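(* Let $\psi:\mathbb R^+\to\mathbb R^+$ be a function, and let $$A(\psi):=\{x\in\mathbb I: a_n(x)\ge\psi(n)\ \text{for infinitely many } n\in\mathbb N\}.$$ Denote $$B_\psi:=\liminf_{n\to\infty}\exp\left(\frac{\log\psi(n)}n\right),\qquad b_\psi:=\liminf_{n\to\infty}\exp\left(\frac{\log\log\psi(n)}n\right).$$ Then $$\dim_{\rm H}A(\psi)=\begin{cases}1,& \text{if } B_\psi=1;\\ \theta(\log B_\psi),&\text{if } 1<B_\psi<\infty;\\ \dfrac1{b_\psi+1},&\text{if } B_\psi=\infty,\end{cases}$$ where, for $B>1$, $\theta(\log B)$ denotes the unique solution $\theta\in(1/2,\infty)$ of $\mathrm P(\theta)=\theta\log B$.
   Context: $\mathbb N=\{1,2,3,\dots\}$, $\mathbb R^+$ is the set of positive reals, and $\mathbb I:=[0,1)\setminus\mathbb Q$. For $x\in\mathbb I$, $a_1(x),a_2(x),\dots\in\mathbb N$ are the coefficients (partial quotients) of its continued fraction expansion $x=[a_1(x),a_2(x),\dots]=1/(a_1(x)+1/(a_2(x)+\cdots))$. For positive integers $a_1,\dots,a_n$, $q_n(a_1,\dots,a_n)$ is the denominator (in lowest terms) of the rational number $[a_1,\dots,a_n]=1/(a_1+1/(a_2+\cdots+1/a_n))$. The Diophantine pressure function is $$\mathrm P(\theta):=\lim_{n\to\infty}\frac1n\log\sum_{a_1,\dots,a_n\in\mathbb N}q_n(a_1,\dots,a_n)^{-2\theta},\qquad \theta>\tfrac12.$$ $\dim_{\rm H}$ denotes Hausdorff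 dimension. The convention $1/\infty=0$ is used. The quantity $b_\psi$ is used only when $B_\psi=\infty$, in which case $\log\log\psi(n)$ is defined for all large $n$ and $b_\psi\in[1,\infty]$. *)

theory Defs
  imports "HOL-Analysis.Analysis"
begin

text \<open>
  The contribution of a covering set to the s-dimensional Hausdorff sum. The case s = 0
  is separated because \<open>0 powr 0 = 0\<close> in HOL, whereas \<open>diam(U)^0\<close> is 1 for nonempty U.
  \<^const>\<open>diameter\<close> is only meaningful on bounded sets, so covers below consist of bounded sets.
\<close>
definition hausdorff_weight :: "real \<Rightarrow> 'a::metric_space set \<Rightarrow> ennreal" where
  "hausdorff_weight s U =
     (if U = {} then 0 else if s = 0 then 1 else ennreal (diameter U powr s))"

definition delta_covers :: "real \<Rightarrow> 'a::metric_space set \<Rightarrow> (nat \<Rightarrow> 'a set) set" where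
  "delta_covers \<delta> A =
     {U. A \<subseteq> (\<Union>i. U i) \<and> (\<forall>i. bounded (U i) \<and> diameter (U i) \<le> \<delta>)}"

definition hausdorff_measure :: "real \<Rightarrow> 'a::metric_space set \<Rightarrow> ennreal" where
  "hausdorff_measure s A =
     (SUP \<delta>\<in>{0<..}. INF U\<in>delta_covers \<delta> A. \<Sum>i. hausdorff_weight s (U i))"

definition hausdorff_dim :: "'a::metric_space set \<Rightarrow> ereal" where
  "hausdorff_dim A = (INF s\<in>{s. 0 \<le> s \<and> hausdorff_measure s A = 0}. ereal s)"

definition unit_irrationals :: "real set" where
  "unit_irrationals = {0..<1} - \<rat>"

primrec cfrac :: "nat list \<Rightarrow> 'a::field_char_0" where
  "cfrac [] = 0"
| "cfrac (a # as) = 1 / (of_nat a + cfrac as)"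

definition cf_denom :: "nat list \<Rightarrow> int" where
  "cf_denom as = snd (quotient_of (cfrac as))"

text \<open>Sequences are indexed from 0 here: \<open>a k\<close> is the partial quotient with number \<open>k + 1\<close>.\<close>
definition is_cf_expansion :: "real \<Rightarrow> (nat \<Rightarrow> nat) \<Rightarrow> bool" where
  "is_cf_expansion x a \<longleftrightarrow>
     (\<forall>k. 1 \<le> a k) \<and> (\<lambda>n. cfrac (map a [0..<n])) \<longlonglongrightarrow> x"

text \<open>The n-th partial quotient of x, for \<open>n \<ge> 1\<close> and \<open>x\<close> in \<^const>\<open>unit_irrationals\<close>.\<close>
definition cf_coeff :: "real \<Rightarrow> nat \<Rightarrow> nat" where
  "cf_coeff x n = (THE a. is_cf_expansion x a) (n - 1)"

definition pressure :: "real \<Rightarrow> real" where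
  "pressure \<theta> = lim (\<lambda>n. 1 / real n *
     ln (\<Sum>\<^sub>\<infinity>as\<in>{as. length as = n \<and> (\<forall>a\<in>set as. 1 \<le> a)}.
           real_of_int (cf_denom as) powr (- 2 * \<theta>)))"

definition pressure_root :: "real \<Rightarrow> real" where
  "pressure_root L = (THE \<theta>. 1 / 2 < \<theta> \<and> pressure \<theta> = \<theta> * L)"

definition A_set :: "(real \<Rightarrow> real) \<Rightarrow> real set" where
  "A_set \<psi> = {x \<in> unit_irrationals.
     infinite {n. 1 \<le> n \<and> \<psi> (real n) \<le> real (cf_coeff x n)}}"

definition B_lower :: "(real \<Rightarrow> real) \<Rightarrow> ereal" where
  "B_lower \<psi> = liminf (\<lambda>n. ereal (exp (ln (\<psi> (real n)) / real n)))"

text \<open>Only used when \<open>B_lower \<psi> = \<infinity>\<close>; then \<open>\<psi>(n) > 1\<close> for all large n, so the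
  values of \<^const>\<open>ln\<close> at nonpositive arguments do not affect the limit inferior.\<close>
definition b_lower :: "(real \<Rightarrow> real) \<Rightarrow> ereal" where
  "b_lower \<psi> = liminf (\<lambda>n. ereal (exp (ln (ln (\<psi> (real n))) / real n)))"

end

theory Submission
  imports Defs "HOL-Probability.Probability" "HOL-Real_Asymp.Real_Asymp"
begin

text \<open>
  Upper bounds come from covering the limsup set by sets indexed by finite words: a point whose
  partial quotient after the word \<open>w\<close> is at least \<open>L\<close> lies in an interval of length \<open>1 / (L q(w)\<^sup>2)\<close>.
  For \<open>B = \<infinity>\<close> one uses that the growth of \<open>\<psi>\<close> forces \<open>q\<^sub>n\<^sub>+\<^sub>1 \<ge> q\<^sub>n powr c\<close> infinitely often.
  Lower bounds come from the mass distribution principle for random digits: independent and of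
  doubly exponential size for \<open>B = \<infinity>\<close>; for finite \<open>B\<close>, independent blocks distributed
  proportionally to \<open>q\<^sup>-\<^sup>2\<^sup>s\<close>, interrupted at very sparse times \<open>n\<close> by one digit of size about \<open>B\<^sup>n\<close>.
  The condition \<open>P(s) > s log B\<close> is what makes the mass of the blocks compensate these digits.
\<close>

section \<open>Continuants\<close>

text \<open>For infinite B, intervals of length 1 / (L q^2) with L depending only on n never give a
  bound below 1/2, since the sum of q^(-2s) over words of fixed length diverges for s \<le> 1/2.
  Bounding the next denominator from below by q^c makes the intervals shorter, about q^(-1-c), and
  the sums converge once s (1 + c) > 1. The lower bounds need points with different digits to be
  separated. This fails for neighbouring digits a and a + 1 when a is followed by 1 and then by a
  huge digit, so the constructions never place 1 before a huge digit. For finite B the pressure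
  enters through the multiplicativity of q up to a factor 2: a finite set of blocks with bounded
  digits already realises a rate close to P(s). Ordinary blocks gain a fixed exponential factor over
  q^(-2s), and the wait before a large digit N is long enough to collect N^(-s). The digit itself
  costs about N^(2s-1), which leaves N^(s-1) \<le> 1, so the reserve is rebuilt from a bounded value
  before the next large digit.\<close>

fun cnum :: "nat \<Rightarrow> nat \<Rightarrow> nat list \<Rightarrow> nat" and cden :: "nat \<Rightarrow> nat \<Rightarrow> nat list \<Rightarrow> nat" where
  "cnum x y [] = x"
| "cnum x y (a # w) = cden x y w"
| "cden x y [] = y"
| "cden x y (a # w) = a * cden x y w + cnum x y w"

text \<open>\<open>cP w / cQ w\<close> is the convergent \<open>p\<^sub>n / q\<^sub>n\<close> of the word \<open>w\<close>; the primed versions are \<open>p\<^sub>n\<^sub>-\<^sub>1\<close> and \<open>q\<^sub>n\<^sub>-\<^sub>1\<close>.\<close>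

abbreviation cP :: "nat list \<Rightarrow> nat" where "cP \<equiv> cnum 0 (Suc 0)"
abbreviation cQ :: "nat list \<Rightarrow> nat" where "cQ \<equiv> cden 0 (Suc 0)"
abbreviation rQ :: "nat list \<Rightarrow> real" where "rQ w \<equiv> real (cQ w)"
abbreviation cP' :: "nat list \<Rightarrow> nat" where "cP' \<equiv> cnum (Suc 0) 0"
abbreviation cQ' :: "nat list \<Rightarrow> nat" where "cQ' \<equiv> cden (Suc 0) 0"

definition pos_word :: "nat list \<Rightarrow> bool" where
  "pos_word w \<longleftrightarrow> (\<forall>a\<in>set w. 1 \<le> a)"

lemma pos_word_simps [simp]:
  "pos_word []" "pos_word (a # w) \<longleftrightarrow> 1 \<le> a \<and> pos_word w"
  "pos_word (u @ v) \<longleftrightarrow> pos_word u \<and> pos_word v"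
  by (auto simp: pos_word_def)

text \<open>Reading a digit is a linear map on the pair (numerator, denominator), so every seed
  \<open>x\<close>, \<open>y\<close> at the end of a word is a combination of the two basic seeds,
  and concatenation becomes composition.\<close>

lemma cnum_cden_linear:
  "cnum x y w = x * cP' w + y * cP w \<and> cden x y w = x * cQ' w + y * cQ w"
  by (induction w) (auto simp: algebra_simps)

lemma cnum_cden_append:
  "cnum x y (u @ v) = cnum (cnum x y v) (cden x y v) u \<and>
   cden x y (u @ v) = cden (cnum x y v) (cden x y v) u"
  by (induction u) auto

lemma cQ_append: "cQ (u @ v) = cP v * cQ' u + cQ v * cQ u"
  using cnum_cden_append[of 0 "Suc 0" u v] cnum_cden_linear[of "cP v" "cQ v" u] by simp

lemma cQ_pos: "pos_word w \<Longrightarrow> 1 \<le> cQ w"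
  by (induction w) (auto simp: Suc_le_eq)

lemma rQ_pos: "pos_word w \<Longrightarrow> 0 < rQ w"
  using cQ_pos[of w] by simp

lemma cP_le_cQ: "pos_word w \<Longrightarrow> cP w \<le> cQ w"
proof (cases w)
  case (Cons a v)
  assume "pos_word w"
  then show ?thesis
    using Cons by (cases a) auto
qed auto

text \<open>The recursion for denominators involves numerators, so the induction carries both. The
  empty word is excluded for numerators because there \<open>cP'\<close> is 1 and \<open>cP\<close>
  is 0.\<close>

lemma cQ'_le_cQ: "pos_word w \<Longrightarrow> cQ' w \<le> cQ w"
proof -
  have "pos_word w \<Longrightarrow> cQ' w \<le> cQ w \<and> (w \<noteq> [] \<longrightarrow> cP' w \<le> cP w)"
  proof (induction w)
    case (Cons a w)
    show ?case
    proof (cases "w = []")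
      case False
      then show ?thesis using Cons by (auto intro!: add_mono mult_le_mono)
    qed (use Cons in auto)
  qed auto
  then show "pos_word w \<Longrightarrow> cQ' w \<le> cQ w" by blast
qed

lemma cQ_append_ge: "cQ u * cQ v \<le> cQ (u @ v)"
  by (simp add: cQ_append)

lemma cQ_append_le:
  assumes "pos_word u" "pos_word v"
  shows "cQ (u @ v) \<le> 2 * (cQ u * cQ v)"
proof -
  have "cP v * cQ' u \<le> cQ v * cQ u"
    using assms by (intro mult_le_mono cP_le_cQ cQ'_le_cQ)
  then show ?thesis by (simp add: cQ_append algebra_simps)
qed

lemma cQ_Cons_le: "pos_word w \<Longrightarrow> cQ (a # w) \<le> (a + 1) * cQ w"
  using cP_le_cQ[of w] by (simp add: algebra_simps)

lemma cQ_snoc: "cQ (w @ [a]) = cQ' w + a * cQ w"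
  by (simp add: cQ_append)

lemma cQ_snoc_le: "pos_word w \<Longrightarrow> cQ (w @ [a]) \<le> (a + 1) * cQ w"
  using cQ'_le_cQ[of w] by (simp add: cQ_snoc)

lemma cQ_mono_Cons: "pos_word (a # w) \<Longrightarrow> cQ w \<le> cQ (a # w)"
  using mult_le_mono1[of 1 a "cQ w"] by (auto simp: trans_le_add1)

text \<open>Two digits at least double the denominator, hence multiply its square by 4; the factor 2
  on the right pays for a single leftover digit.\<close>

lemma cQ_growth: "pos_word w \<Longrightarrow> 2 ^ length w \<le> 2 * (cQ w)\<^sup>2"
proof (induction w rule: induct_list012)
  case (3 a b w)
  have "2 * cQ w \<le> cQ (a # b # w)"
  proof -
    have "1 * cQ (b # w) \<le> a * cQ (b # w)" using 3 by (intro mult_le_mono1) auto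
    moreover have "cQ w \<le> cQ (b # w)" using 3 by (intro cQ_mono_Cons) auto
    moreover have "cQ (a # b # w) = a * cQ (b # w) + cQ w" by simp
    ultimately show ?thesis by linarith
  qed
  then have "(2 * cQ w)\<^sup>2 \<le> (cQ (a # b # w))\<^sup>2"
    by (rule power_mono) simp
  moreover have "2 ^ length w \<le> 2 * (cQ w)\<^sup>2" using 3 by auto
  ultimately show ?case by (simp add: power2_eq_square)
qed (auto simp: Suc_le_eq)

text \<open>Every digit contributes a matrix of determinant -1. This yields both the coprimality
  behind \<open>cf_denom_eq\<close> and the exact distance formula \<open>cft_diff\<close>.\<close>

lemma cf_det: "\<bar>int (cP w) * int (cQ' w) - int (cP' w) * int (cQ w)\<bar> = 1"
proof (induction w)
  case (Cons a w)
  have "int (cP (a # w)) * int (cQ' (a # w)) - int (cP' (a # w)) * int (cQ (a # w))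
      = - (int (cP w) * int (cQ' w) - int (cP' w) * int (cQ w))"
    by (simp add: algebra_simps)
  then show ?case using Cons by (simp only: abs_minus_cancel)
qed auto

section \<open>Finite continued fractions with a real tail\<close>

primrec cft :: "nat list \<Rightarrow> 'a::field_char_0 \<Rightarrow> 'a" where
  "cft [] t = t"
| "cft (a # w) t = 1 / (of_nat a + cft w t)"

lemma cfrac_eq_cft: "cfrac w = cft w 0"
  by (induction w) auto

lemma cft_append: "cft (u @ v) t = cft u (cft v t)"
  by (induction u) auto

text \<open>Generic in the field because \<open>cf_denom\<close> is defined through rational
  numbers, whereas all metric estimates take place in the reals.\<close>

lemma cft_eq_quotient:
  fixes t :: "'a :: linordered_field"
  assumes "pos_word w" "0 \<le> t"
  shows "cft w t = (of_nat (cP w) + t * of_nat (cP' w)) / (of_nat (cQ w) + t * of_nat (cQ' w))"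
  using assms
proof (induction w)
  case (Cons a w)
  have *: "(of_nat (cQ w) + t * of_nat (cQ' w) :: 'a) > 0"
    using Cons.prems cQ_pos[of w] by (intro add_pos_nonneg) auto
  have "cft (a # w) t = 1 / (of_nat a + (of_nat (cP w) + t * of_nat (cP' w)) / (of_nat (cQ w) + t * of_nat (cQ' w)))"
    using Cons by simp
  also have "of_nat a + (of_nat (cP w) + t * of_nat (cP' w)) / (of_nat (cQ w) + t * of_nat (cQ' w))
     = (of_nat (cQ (a # w)) + t * of_nat (cQ' (a # w))) / (of_nat (cQ w) + t * of_nat (cQ' w))"
    using * by (simp add: divide_simps) (simp add: algebra_simps)
  finally show ?case by simp
qed auto

lemma cf_denom_eq:
  assumes "pos_word w"
  shows "cf_denom w = int (cQ w)"
proof -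
  have q: "cQ w > 0" using cQ_pos[OF assms] by simp
  have "cfrac w = Fract (int (cP w)) (int (cQ w))"
    using q assms by (simp add: cfrac_eq_cft cft_eq_quotient Fract_of_int_quotient)
  moreover have "coprime (int (cP w)) (int (cQ w))"
  proof (rule coprimeI)
    fix c assume "c dvd int (cP w)" "c dvd int (cQ w)"
    then have "c dvd int (cP w) * int (cQ' w) - int (cP' w) * int (cQ w)"
      by (intro dvd_diff dvd_mult dvd_mult2)
    then show "is_unit c" using cf_det[of w] by (metis dvd_abs_iff)
  qed
  ultimately show ?thesis
    using q by (simp add: cf_denom_def quotient_of_Fract)
qed

lemma cft_nonneg: "0 \<le> t \<Longrightarrow> 0 \<le> cft w (t::real)"
  by (induction w) auto

lemma cft_le_1: 
  assumes "pos_word w" "0 \<le> t" "t \<le> 1"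
  shows "cft w (t::real) \<le> 1"
proof (cases w)
  case (Cons a v)
  have "1 \<le> real a + cft v t" using assms Cons cft_nonneg[of t v] by auto
  then show ?thesis using Cons by simp
qed (use assms in auto)

lemma cft_diff:
  fixes t t' :: real
  assumes "pos_word w" "0 \<le> t" "0 \<le> t'"
  shows "\<bar>cft w t - cft w t'\<bar>
    = \<bar>t - t'\<bar> / ((cQ w + t * cQ' w) * (cQ w + t' * cQ' w))"
proof -
  let ?P = "real (cP w)" and ?Q = "rQ w" and ?P' = "real (cP' w)" and ?Q' = "real (cQ' w)"
  have q: "?Q > 0" using cQ_pos[OF assms(1)] by simp
  have 1: "?Q + t * ?Q' > 0" "?Q + t' * ?Q' > 0" using q assms by (auto intro: add_pos_nonneg)
  have "cft w t - cft w t' = (?P + t * ?P') / (?Q + t * ?Q') - (?P + t' * ?P') / (?Q + t' * ?Q')"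
    using assms by (simp add: cft_eq_quotient)
  also have "\<dots> = ((?P + t * ?P') * (?Q + t' * ?Q') - (?P + t' * ?P') * (?Q + t * ?Q')) /
      ((?Q + t * ?Q') * (?Q + t' * ?Q'))"
    using 1 by (simp add: diff_frac_eq)
  also have "(?P + t * ?P') * (?Q + t' * ?Q') - (?P + t' * ?P') * (?Q + t * ?Q')
      = (t' - t) * (?P * ?Q' - ?P' * ?Q)"
    by (simp add: algebra_simps)
  finally have "\<bar>cft w t - cft w t'\<bar> = \<bar>(t' - t) * (?P * ?Q' - ?P' * ?Q)\<bar> /
      \<bar>(?Q + t * ?Q') * (?Q + t' * ?Q')\<bar>"
    by simp
  moreover have "\<bar>?P * ?Q' - ?P' * ?Q\<bar> = 1"
  proof -
    have "\<bar>?P * ?Q' - ?P' * ?Q\<bar> = real_of_int \<bar>int (cP w) * int (cQ' w) - int (cP' w) * int (cQ w)\<bar>"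
      by simp
    then show ?thesis using cf_det[of w] by simp
  qed
  ultimately show ?thesis using 1 by (simp add: abs_mult abs_minus_commute)
qed

lemma cft_diff_le:
  fixes t t' :: real
  assumes "pos_word w" "0 \<le> t" "0 \<le> t'"
  shows "\<bar>cft w t - cft w t'\<bar> \<le> \<bar>t - t'\<bar> / (rQ w)\<^sup>2"
proof -
  have q: "rQ w > 0" using cQ_pos[OF assms(1)] by simp
  have "rQ w * rQ w \<le> (cQ w + t * cQ' w) * (cQ w + t' * cQ' w)"
    using assms by (intro mult_mono) auto
  then show ?thesis
    unfolding cft_diff[OF assms] using q assms
    by (auto simp: power2_eq_square intro!: divide_left_mono mult_pos_pos add_pos_nonneg)
qed

text \<open>For tails in [0, 1] both factors of the exact denominator are at most
  \<open>2 * cQ w\<close>, since \<open>cQ' w\<close> does not exceed \<open>cQ w\<close>. Together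
  with \<open>cft_diff_le\<close>, \<open>cft w\<close> contracts distances by 1 / q^2 up to the
  factor 4.\<close>

lemma cft_diff_ge:
  fixes t t' :: real
  assumes "pos_word w" "0 \<le> t" "0 \<le> t'" "t \<le> 1" "t' \<le> 1"
  shows "\<bar>t - t'\<bar> / (4 * (rQ w)\<^sup>2) \<le> \<bar>cft w t - cft w t'\<bar>"
proof -
  have q: "rQ w > 0" using cQ_pos[OF assms(1)] by simp
  have q': "real (cQ' w) \<le> rQ w" using cQ'_le_cQ[OF assms(1)] by simp
  have *: "rQ w + s * real (cQ' w) \<le> 2 * rQ w" if "0 \<le> s" "s \<le> 1" for s :: real
    using that q' mult_mono[of s 1 "real (cQ' w)" "rQ w"] by auto
  have "(cQ w + t * cQ' w) * (cQ w + t' * cQ' w) \<le> (2 * rQ w) * (2 * rQ w)"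
    using assms q by (intro mult_mono[OF * *] mult_nonneg_nonneg add_nonneg_nonneg) auto
  also have "\<dots> = 4 * (rQ w)\<^sup>2" by (simp add: power2_eq_square)
  finally show ?thesis
    unfolding cft_diff[OF assms(1-3)] using q assms
    by (intro divide_left_mono) (auto intro!: mult_pos_pos add_pos_nonneg)
qed

lemma continuous_cft: "pos_word w \<Longrightarrow> continuous_on {0..} (cft w :: real \<Rightarrow> real)"
proof (induction w)
  case (Cons a w)
  show ?case
    using Cons by (auto intro!: continuous_intros simp: add_nonneg_eq_0_iff cft_nonneg)
qed (auto intro: continuous_on_id)

section \<open>Infinite continued fractions\<close>

definition pre :: "nat \<Rightarrow> (nat \<Rightarrow> nat) \<Rightarrow> nat list" where
  "pre n a = map a [0..<n]"

definition shift :: "nat \<Rightarrow> (nat \<Rightarrow> nat) \<Rightarrow> nat \<Rightarrow> nat" where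
  "shift n a = (\<lambda>k. a (n + k))"

definition pos_seq :: "(nat \<Rightarrow> nat) \<Rightarrow> bool" where
  "pos_seq a \<longleftrightarrow> (\<forall>k. 1 \<le> a k)"

definition cval :: "(nat \<Rightarrow> nat) \<Rightarrow> real" where
  "cval a = lim (\<lambda>n. cfrac (pre n a))"

lemma length_pre [simp]: "length (pre n a) = n"
  by (simp add: pre_def)

lemma pre_0 [simp]: "pre 0 a = []"
  by (simp add: pre_def)

lemma pre_Suc: "pre (Suc n) a = pre n a @ [a n]"
  by (simp add: pre_def)

lemma pre_eq_iff: "pre n a = pre n b \<longleftrightarrow> (\<forall>k<n. a k = b k)"
  by (auto simp: pre_def)

lemma pre_nth: "k < n \<Longrightarrow> pre n a ! k = a k"
  by (simp add: pre_def)

lemma pre_add: "pre (n + m) a = pre n a @ pre m (shift n a)"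
  by (auto simp: pre_def shift_def list_eq_iff_nth_eq nth_append)

lemma shift_shift: "shift n (shift m a) = shift (m + n) a"
  by (simp add: shift_def add.assoc)

lemma pos_seq_shift: "pos_seq a \<Longrightarrow> pos_seq (shift n a)"
  by (simp add: pos_seq_def shift_def)

lemma pos_word_pre: "pos_seq a \<Longrightarrow> pos_word (pre n a)"
  by (auto simp: pos_seq_def pos_word_def pre_def)

lemma cfrac_bounds:
  assumes "pos_word w"
  shows "0 \<le> (cfrac w :: real)" "(cfrac w :: real) \<le> 1"
  using assms cft_nonneg[of 0 w] cft_le_1[of w 0] by (auto simp: cfrac_eq_cft)

lemma inverse_cQ_le: "pos_word w \<Longrightarrow> 1 / (rQ w)\<^sup>2 \<le> 2 * (1 / 2) ^ length w"
proof -
  assume w: "pos_word w"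
  have "real (2 ^ length w) \<le> real (2 * (cQ w)\<^sup>2)"
    using cQ_growth[OF w] of_nat_le_iff by blast
  moreover have "0 < rQ w" by (rule rQ_pos[OF w])
  ultimately show ?thesis by (simp add: field_simps)
qed

text \<open>Convergents sharing a prefix of length n are images of points of [0, 1] under the same
  \<open>cft\<close>, so they differ by at most 1 / q^2, which decays geometrically.\<close>

lemma cfrac_convergent:
  assumes "pos_seq a"
  shows "(\<lambda>n. cfrac (pre n a)) \<longlonglongrightarrow> cval a"
proof -
  let ?f = "\<lambda>n. cfrac (pre n a) :: real"
  have 1: "\<bar>?f (n + m) - ?f n\<bar> \<le> 2 * (1 / 2) ^ n" for n m
  proof -
    have "?f (n + m) - ?f n = cft (pre n a) (cfrac (pre m (shift n a))) - cft (pre n a) 0"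
      by (simp add: pre_add cft_append cfrac_eq_cft)
    also have "\<bar>\<dots>\<bar> \<le> \<bar>cfrac (pre m (shift n a)) - 0\<bar> / (rQ (pre n a))\<^sup>2"
      using assms by (intro cft_diff_le pos_word_pre cfrac_bounds pos_seq_shift) auto
    also have "\<dots> \<le> 1 / (rQ (pre n a))\<^sup>2"
      using cfrac_bounds[OF pos_word_pre[OF pos_seq_shift[OF assms]], of m n]
      by (intro divide_right_mono) auto
    also have "\<dots> \<le> 2 * (1 / 2) ^ n"
      using inverse_cQ_le[OF pos_word_pre[OF assms], of n] by simp
    finally show ?thesis .
  qed
  have "Cauchy ?f"
  proof (rule metric_CauchyI)
    fix e :: real assume e: "e > 0"
    have "(\<lambda>n. 4 * (1 / 2) ^ n :: real) \<longlonglongrightarrow> 0" by real_asymp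
    then have "eventually (\<lambda>n. 4 * (1 / 2) ^ n < e) sequentially"
      using e by (rule order_tendstoD)
    then obtain N where N: "4 * (1 / 2) ^ N < e"
      unfolding eventually_sequentially by blast
    have "dist (?f m) (?f n) < e" if "m \<ge> N" "n \<ge> N" for m n
    proof -
      have "\<bar>?f m - ?f N\<bar> \<le> 2 * (1 / 2) ^ N" "\<bar>?f n - ?f N\<bar> \<le> 2 * (1 / 2) ^ N"
        using 1[of N "m - N"] 1[of N "n - N"] that by auto
      then show ?thesis using N by (simp add: dist_real_def)
    qed
    then show "\<exists>M. \<forall>m\<ge>M. \<forall>n\<ge>M. dist (?f m) (?f n) < e" by blast
  qed
  then have "convergent ?f" by (rule Cauchy_convergent)
  then show ?thesis unfolding cval_def by (simp add: convergent_LIMSEQ_iff)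
qed

lemma cval_bounds_weak:
  assumes "pos_seq a"
  shows "0 \<le> cval a" "cval a \<le> 1"
  using cfrac_convergent[OF assms] cfrac_bounds[OF pos_word_pre[OF assms]]
  by (auto intro: LIMSEQ_le_const LIMSEQ_le_const2)

lemma cval_tail:
  assumes "pos_seq a"
  shows "cval a = cft (pre n a) (cval (shift n a))"
proof -
  have "(\<lambda>m. cfrac (pre (n + m) a)) \<longlonglongrightarrow> cval a"
    using LIMSEQ_ignore_initial_segment[OF cfrac_convergent[OF assms], of n]
    by (simp add: add.commute)
  moreover have "(\<lambda>m. cft (pre n a) (cfrac (pre m (shift n a)))) \<longlonglongrightarrow> cft (pre n a) (cval (shift n a))"
    using assms
    by (intro continuous_on_tendsto_compose[OF continuous_cft] cfrac_convergent)
       (auto intro!: pos_word_pre pos_seq_shift cval_bounds_weak always_eventually cfrac_bounds)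
  moreover have "cfrac (pre (n + m) a) = cft (pre n a) (cfrac (pre m (shift n a)) :: real)" for m
    by (simp add: pre_add cft_append cfrac_eq_cft)
  ultimately show ?thesis by (simp add: LIMSEQ_unique)
qed

lemma cval_step: 
  assumes "pos_seq a"
  shows "cval a = 1 / (real (a 0) + cval (shift 1 a))"
  using cval_tail[OF assms, of 1] by (simp add: pre_def)

lemma cval_bounds:
  assumes "pos_seq a"
  shows "0 < cval a" "cval a < 1"
proof -
  have p: "0 < cval a" if "pos_seq a" for a
  proof -
    have "real (a 0) \<ge> 1" using that by (auto simp: pos_seq_def)
    moreover have "cval (shift 1 a) \<ge> 0" by (intro cval_bounds_weak pos_seq_shift that)
    ultimately show ?thesis unfolding cval_step[OF that] by simp
  qed
  show "0 < cval a" by (rule p[OF assms])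
  have "real (a 0) \<ge> 1" using assms by (auto simp: pos_seq_def)
  moreover have "cval (shift 1 a) > 0" by (intro p pos_seq_shift assms)
  ultimately show "cval a < 1" unfolding cval_step[OF assms] by simp
qed

lemma cval_first_digit:
  assumes "pos_seq a"
  shows "\<lfloor>1 / cval a\<rfloor> = int (a 0)" "frac (1 / cval a) = cval (shift 1 a)"
proof -
  have *: "1 / cval a = real (a 0) + cval (shift 1 a)"
    unfolding cval_step[OF assms] by simp
  note b = cval_bounds[OF pos_seq_shift[OF assms, of 1]]
  show 1: "\<lfloor>1 / cval a\<rfloor> = int (a 0)" unfolding * using b by (simp add: floor_eq_iff)
  show "frac (1 / cval a) = cval (shift 1 a)" unfolding frac_def 1 unfolding * by simp
qed

lemma cval_inj:
  assumes "pos_seq a" "pos_seq b" "cval a = cval b"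
  shows "a = b"
proof
  fix k
  have "a k = b k" if "pos_seq a" "pos_seq b" "cval a = cval b" for a b
    using that
  proof (induction k arbitrary: a b)
    case 0
    then show ?case using cval_first_digit(1) by (metis of_nat_eq_iff)
  next
    case (Suc k)
    have "shift 1 a k = shift 1 b k"
      using Suc.prems by (intro Suc.IH pos_seq_shift) (metis cval_first_digit(2))+
    then show ?case by (simp add: shift_def)
  qed
  then show "a k = b k" using assms by blast
qed

text \<open>A value i / n differs from each convergent by a nonzero fraction with denominator n q,
  hence by at least 1 / (n q), while the contraction bound allows at most 1 / q^2. This forces q
  \<le> n, although q is unbounded.\<close>

lemma cval_irrational:
  assumes "pos_seq a"
  shows "cval a \<notin> \<rat>"
proof
  assume "cval a \<in> \<rat>"
  then obtain i n where n: "n > 0" and i: "cval a = real_of_int i / real_of_int n"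
    by (auto elim: Rats_cases')
  have "(\<lambda>k. 2 * (1 / 2) ^ k * real_of_int n ^ 2) \<longlonglongrightarrow> 0" by real_asymp
  then have "eventually (\<lambda>k. 2 * (1 / 2) ^ k * real_of_int n ^ 2 < 1) sequentially"
    by (rule order_tendstoD) simp
  then obtain k where k: "2 * (1 / 2) ^ k * real_of_int n ^ 2 < 1"
    unfolding eventually_sequentially by blast
  define w where "w = pre k a"
  define t where "t = cval (shift k a)"
  have w: "pos_word w" unfolding w_def by (rule pos_word_pre[OF assms])
  have t: "0 < t" "t < 1" unfolding t_def by (intro cval_bounds pos_seq_shift assms)+
  have q: "0 < rQ w" by (rule rQ_pos[OF w])
  have d: "\<bar>cft w t - cft w 0\<bar> = t / ((cQ w + t * cQ' w) * cQ w)"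
    using cft_diff[OF w, of t 0] t by simp
  have pos: "\<bar>cft w t - cft w 0\<bar> > 0"
    unfolding d using q t by (intro divide_pos_pos mult_pos_pos add_pos_nonneg) auto
  have le: "\<bar>cft w t - cft w 0\<bar> \<le> 1 / (rQ w)\<^sup>2"
  proof -
    have "\<bar>cft w t - cft w 0\<bar> \<le> \<bar>t - 0\<bar> / (rQ w)\<^sup>2" using t by (intro cft_diff_le w) auto
    also have "\<dots> \<le> 1 / (rQ w)\<^sup>2" using t by (intro divide_right_mono) auto
    finally show ?thesis .
  qed
  have eq: "cft w t - cft w 0 = (real_of_int i * cQ w - real_of_int n * cP w) / (real_of_int n * cQ w)"
  proof -
    have "cft w t = cval a" unfolding w_def t_def by (simp add: cval_tail[OF assms, symmetric])
    moreover have "cft w (0::real) = cP w / cQ w" using w by (simp add: cft_eq_quotient)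
    ultimately show ?thesis using i n q by (simp add: field_simps)
  qed
  define z where "z = i * int (cQ w) - n * int (cP w)"
  have eq': "\<bar>cft w t - cft w 0\<bar> = real_of_int \<bar>z\<bar> / (real_of_int n * cQ w)"
    unfolding eq z_def using n by (simp add: abs_mult)
  have "z \<noteq> 0" using pos eq' by auto
  then have "1 \<le> real_of_int \<bar>z\<bar>" by linarith
  then have "1 / (real_of_int n * cQ w) \<le> real_of_int \<bar>z\<bar> / (real_of_int n * cQ w)"
    using n q by (intro divide_right_mono) auto
  then have "1 / (real_of_int n * cQ w) \<le> 1 / (rQ w)\<^sup>2" using le eq' by linarith
  then have "rQ w \<le> real_of_int n"
    using n q by (simp add: field_simps power2_eq_square)
  then have "(cQ w)\<^sup>2 \<le> (real_of_int n)\<^sup>2" using q by (simp add: power_mono)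
  moreover have "1 \<le> 2 * (1 / 2) ^ k * (rQ w)\<^sup>2"
    using inverse_cQ_le[OF w] q by (simp add: field_simps w_def)
  moreover have "2 * (1 / 2) ^ k * (rQ w)\<^sup>2 \<le> 2 * (1 / 2) ^ k * (real_of_int n)\<^sup>2"
    using calculation(1) by (intro mult_left_mono) auto
  ultimately show False using k by linarith
qed

text \<open>The expansion of an irrational is read off the orbit of the Gauss map.\<close>

lemma cval_exists:
  assumes "0 < x" "x < 1" "x \<notin> \<rat>"
  shows "\<exists>a. pos_seq a \<and> cval a = x"
proof -
  define g where "g = (\<lambda>x::real. frac (1 / x))"
  define y where "y = (\<lambda>n. (g ^^ n) x)"
  define a where "a = (\<lambda>n. nat \<lfloor>1 / y n\<rfloor>)"
  have y: "0 < y n \<and> y n < 1 \<and> y n \<notin> \<rat>" for n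
  proof (induction n)
    case (Suc n)
    have 1: "1 / y n \<notin> \<rat>"
    proof
      assume "1 / y n \<in> \<rat>"
      then have "inverse (1 / y n) \<in> \<rat>" by (rule Rats_inverse)
      then show False using Suc by simp
    qed
    have "frac (1 / y n) \<notin> \<rat>"
    proof
      assume "frac (1 / y n) \<in> \<rat>"
      then have "frac (1 / y n) + of_int \<lfloor>1 / y n\<rfloor> \<in> \<rat>" by (intro Rats_add) auto
      then show False using 1 by (simp add: frac_def)
    qed
    moreover have "frac (1 / y n) \<noteq> 0"
    proof
      assume "frac (1 / y n) = 0"
      then show False using calculation by (metis Rats_0)
    qed
    ultimately show ?case
      using frac_ge_0[of "1 / y n"] frac_lt_1[of "1 / y n"] by (simp add: y_def g_def)
  qed (use assms in \<open>auto simp: y_def\<close>)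
  have a1: "1 \<le> a n" and step: "y n = 1 / (real (a n) + y (Suc n))" for n
  proof -
    have "1 \<le> 1 / y n" using y[of n] by simp
    then have f: "1 \<le> \<lfloor>1 / y n\<rfloor>" by (simp add: le_floor_iff)
    then show "1 \<le> a n" unfolding a_def by linarith
    have "real (a n) = of_int \<lfloor>1 / y n\<rfloor>"
      unfolding a_def by (rule of_nat_nat) (use f in linarith)
    then have "real (a n) + y (Suc n) = 1 / y n" by (simp add: y_def g_def frac_def)
    then show "y n = 1 / (real (a n) + y (Suc n))" by simp
  qed
  have pa: "pos_seq a" using a1 by (simp add: pos_seq_def)
  have x: "x = cft (pre n a) (y n)" for n
  proof (induction n)
    case (Suc n)
    then show ?case using step[of n] by (simp add: pre_Suc cft_append)
  qed (auto simp: y_def)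
  have "(\<lambda>n. cfrac (pre n a)) \<longlonglongrightarrow> x"
  proof (rule LIMSEQ_I)
    fix e :: real assume e: "e > 0"
    have "(\<lambda>k. 2 * (1 / 2) ^ k :: real) \<longlonglongrightarrow> 0" by real_asymp
    then have "eventually (\<lambda>k. 2 * (1 / 2) ^ k < e) sequentially"
      using e by (rule order_tendstoD)
    then obtain N where N: "\<And>k. k \<ge> N \<Longrightarrow> 2 * (1 / 2) ^ k < e"
      unfolding eventually_sequentially by blast
    have "norm (cfrac (pre n a) - x) < e" if "n \<ge> N" for n
    proof -
      have "norm (cfrac (pre n a) - x) = \<bar>cft (pre n a) 0 - cft (pre n a) (y n)\<bar>"
        using x[of n] by (simp add: cfrac_eq_cft)
      also have "\<dots> \<le> \<bar>0 - y n\<bar> / (rQ (pre n a))\<^sup>2"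
        using y[of n] by (intro cft_diff_le pos_word_pre pa) auto
      also have "\<dots> \<le> 1 / (rQ (pre n a))\<^sup>2" using y[of n] by (intro divide_right_mono) auto
      also have "\<dots> \<le> 2 * (1 / 2) ^ n"
        using inverse_cQ_le[OF pos_word_pre[OF pa], of n] by simp
      also have "\<dots> < e" by (rule N[OF that])
      finally show ?thesis .
    qed
    then show "\<exists>no. \<forall>n\<ge>no. norm (cfrac (pre n a) - x) < e" by blast
  qed
  then have "x = cval a" using cfrac_convergent[OF pa] LIMSEQ_unique by blast
  then show ?thesis using pa by blast
qed

lemma is_cf_expansion_iff: "is_cf_expansion x a \<longleftrightarrow> pos_seq a \<and> cval a = x"
proof -
  have "is_cf_expansion x a \<longleftrightarrow> pos_seq a \<and> (\<lambda>n. cfrac (pre n a)) \<longlonglongrightarrow> x"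
    by (auto simp: is_cf_expansion_def pos_seq_def pre_def)
  then show ?thesis using cfrac_convergent LIMSEQ_unique by blast
qed

lemma unit_irrationals_eq: "unit_irrationals = cval ` {a. pos_seq a}"
proof (intro equalityI subsetI)
  fix x assume x: "x \<in> unit_irrationals"
  then have "x \<noteq> 0" by (auto simp: unit_irrationals_def)
  then show "x \<in> cval ` {a. pos_seq a}"
    using cval_exists[of x] x by (auto simp: unit_irrationals_def)
next
  fix x assume "x \<in> cval ` {a. pos_seq a}"
  then show "x \<in> unit_irrationals"
    using cval_bounds cval_irrational by (auto simp: unit_irrationals_def less_imp_le)
qed

lemma cf_coeff_cval:
  assumes "pos_seq a"
  shows "cf_coeff (cval a) n = a (n - 1)"
proof -
  have "(THE b. is_cf_expansion (cval a) b) = a"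
    using assms cval_inj by (intro the_equality) (auto simp: is_cf_expansion_iff)
  then show ?thesis by (simp add: cf_coeff_def)
qed

text \<open>\<open>Suc n\<close> accounts for digits being numbered from 0 here. The
  infinitely-often form can be combined directly with eventual bounds on \<psi>.\<close>

lemma A_set_eq:
  "A_set \<psi> = cval ` {a. pos_seq a \<and> (\<exists>\<^sub>\<infinity>n. \<psi> (real (Suc n)) \<le> real (a n))}"
proof -
  have *: "finite {n. 1 \<le> n \<and> \<psi> (real n) \<le> real (a (n - 1))} \<longleftrightarrow>
      \<not> (\<exists>\<^sub>\<infinity>n. \<psi> (real (Suc n)) \<le> real (a n))" for a :: "nat \<Rightarrow> nat"
  proof -
    have "{n. 1 \<le> n \<and> \<psi> (real n) \<le> real (a (n - 1))} = Suc ` {n. \<psi> (real (Suc n)) \<le> real (a n)}"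
    proof (intro equalityI subsetI)
      fix n assume "n \<in> {n. 1 \<le> n \<and> \<psi> (real n) \<le> real (a (n - 1))}"
      then show "n \<in> Suc ` {n. \<psi> (real (Suc n)) \<le> real (a n)}"
        by (intro image_eqI[of _ _ "n - 1"]) auto
    qed auto
    then show ?thesis by (simp add: finite_image_iff frequently_cofinite)
  qed
  then show ?thesis
    unfolding A_set_def unit_irrationals_eq
    by (auto simp: cf_coeff_cval * simp del: One_nat_def of_nat_Suc)
qed

section \<open>Bounds for the Hausdorff dimension\<close>

lemma hausdorff_dim_le:
  assumes "0 \<le> s" "hausdorff_measure s A = 0"
  shows "hausdorff_dim A \<le> ereal s"
  unfolding hausdorff_dim_def using assms by (intro INF_lower) auto

lemma hausdorff_weight_le:
  assumes "0 < s" "diameter U \<le> d" "bounded U"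
  shows "hausdorff_weight s U \<le> ennreal (d powr s)"
  using assms diameter_ge_0[OF assms(3)]
  by (auto simp: hausdorff_weight_def intro!: ennreal_leI powr_mono2)

text \<open>First half of Borel-Cantelli: every tail of the sequence covers \<open>A\<close>, tails
  of a convergent series have arbitrarily small sums, and the terms eventually fall below the
  admissible diameter.\<close>

lemma hausdorff_measure_limsup_nat:
  fixes U :: "nat \<Rightarrow> 'a::metric_space set"
  assumes s: "0 < s" and bdd: "\<And>i. bounded (U i)" and diam: "\<And>i. diameter (U i) \<le> d i"
    and summ: "summable (\<lambda>i. d i powr s)"
    and A: "\<And>x. x \<in> A \<Longrightarrow> \<exists>\<^sub>\<infinity>i. x \<in> U i"
  shows "hausdorff_measure s A = 0"
proof -
  have d0: "0 \<le> d i" for i using diam[of i] diameter_ge_0[OF bdd[of i]] by linarith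
  have "(INF V\<in>delta_covers \<delta> A. \<Sum>i. hausdorff_weight s (V i)) = 0" (is "?inf = 0") if \<delta>: "\<delta> > 0" for \<delta>
  proof -
    have "?inf \<le> 0 + ennreal e" if e: "e > 0" for e
    proof -
      have "(\<lambda>i. d i powr s) \<longlonglongrightarrow> 0" by (rule summable_LIMSEQ_zero[OF summ])
      then have "eventually (\<lambda>i. d i powr s < \<delta> powr s) sequentially"
        using \<delta> by (intro order_tendstoD) auto
      then obtain N1 where N1: "\<And>i. i \<ge> N1 \<Longrightarrow> d i powr s < \<delta> powr s"
        unfolding eventually_sequentially by blast
      obtain N2 where N2: "\<And>n. n \<ge> N2 \<Longrightarrow> norm (\<Sum>i. d (i + n) powr s) < e"
        using suminf_exist_split[OF e summ] by blast
      define N where "N = max N1 N2"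
      define V where "V = (\<lambda>i. U (i + N))"
      have "V \<in> delta_covers \<delta> A"
      proof -
        have "x \<in> (\<Union>i. V i)" if x: "x \<in> A" for x
        proof -
          obtain i where "i \<ge> N" "x \<in> U i"
            using A[OF x] unfolding INFM_nat_le by blast
          then have "x \<in> V (i - N)" by (simp add: V_def)
          then show ?thesis by blast
        qed
        moreover have "diameter (V i) \<le> \<delta>" for i
        proof -
          have "d (i + N) powr s < \<delta> powr s" by (intro N1) (simp add: N_def)
          then have "d (i + N) < \<delta>"
            using powr_mono2[of s \<delta> "d (i + N)"] s \<delta> by (cases "\<delta> \<le> d (i + N)") auto
          then show ?thesis using diam[of "i + N"] by (simp add: V_def)
        qed
        moreover have "bounded (V i)" for i by (simp add: V_def bdd)
        ultimately show ?thesis unfolding delta_covers_def by blast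
      qed
      then have "?inf \<le> (\<Sum>i. hausdorff_weight s (V i))"
        by (rule INF_lower)
      also have "\<dots> \<le> (\<Sum>i. ennreal (d (i + N) powr s))"
        unfolding V_def by (intro suminf_le hausdorff_weight_le s diam bdd) auto
      also have "\<dots> = ennreal (\<Sum>i. d (i + N) powr s)"
        by (rule suminf_ennreal2) (auto intro: summable_ignore_initial_segment[OF summ])
      also have "\<dots> \<le> ennreal e" using N2[of N] by (intro ennreal_leI) (simp add: N_def)
      finally show ?thesis by simp
    qed
    then have "?inf \<le> 0"
      by (rule ennreal_le_epsilon)
    then show ?thesis by simp
  qed
  then show ?thesis by (simp add: hausdorff_measure_def)
qed

text \<open>Version for covers indexed by words. Numbers that encode no element of \<open>I\<close>
  receive the empty set, whose weight is 0.\<close>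

lemma hausdorff_measure_limsup:
  fixes U :: "'i::countable \<Rightarrow> 'a::metric_space set"
  assumes s: "0 < s" and bdd: "\<And>i. i \<in> I \<Longrightarrow> bounded (U i)"
    and diam: "\<And>i. i \<in> I \<Longrightarrow> diameter (U i) \<le> d i"
    and summ: "(\<lambda>i. d i powr s) summable_on I"
    and A: "\<And>x. x \<in> A \<Longrightarrow> infinite {i\<in>I. x \<in> U i}"
  shows "hausdorff_measure s A = 0"
proof -
  define V where "V = (\<lambda>n. if n \<in> to_nat ` I then U (from_nat n) else {})"
  define c where "c = (\<lambda>n. if n \<in> to_nat ` I then d (from_nat n) else 0)"
  show ?thesis
  proof (rule hausdorff_measure_limsup_nat[OF s, of V c])
    have "(\<lambda>n. c n powr s) summable_on to_nat ` I"
      using summ by (subst summable_on_reindex) (auto simp: c_def o_def cong: summable_on_cong)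
    then have "(\<lambda>n. c n powr s) summable_on UNIV"
      by (subst summable_on_cong_neutral[where g = "\<lambda>n. c n powr s" and T = "to_nat ` I"])
         (auto simp: c_def)
    then show "summable (\<lambda>n. c n powr s)" by (rule summable_on_UNIV_nonneg_real_iff[THEN iffD1, rotated]) simp
    show "\<exists>\<^sub>\<infinity>n. x \<in> V n" if "x \<in> A" for x
    proof -
      have "infinite (to_nat ` {i\<in>I. x \<in> U i})"
        using A[OF that] by (simp add: finite_image_iff)
      moreover have "to_nat ` {i\<in>I. x \<in> U i} \<subseteq> {n. x \<in> V n}" by (auto simp: V_def)
      ultimately show ?thesis unfolding frequently_cofinite by (auto dest: finite_subset)
    qed
  qed (use bdd diam in \<open>auto simp: V_def c_def\<close>)
qed

text \<open>Mass distribution principle for the image of \<open>M\<close> under \<open>f\<close>.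
  Covers of diameter at most 1 rule out all t \<le> s at once, because d^s \<le> d^t for d \<le>
  1.\<close>

lemma mass_distribution:
  fixes A :: "real set" and f :: "'m \<Rightarrow> real"
  assumes "prob_space M" and f [measurable]: "f \<in> borel_measurable M"
    and fA: "AE \<xi> in M. f \<xi> \<in> A" and s: "0 < s" and C: "0 < C"
    and bound: "\<And>x y. x \<le> y \<Longrightarrow> measure M {\<xi>\<in>space M. x \<le> f \<xi> \<and> f \<xi> \<le> y} \<le> C * (y - x) powr s"
  shows "ereal s \<le> hausdorff_dim A"
proof -
  interpret prob_space M by fact
  have nz: "hausdorff_measure t A \<noteq> 0" if t: "0 \<le> t" "t \<le> s" for t
  proof -
    \<comment> \<open>A set of diameter d containing p lies in [p - d, p + d], an interval of length
      2 d; hence the factor \<open>2 powr s\<close>.\<close>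
    define c where "c = 1 / (C * 2 powr s)"
    have c: "c > 0" using C by (simp add: c_def)
    have key: "ennreal c \<le> (\<Sum>i. hausdorff_weight t (V i))" if V: "V \<in> delta_covers 1 A" for V
    proof -
      have bdd: "bounded (V i)" and d1: "diameter (V i) \<le> 1" and cov: "A \<subseteq> (\<Union>i. V i)" for i
        using V by (auto simp: delta_covers_def)
      define p where "p = (\<lambda>i. SOME x. x \<in> V i)"
      \<comment> \<open>The covering sets may fail to be measurable, so each is enlarged to an
        interval before its mass is taken.\<close>
      define J where "J = (\<lambda>i. if V i = {} then {} else 
         {\<xi>\<in>space M. p i - diameter (V i) \<le> f \<xi> \<and> f \<xi> \<le> p i + diameter (V i)})"
      have [measurable]: "J i \<in> sets M" for i by (simp add: J_def)
      have mJ: "emeasure M (J i) \<le> ennreal (1 / c) * hausdorff_weight t (V i)" for i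
      proof (cases "V i = {}")
        case False
        let ?d = "diameter (V i)"
        have d: "0 \<le> ?d" by (rule diameter_ge_0[OF bdd])
        have w: "ennreal (?d powr s) \<le> hausdorff_weight t (V i)"
          using False t d d1[of i] s
          by (auto simp: hausdorff_weight_def powr_le1 intro!: ennreal_leI powr_mono')
        have "emeasure M (J i) = ennreal (measure M (J i))" by (simp add: emeasure_eq_measure)
        also have "measure M (J i) \<le> C * ((p i + ?d) - (p i - ?d)) powr s"
          unfolding J_def using False d bound[of "p i - ?d" "p i + ?d"] by simp
        also have "\<dots> = 1 / c * ?d powr s"
          using d by (simp add: c_def powr_mult[symmetric])
        also have "ennreal \<dots> = ennreal (1 / c) * ennreal (?d powr s)"
          using c by (intro ennreal_mult) auto
        also have "\<dots> \<le> ennreal (1 / c) * hausdorff_weight t (V i)"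
          by (intro mult_left_mono w) auto
        finally show ?thesis by (simp add: ennreal_leI)
      qed (simp add: J_def)
      have "AE \<xi> in M. \<xi> \<in> (\<Union>i. J i)"
        using fA AE_space
      proof eventually_elim
        case (elim \<xi>)
        then obtain i where i: "f \<xi> \<in> V i" using cov by blast
        then have "p i \<in> V i" unfolding p_def by (rule someI)
        then have "dist (f \<xi>) (p i) \<le> diameter (V i)" using i bdd by (intro diameter_bounded_bound)
        then have "\<xi> \<in> J i" using elim i by (auto simp: J_def dist_real_def)
        then show ?case by blast
      qed
      then have "1 = emeasure M (\<Union>i. J i)" by (intro emeasure_eq_1_AE[symmetric]) auto
      also have "\<dots> \<le> (\<Sum>i. emeasure M (J i))" by (intro emeasure_subadditive_countably) auto
      also have "\<dots> \<le> (\<Sum>i. ennreal (1 / c) * hausdorff_weight t (V i))"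
        by (intro suminf_le mJ) auto
      also have "\<dots> = ennreal (1 / c) * (\<Sum>i. hausdorff_weight t (V i))" by simp
      finally have "ennreal c * 1 \<le> ennreal c * (ennreal (1 / c) * (\<Sum>i. hausdorff_weight t (V i)))"
        by (intro mult_left_mono) auto
      also have "\<dots> = (\<Sum>i. hausdorff_weight t (V i))"
        using c by (simp add: mult.assoc[symmetric] ennreal_mult[symmetric])
      finally show ?thesis by simp
    qed
    have "ennreal c \<le> (INF V\<in>delta_covers 1 A. \<Sum>i. hausdorff_weight t (V i))"
      by (intro INF_greatest key)
    also have "\<dots> \<le> hausdorff_measure t A"
      unfolding hausdorff_measure_def by (rule SUP_upper) auto
    finally show ?thesis using c by auto
  qed
  have "s \<le> t" if "0 \<le> t" "hausdorff_measure t A = 0" for t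
  proof (rule ccontr)
    assume "\<not> s \<le> t"
    then have "t \<le> s" by simp
    then show False using nz[OF that(1)] that(2) by blast
  qed
  then show ?thesis unfolding hausdorff_dim_def
    by (intro INF_greatest) auto
qed

section \<open>The pressure function\<close>

definition words :: "nat \<Rightarrow> nat list set" where
  "words n = {w. length w = n \<and> pos_word w}"

text \<open>Up to a factor bounded in terms of s, this is the s-th power of the length of the
  cylinder of \<open>w\<close>.\<close>

definition weight :: "real \<Rightarrow> nat list \<Rightarrow> real" where
  "weight s w = rQ w powr (- 2 * s)"

definition psum :: "nat \<Rightarrow> real \<Rightarrow> real" where
  "psum n s = infsum (weight s) (words n)"

lemma words_0 [simp]: "words 0 = {[]}"
  by (auto simp: words_def)

lemma bij_betw_words_append:
  "bij_betw (\<lambda>(u, v). u @ v) (words n \<times> words m) (words (n + m))"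
proof (rule bij_betw_byWitness[where f' = "\<lambda>w. (take n w, drop n w)"])
  show "(\<lambda>w. (take n w, drop n w)) ` words (n + m) \<subseteq> words n \<times> words m"
    by (auto simp: words_def pos_word_def dest: in_set_takeD in_set_dropD)
qed (auto simp: words_def)

lemma bij_betw_words_snoc:
  "bij_betw (\<lambda>(w, a). w @ [Suc a]) (words n \<times> UNIV) (words (Suc n))"
proof (rule bij_betw_byWitness[where f' = "\<lambda>w. (butlast w, last w - 1)"])
  show "\<forall>w\<in>words (Suc n). (case (butlast w, last w - 1) of (w, a) \<Rightarrow> w @ [Suc a]) = w"
  proof
    fix w assume "w \<in> words (Suc n)"
    then have "w \<noteq> []" "pos_word w" by (auto simp: words_def)
    then have "last w \<ge> 1" by (auto simp: pos_word_def)
    then show "(case (butlast w, last w - 1) of (w, a) \<Rightarrow> w @ [Suc a]) = w"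
      using \<open>w \<noteq> []\<close> by simp
  qed
  show "(\<lambda>w. (butlast w, last w - 1)) ` words (Suc n) \<subseteq> words n \<times> UNIV"
    by (auto simp: words_def pos_word_def dest: in_set_butlastD)
qed (auto simp: words_def)

lemma has_sum_product_nonneg:
  fixes f g :: "_ \<Rightarrow> real"
  assumes "(f has_sum a) A" "(g has_sum b) B"
    and "\<And>x. x \<in> A \<Longrightarrow> 0 \<le> f x" "\<And>y. y \<in> B \<Longrightarrow> 0 \<le> g y"
  shows "((\<lambda>(x, y). f x * g y) has_sum a * b) (A \<times> B)"
proof (rule has_sum_SigmaI)
  show 1: "((\<lambda>y. case (x, y) of (x, y) \<Rightarrow> f x * g y) has_sum f x * b) B" for x
    using assms(2) by (auto intro: has_sum_cmult_right)
  show 2: "((\<lambda>x. f x * b) has_sum a * b) A"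
    using assms(1) by (rule has_sum_cmult_left)
  show "(\<lambda>(x, y). f x * g y) summable_on A \<times> B"
    by (rule summable_on_SigmaI[OF 1 has_sum_imp_summable[OF 2]]) (use assms in auto)
qed

lemma weight_nonneg: "0 \<le> weight s w"
  by (simp add: weight_def)

lemma weight_pos: "pos_word w \<Longrightarrow> 0 < weight s w"
  using cQ_pos[of w] by (simp add: weight_def)

lemma weight_append_le:
  assumes "pos_word u" "pos_word v" "0 \<le> s"
  shows "weight s (u @ v) \<le> weight s u * weight s v"
proof -
  have "rQ u * rQ v \<le> rQ (u @ v)"
    using cQ_append_ge[of u v] by (metis of_nat_le_iff of_nat_mult)
  moreover have "0 < rQ u * rQ v"
    using cQ_pos[of u] cQ_pos[of v] assms by simp
  ultimately have "rQ (u @ v) powr (- 2 * s) \<le> (rQ u * rQ v) powr (- 2 * s)"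
    using assms by (intro powr_mono2') auto
  then show ?thesis by (simp add: weight_def powr_mult)
qed

lemma weight_append_ge:
  assumes "pos_word u" "pos_word v" "0 \<le> s"
  shows "4 powr (- s) * (weight s u * weight s v) \<le> weight s (u @ v)"
proof -
  have "rQ (u @ v) \<le> 2 * (rQ u * rQ v)"
    using cQ_append_le[OF assms(1,2)] by (metis of_nat_le_iff of_nat_mult of_nat_numeral)
  moreover have "0 < rQ (u @ v)"
    using cQ_pos[of "u @ v"] assms by simp
  ultimately have "(2 * (rQ u * rQ v)) powr (- 2 * s) \<le> rQ (u @ v) powr (- 2 * s)"
    using assms by (intro powr_mono2') auto
  moreover have "(2::real) powr (- 2 * s) = 4 powr (- s)"
    using powr_powr[of 2 2 "- s"] by simp
  ultimately show ?thesis by (simp add: weight_def powr_mult)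
qed

lemma summable_weight:
  assumes s: "1 / 2 < s"
  shows "weight s summable_on words n"
proof (induction n)
  case (Suc n)
  have 1: "(\<lambda>a. real (Suc a) powr (- 2 * s)) summable_on UNIV"
  proof -
    have "summable (\<lambda>a. real a powr (- 2 * s))" using s by (subst summable_real_powr_iff) auto
    then have "summable (\<lambda>a. real (Suc a) powr (- 2 * s))" by (subst summable_Suc_iff)
    then show ?thesis by (subst summable_on_UNIV_nonneg_real_iff) auto
  qed
  have "(\<lambda>(w, a). weight s w * real (Suc a) powr (- 2 * s)) summable_on words n \<times> UNIV"
    using has_sum_product_nonneg[OF has_sum_infsum[OF Suc] has_sum_infsum[OF 1]]
    by (auto simp: weight_nonneg summable_on_def)
  then have "(\<lambda>(w, a). weight s (w @ [Suc a])) summable_on words n \<times> UNIV"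
  proof (rule summable_on_comparison_test)
    fix x assume x: "x \<in> words n \<times> (UNIV :: nat set)"
    obtain w a where [simp]: "x = (w, a)" by force
    have "weight s (w @ [Suc a]) \<le> weight s w * weight s [Suc a]"
      using x s by (intro weight_append_le) (auto simp: words_def)
    then show "(case x of (w, a) \<Rightarrow> weight s (w @ [Suc a]))
        \<le> (case x of (w, a) \<Rightarrow> weight s w * real (Suc a) powr (- 2 * s))"
      by (simp add: weight_def)
  qed (auto simp: weight_nonneg)
  then show ?case
    by (subst summable_on_reindex_bij_betw[OF bij_betw_words_snoc, symmetric])
       (simp add: case_prod_unfold)
qed auto

lemma psum_pos:
  assumes s: "1 / 2 < s"
  shows "0 < psum n s"
proof -
  have w: "replicate n 1 \<in> words n" by (auto simp: words_def pos_word_def)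
  have "0 < weight s (replicate n 1)"
    using w by (intro weight_pos) (auto simp: words_def)
  also have "\<dots> = infsum (weight s) {replicate n 1}" by simp
  also have "\<dots> \<le> psum n s"
    unfolding psum_def
    using w s by (intro infsum_mono_neutral summable_weight) (auto simp: weight_nonneg)
  finally show ?thesis .
qed

text \<open>Words of length n + m split uniquely, and q(uv) lies between q(u) q(v) and 2 q(u) q(v);
  raised to the power -2 s, the factor 2 becomes \<open>4 powr (- s)\<close>.\<close>

lemma psum_add:
  assumes s: "1 / 2 < s"
  shows "psum (n + m) s \<le> psum n s * psum m s"
    and "4 powr (- s) * (psum n s * psum m s) \<le> psum (n + m) s"
proof -
  have 1: "((\<lambda>(u, v). weight s u * weight s v) has_sum
      psum n s * psum m s) (words n \<times> words m)"
    unfolding psum_def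
    by (intro has_sum_product_nonneg has_sum_infsum summable_weight s weight_nonneg)
  have 2: "((\<lambda>(u, v). weight s (u @ v)) has_sum psum (n + m) s) (words n \<times> words m)"
  proof -
    have "(weight s has_sum psum (n + m) s) (words (n + m))"
      unfolding psum_def by (intro has_sum_infsum summable_weight s)
    then show ?thesis
      by (subst (asm) has_sum_reindex_bij_betw[OF bij_betw_words_append, symmetric])
         (simp add: case_prod_unfold)
  qed
  show "psum (n + m) s \<le> psum n s * psum m s"
    by (rule has_sum_mono[OF 2 1]) (use s in \<open>auto simp: words_def intro!: weight_append_le\<close>)
  show "4 powr (- s) * (psum n s * psum m s) \<le> psum (n + m) s"
    by (rule has_sum_mono[OF has_sum_cmult_right[OF 1] 2])
       (use s in \<open>auto simp: words_def intro!: weight_append_ge\<close>)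
qed

text \<open>Since both bounds are available, \<open>u (n * m)\<close> can be compared with \<open>m * u n\<close> and with
  \<open>n * u m\<close>, which makes \<open>u n / n\<close> a Cauchy sequence.\<close>

lemma almost_additive_limit:
  fixes u :: "nat \<Rightarrow> real"
  assumes u: "\<And>n m. \<bar>u (n + m) - u n - u m\<bar> \<le> D"
  shows "\<exists>P. (\<lambda>n. u n / real n) \<longlonglongrightarrow> P \<and> (\<forall>n. \<bar>u n - real n * P\<bar> \<le> D)"
proof -
  have D: "0 \<le> D" using u[of 0 0] by linarith
  have mult: "\<bar>u (n * m) - real m * u n\<bar> \<le> real (Suc m) * D" for n m
  proof (induction m)
    case 0
    then show ?case using u[of 0 0] by simp
  next
    case (Suc m)
    have "n * Suc m = n * m + n" by simp
    then show ?case using Suc u[of "n * m" n] by (simp add: algebra_simps)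
  qed
  have close: "\<bar>u n / n - u m / m\<bar> \<le> 2 * D / n + 2 * D / m" if "n \<ge> 1" "m \<ge> 1" for n m
  proof -
    have "\<bar>real m * u n - real n * u m\<bar> \<le> real (Suc m) * D + real (Suc n) * D"
      using mult[of n m] mult[of m n] by (simp add: mult.commute[of m n])
    also have "\<dots> \<le> (2 * real m) * D + (2 * real n) * D"
      using that D by (intro add_mono mult_right_mono) auto
    finally have "\<bar>real m * u n - real n * u m\<bar> / (real n * real m)
        \<le> ((2 * real m) * D + (2 * real n) * D) / (real n * real m)"
      by (intro divide_right_mono) auto
    moreover have "u n / n - u m / m = (real m * u n - real n * u m) / (real n * real m)"
      using that by (simp add: field_simps)
    moreover have "((2 * real m) * D + (2 * real n) * D) / (real n * real m) = 2 * D / n + 2 * D / m"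
      using that by (simp add: field_simps)
    ultimately show ?thesis by (simp add: abs_divide)
  qed
  have "Cauchy (\<lambda>n. u n / real n)"
  proof (rule metric_CauchyI)
    fix e :: real assume e: "e > 0"
    have "(\<lambda>n. 2 * D / real n) \<longlonglongrightarrow> 0" by real_asymp
    then have "eventually (\<lambda>n. 2 * D / real n < e / 2 \<and> n \<ge> 1) sequentially"
      using e by (intro eventually_conj order_tendstoD eventually_ge_at_top) auto
    then obtain N where N: "\<And>n. n \<ge> N \<Longrightarrow> 2 * D / real n < e / 2 \<and> n \<ge> 1"
      unfolding eventually_sequentially by blast
    have "dist (u m / real m) (u n / real n) < e" if "m \<ge> N" "n \<ge> N" for m n
      using N[OF that(1)] N[OF that(2)] close[of m n] by (auto simp: dist_real_def)
    then show "\<exists>M. \<forall>m\<ge>M. \<forall>n\<ge>M. dist (u m / real m) (u n / real n) < e" by blast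
  qed
  then obtain P where P: "(\<lambda>n. u n / real n) \<longlonglongrightarrow> P"
    using Cauchy_convergent convergent_def by blast
  have "\<bar>u n - real n * P\<bar> \<le> D" for n
  proof -
    have lim: "(\<lambda>m. \<bar>u n - real n * (u (Suc m) / real (Suc m))\<bar>) \<longlonglongrightarrow> \<bar>u n - real n * P\<bar>"
      by (intro tendsto_intros LIMSEQ_Suc P)
    \<comment> \<open>Dividing the comparison of \<open>u n\<close> with \<open>u m\<close> by m and
      letting m grow leaves exactly \<open>D\<close>, uniformly in n.\<close>
    have lim': "(\<lambda>m. real (Suc (Suc m)) * D / real (Suc m) + real (Suc n) * D / real (Suc m)) \<longlonglongrightarrow> D"
      by real_asymp
    show ?thesis
    proof (rule LIMSEQ_le[OF lim lim'], intro exI allI impI)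
      fix m :: nat
      have "\<bar>real (Suc m) * u n - real n * u (Suc m)\<bar> \<le> real (Suc (Suc m)) * D + real (Suc n) * D"
        using mult[of n "Suc m"] mult[of "Suc m" n] by (simp only: mult.commute[of "Suc m" n])
      then have "\<bar>real (Suc m) * u n - real n * u (Suc m)\<bar> / real (Suc m)
          \<le> (real (Suc (Suc m)) * D + real (Suc n) * D) / real (Suc m)"
        by (intro divide_right_mono) auto
      moreover have "u n - real n * (u (Suc m) / real (Suc m))
          = (real (Suc m) * u n - real n * u (Suc m)) / real (Suc m)"
        by (simp add: field_simps del: of_nat_Suc)
      ultimately show "\<bar>u n - real n * (u (Suc m) / real (Suc m))\<bar>
          \<le> real (Suc (Suc m)) * D / real (Suc m) + real (Suc n) * D / real (Suc m)"
        by (simp add: abs_divide add_divide_distrib del: of_nat_Suc)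
    qed
  qed
  then show ?thesis using P by blast
qed

text \<open>The error in the second part does not depend on n. It is what turns knowledge of the
  pressure into estimates of \<open>psum\<close> at a fixed order, and conversely.\<close>

lemma pressure_limit:
  assumes s: "1 / 2 < s"
  shows "(\<lambda>n. ln (psum n s) / real n) \<longlonglongrightarrow> pressure s"
    and "\<bar>ln (psum n s) - real n * pressure s\<bar> \<le> s * ln 4"
proof -
  have "\<bar>ln (psum (n + m) s) - ln (psum n s) - ln (psum m s)\<bar> \<le> s * ln 4" for n m
  proof -
    note p = psum_pos[OF s]
    have "ln (psum (n + m) s) \<le> ln (psum n s * psum m s)"
      using p psum_add(1)[OF s, of n m] by simp
    moreover have "ln (4 powr (- s) * (psum n s * psum m s)) \<le> ln (psum (n + m) s)"
      using p psum_add(2)[OF s, of n m] by (subst ln_le_cancel_iff) auto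
    moreover have "s * ln 4 \<ge> 0" using s by simp
    ultimately show ?thesis
      using p[of n] p[of m] by (auto simp: ln_mult ln_powr)
  qed
  from almost_additive_limit[of "\<lambda>n. ln (psum n s)", OF this]
  obtain P where P: "(\<lambda>n. ln (psum n s) / real n) \<longlonglongrightarrow> P"
    "\<And>n. \<bar>ln (psum n s) - real n * P\<bar> \<le> s * ln 4"
    by blast
  have "pressure s = lim (\<lambda>n. ln (psum n s) / real n)"
  proof -
    have "infsum (\<lambda>w. real_of_int (cf_denom w) powr (- 2 * s)) {w. length w = n \<and> (\<forall>a\<in>set w. 1 \<le> a)}
        = psum n s" for n
      unfolding psum_def words_def pos_word_def[symmetric]
      by (intro infsum_cong) (auto simp: cf_denom_eq weight_def)
    then show ?thesis by (simp add: pressure_def)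
  qed
  then have "pressure s = P" using limI[OF P(1)] by simp
  then show "(\<lambda>n. ln (psum n s) / real n) \<longlonglongrightarrow> pressure s"
    "\<bar>ln (psum n s) - real n * pressure s\<bar> \<le> s * ln 4"
    using P by auto
qed

lemma psum_le:
  assumes s: "1 / 2 < s"
  shows "psum n s \<le> 4 powr s * exp (real n * pressure s)"
proof -
  have "ln (psum n s) \<le> s * ln 4 + real n * pressure s"
    using pressure_limit(2)[OF s, of n] by linarith
  then have "exp (ln (psum n s)) \<le> exp (s * ln 4 + real n * pressure s)" by simp
  then show ?thesis using psum_pos[OF s, of n] by (simp add: exp_add powr_def)
qed

text \<open>Raising the exponent from s to t multiplies each weight by
  \<open>(1 / q^2) powr (t - s)\<close>, and q^2 is at least 2^(n-1) for every word of length
  n.\<close>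

lemma pressure_decreasing:
  assumes s: "1 / 2 < s" and st: "s \<le> t"
  shows "pressure t \<le> pressure s - (t - s) * ln 2"
proof -
  have t: "1 / 2 < t" using s st by simp
  have "ln (psum n t) \<le> ln (psum n s) + (t - s) * (ln 2 - real n * ln 2)" for n
  proof -
    define c where "c = (2 / 2 ^ n :: real) powr (t - s)"
    have "psum n t \<le> c * psum n s"
      unfolding psum_def
    proof (subst infsum_cmult_right'[symmetric], rule infsum_mono)
      show "(\<lambda>w. c * weight s w) summable_on words n"
        by (intro summable_on_cmult_right summable_weight s)
      fix w assume "w \<in> words n"
      then have w: "pos_word w" "length w = n" by (auto simp: words_def)
      have q: "rQ w > 0" using cQ_pos[OF w(1)] by simp
      have "1 / (rQ w)\<^sup>2 \<le> 2 / 2 ^ n" using inverse_cQ_le[OF w(1)] w(2) by (simp add: power_divide)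
      then have "(1 / (rQ w)\<^sup>2) powr (t - s) \<le> c"
        unfolding c_def using st by (intro powr_mono2) auto
      moreover have "(1 / (rQ w)\<^sup>2) powr (t - s) = rQ w powr (- 2 * (t - s))"
      proof -
        have "1 / (rQ w)\<^sup>2 = rQ w powr (- 2)" using q by (simp add: powr_minus divide_inverse)
        then show ?thesis by (simp add: powr_powr)
      qed
      ultimately have "rQ w powr (- 2 * (t - s)) * weight s w \<le> c * weight s w"
        by (intro mult_right_mono weight_nonneg) auto
      then show "weight t w \<le> c * weight s w"
        by (simp add: weight_def powr_add[symmetric] algebra_simps)
    qed (use t in \<open>auto intro: summable_weight\<close>)
    then have "ln (psum n t) \<le> ln (c * psum n s)"
      using psum_pos[OF t, of n] by simp
    also have "\<dots> = ln c + ln (psum n s)"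
      using psum_pos[OF s, of n] by (intro ln_mult_pos) (auto simp: c_def)
    also have "ln c = (t - s) * (ln 2 - real n * ln 2)"
      unfolding c_def by (simp add: ln_powr ln_div ln_realpow)
    finally show ?thesis by simp
  qed
  then have le: "ln (psum n t) / real n \<le> ln (psum n s) / real n
      + (t - s) * ln 2 / real n - (t - s) * ln 2" if "n \<ge> 1" for n
  proof -
    have "ln (psum n t) / real n \<le> (ln (psum n s) + (t - s) * (ln 2 - real n * ln 2)) / real n"
      by (intro divide_right_mono \<open>\<And>n. ln (psum n t) \<le> _ n\<close>) auto
    then show ?thesis using that by (simp add: field_simps)
  qed
  have lim: "(\<lambda>n. ln (psum n s) / real n + (t - s) * ln 2 / real n - (t - s) * ln 2)
      \<longlonglongrightarrow> pressure s + 0 - (t - s) * ln 2"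
    by (intro tendsto_intros pressure_limit s; real_asymp)
  show ?thesis
    using LIMSEQ_le[OF pressure_limit(1)[OF t] lim] le by auto
qed

lemma convex_comb_gt:
  fixes c s t a b :: real
  assumes "c < s" "c < t" "0 \<le> a" "0 \<le> b" "a + b = 1"
  shows "c < a * s + b * t"
proof -
  have "c = a * c + b * c" using assms by (simp add: distrib_right[symmetric])
  also have "\<dots> < a * s + b * t"
  proof (cases "a = 0")
    case False
    then have "a * c < a * s" using assms by (intro mult_strict_left_mono) auto
    then show ?thesis using assms by (intro add_less_le_mono mult_left_mono) auto
  qed (use assms in auto)
  finally show ?thesis .
qed

text \<open>Hoelder's inequality, obtained termwise: Young's inequality for the weights normalised
  by \<open>?S\<close> and \<open>?T\<close>, scaled back by \<open>c\<close> and summed.\<close>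

lemma psum_log_convex:
  assumes "1 / 2 < s" "1 / 2 < t" "0 \<le> a" "0 \<le> b" "a + b = 1"
  shows "ln (psum n (a * s + b * t)) \<le> a * ln (psum n s) + b * ln (psum n t)"
proof -
  let ?S = "psum n s" and ?T = "psum n t" and ?r = "a * s + b * t"
  have r: "1 / 2 < ?r" using convex_comb_gt[of "1 / 2" s t a b] assms by simp
  have S: "?S > 0" and T: "?T > 0" using assms by (auto intro: psum_pos)
  define c where "c = ?S powr a * ?T powr b"
  have c: "c > 0" using S T by (simp add: c_def)
  have "psum n ?r \<le> a * (c / ?S) * ?S + b * (c / ?T) * ?T"
  proof (rule has_sum_mono)
    show "(weight ?r has_sum psum n ?r) (words n)"
      unfolding psum_def by (intro has_sum_infsum summable_weight r)
    show "((\<lambda>w. a * (c / ?S) * weight s w + b * (c / ?T) * weight t w) has_sum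
        (a * (c / ?S) * ?S + b * (c / ?T) * ?T)) (words n)"
      unfolding psum_def
      by (intro has_sum_add has_sum_cmult_right has_sum_infsum summable_weight assms)
    fix w assume "w \<in> words n"
    then have w: "pos_word w" by (auto simp: words_def)
    have q: "0 < rQ w" by (rule rQ_pos[OF w])
    have p: "weight s w > 0" "weight t w > 0" by (intro weight_pos w)+
    have "(weight s w / ?S) powr a * (weight t w / ?T) powr b
        \<le> a * (weight s w / ?S) + b * (weight t w / ?T)"
      using p S T assms by (intro Youngs_inequality_0) auto
    then have "c * ((weight s w / ?S) powr a * (weight t w / ?T) powr b)
        \<le> c * (a * (weight s w / ?S) + b * (weight t w / ?T))"
      using c by (intro mult_left_mono) auto
    moreover have "c * ((weight s w / ?S) powr a * (weight t w / ?T) powr b) = weight ?r w"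
    proof -
      have "c * ((weight s w / ?S) powr a * (weight t w / ?T) powr b)
          = weight s w powr a * weight t w powr b"
        using S T p by (simp add: c_def powr_divide)
      also have "\<dots> = weight ?r w"
        using q by (simp add: weight_def powr_powr powr_add[symmetric] algebra_simps)
      finally show ?thesis .
    qed
    ultimately show "weight ?r w \<le> a * (c / ?S) * weight s w + b * (c / ?T) * weight t w"
      by (simp add: algebra_simps)
  qed
  also have "\<dots> = c" using S T assms by (simp add: distrib_right[symmetric])
  finally have "ln (psum n ?r) \<le> ln c"
    using psum_pos[OF r, of n] by simp
  also have "\<dots> = a * ln ?S + b * ln ?T"
    using S T by (simp add: c_def ln_mult ln_powr)
  finally show ?thesis .
qed

text \<open>A pointwise limit of convex functions is convex, and a convex function on an open
  interval is continuous.\<close>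

lemma continuous_on_pressure: "continuous_on {1/2<..} pressure"
proof (rule convex_on_continuous)
  show "convex_on {1 / 2<..} pressure"
    unfolding convex_on_def
  proof (intro conjI ballI allI impI)
    fix x y u v :: real
    assume a: "x \<in> {1/2<..}" "y \<in> {1/2<..}" "0 \<le> u" "0 \<le> v" "u + v = 1"
    have "u *\<^sub>R x + v *\<^sub>R y \<in> {1/2<..}"
      using a convex_comb_gt[of "1 / 2" x y u v] by simp
    then have "(\<lambda>n. ln (psum n (u * x + v * y)) / real n) \<longlonglongrightarrow> pressure (u * x + v * y)"
      by (intro pressure_limit) auto
    moreover have "(\<lambda>n. u * (ln (psum n x) / real n) + v * (ln (psum n y) / real n))
        \<longlonglongrightarrow> u * pressure x + v * pressure y"
      using a by (intro tendsto_intros pressure_limit) auto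
    ultimately show "pressure (u *\<^sub>R x + v *\<^sub>R y) \<le> u * pressure x + v * pressure y"
      unfolding real_scaleR_def
    proof (rule LIMSEQ_le, intro exI allI impI)
      fix n :: nat
      have "ln (psum n (u * x + v * y)) / real n
          \<le> (u * ln (psum n x) + v * ln (psum n y)) / real n"
        using a by (intro divide_right_mono psum_log_convex) auto
      then show "ln (psum n (u * x + v * y)) / real n
          \<le> u * (ln (psum n x) / real n) + v * (ln (psum n y) / real n)"
        by (simp add: add_divide_distrib)
    qed
  qed (rule convex_real_interval)
qed auto

text \<open>The terms below are the lengths of the cylinders of order \<open>n\<close>, which partition the unit
  interval; hence the normalisation \<open>pressure 1 = 0\<close>.\<close>

lemma has_sum_cylinder_lengths:
  "((\<lambda>w. 1 / (rQ w * (rQ w + real (cQ' w)))) has_sum 1) (words n)"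
proof (induction n)
  case 0
  have "((\<lambda>w. 1 / (rQ w * (rQ w + real (cQ' w)))) has_sum
     (\<Sum>w\<in>{[]}. 1 / (rQ w * (rQ w + real (cQ' w))))) {[]}"
    by (rule has_sum_finite) auto
  then show ?case by simp
next
  case (Suc n)
  let ?y = "\<lambda>w. 1 / (rQ w * (rQ w + real (cQ' w)))"
  have Q'_snoc: "cQ' (w @ [a]) = cQ w" for w a
    using cnum_cden_append[of "Suc 0" 0 w "[a]"] cnum_cden_linear[of 0 1 w] by simp
  have inner: "((\<lambda>a. ?y (w @ [Suc a])) has_sum ?y w) UNIV" if w: "w \<in> words n" for w
  proof -
    have q: "rQ w > 0" using w cQ_pos[of w] by (auto simp: words_def)
    \<comment> \<open>\<open>g a\<close> is the total length of the subcylinders whose next digit is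
      at least \<open>Suc a\<close>, so the lengths of the individual ones telescope.\<close>
    define g where "g = (\<lambda>a. 1 / (rQ w * (real (Suc a) * rQ w + real (cQ' w))))"
    have pos: "real (Suc a) * rQ w + real (cQ' w) > 0" for a
      using q by (intro add_pos_nonneg mult_pos_pos) auto
    have eq: "?y (w @ [Suc a]) = g a - g (Suc a)" for a
    proof -
      define x where "x = real (Suc a) * rQ w + real (cQ' w)"
      have x: "x > 0" unfolding x_def by (rule pos)
      have "?y (w @ [Suc a]) = 1 / (x * (x + rQ w))"
        by (simp add: cQ_snoc Q'_snoc x_def algebra_simps)
      also have "\<dots> = 1 / (rQ w * x) - 1 / (rQ w * (x + rQ w))"
        using x q by (simp add: divide_simps add_pos_pos[THEN less_imp_neq, symmetric])
      also have "\<dots> = g a - g (Suc a)"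
        by (simp add: g_def x_def algebra_simps)
      finally show ?thesis .
    qed
    have "g \<longlonglongrightarrow> 0" unfolding g_def using q by real_asymp
    then have "(\<lambda>a. g a - g (Suc a)) sums (g 0 - 0)" by (rule telescope_sums')
    moreover have "g 0 = ?y w" by (simp add: g_def)
    ultimately have sums: "(\<lambda>a. ?y (w @ [Suc a])) sums ?y w" by (simp only: eq) simp
    have "(\<lambda>a. ?y (w @ [Suc a])) summable_on UNIV"
      using sums_summable[OF sums] by (subst summable_on_UNIV_nonneg_real_iff) auto
    then obtain S where S: "((\<lambda>a. ?y (w @ [Suc a])) has_sum S) UNIV"
      unfolding summable_on_def by blast
    then have "S = ?y w" using has_sum_imp_sums[OF S] sums by (intro sums_unique2)
    then show ?thesis using S by (simp only:)
  qed
  have "((\<lambda>(w, a). ?y (w @ [Suc a])) has_sum 1) (words n \<times> UNIV)"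
  proof (rule has_sum_SigmaI)
    show "((\<lambda>a. case (w, a) of (w, a) \<Rightarrow> ?y (w @ [Suc a])) has_sum ?y w) UNIV" if "w \<in> words n" for w
      using inner[OF that] by simp
    show "(?y has_sum 1) (words n)" by (rule Suc)
    show "(\<lambda>(w, a). ?y (w @ [Suc a])) summable_on words n \<times> UNIV"
    proof (rule summable_on_SigmaI)
      show "((\<lambda>a. case (w, a) of (w, a) \<Rightarrow> ?y (w @ [Suc a])) has_sum ?y w) UNIV" if "w \<in> words n" for w
        using inner[OF that] by simp
      show "?y summable_on words n" using Suc by (rule has_sum_imp_summable)
    qed auto
  qed
  then show ?case
    by (subst has_sum_reindex_bij_betw[OF bij_betw_words_snoc, symmetric])
       (simp add: case_prod_unfold)
qed

text \<open>Since \<open>cQ' w\<close> lies between 0 and \<open>cQ w\<close>, weight and cylinder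
  length differ by a factor of at most 2; hence \<open>psum n 1\<close> stays between 1 and
  2.\<close>

lemma pressure_1: "pressure 1 = 0"
proof -
  let ?y = "\<lambda>w. 1 / (rQ w * (rQ w + real (cQ' w)))"
  have Z: "(weight 1 has_sum psum n 1) (words n)" for n
    unfolding psum_def by (intro has_sum_infsum summable_weight) auto
  have w1: "weight 1 w = 1 / (rQ w * rQ w)" if "pos_word w" for w
    using cQ_pos[OF that] by (simp add: weight_def powr_minus divide_inverse power2_eq_square)
  have "1 \<le> psum n 1" for n
  proof (rule has_sum_mono[OF has_sum_cylinder_lengths Z])
    fix w assume w: "w \<in> words n"
    then have q: "rQ w > 0" using cQ_pos[of w] by (auto simp: words_def)
    then show "?y w \<le> weight 1 w"
      using w by (subst w1) (auto simp: words_def intro!: divide_left_mono mult_left_mono mult_pos_pos add_pos_nonneg)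
  qed
  moreover have "psum n 1 \<le> 2 * 1" for n
  proof (rule has_sum_mono[OF Z has_sum_cmult_right[OF has_sum_cylinder_lengths]])
    fix w assume w: "w \<in> words n"
    then have q: "rQ w > 0" using cQ_pos[of w] by (auto simp: words_def)
    have q': "real (cQ' w) \<le> rQ w" using w cQ'_le_cQ by (auto simp: words_def)
    have "weight 1 w = 2 * (1 / (rQ w * (2 * rQ w)))"
      using w by (subst w1) (auto simp: words_def)
    also have "\<dots> \<le> 2 * ?y w"
      using q q' by (intro mult_left_mono divide_left_mono mult_pos_pos add_pos_nonneg) auto
    finally show "weight 1 w \<le> 2 * ?y w" .
  qed
  ultimately have b: "0 \<le> ln (psum n 1) / real n" "ln (psum n 1) / real n \<le> ln 2 / real n" for n
  proof -
    assume 1: "\<And>n. 1 \<le> psum n 1" "\<And>n. psum n 1 \<le> 2 * 1"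
    have "0 \<le> ln (psum n 1)" using 1(1)[of n] by simp
    moreover have "ln (psum n 1) \<le> ln 2" using 1(1)[of n] 1(2)[of n] by simp
    ultimately show "0 \<le> ln (psum n 1) / real n" "ln (psum n 1) / real n \<le> ln 2 / real n"
      by (auto intro: divide_right_mono)
  qed
  have "(\<lambda>n. ln 2 / real n) \<longlonglongrightarrow> 0" by real_asymp
  then have "(\<lambda>n. ln (psum n 1) / real n) \<longlonglongrightarrow> 0"
    by (rule tendsto_sandwich[OF _ _ tendsto_const, rotated 2]) (use b in auto)
  moreover have "(\<lambda>n. ln (psum n 1) / real n) \<longlonglongrightarrow> pressure 1"
    by (rule pressure_limit) simp
  ultimately show ?thesis by (rule LIMSEQ_unique[rotated])
qed

text \<open>Words of length 1 suffice: finite parts of their sum approach those of the divergent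
  harmonic series as s decreases to 1/2. The summand ln 4 in \<open>R\<close> pays for comparing
  \<open>psum 1 s\<close> with the pressure.\<close>

lemma pressure_unbounded:
  "\<exists>s. 1 / 2 < s \<and> s < 1 \<and> K < pressure s"
proof -
  define R where "R = exp (K + ln 4)"
  have "\<exists>N. R < (\<Sum>a<N. 1 / real (Suc a))"
  proof (rule ccontr)
    assume "\<not> (\<exists>N. R < (\<Sum>a<N. 1 / real (Suc a)))"
    then have "summable (\<lambda>a. 1 / real (Suc a))"
      by (intro summableI_nonneg_bounded[where x = R]) (auto simp: not_less)
    then have "summable (\<lambda>a. 1 / real a)" by (subst (asm) summable_Suc_iff)
    then show False
      using not_summable_harmonic[where 'a = real] by (simp add: inverse_eq_divide)
  qed
  then obtain N where N: "R < (\<Sum>a<N. 1 / real (Suc a))" by blast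
  let ?g = "\<lambda>s. \<Sum>a<N. real (Suc a) powr (- 2 * s)"
  have "((\<lambda>s. ?g s) \<longlongrightarrow> ?g (1 / 2)) (at_right (1 / 2))"
    by (intro tendsto_sum tendsto_powr tendsto_mult tendsto_const tendsto_ident_at) auto
  moreover have "?g (1 / 2) = (\<Sum>a<N. 1 / real (Suc a))"
    by (intro sum.cong) (simp_all add: powr_neg_one)
  ultimately have "eventually (\<lambda>s. R < ?g s) (at_right (1 / 2))"
    using N by (auto dest: order_tendstoD(1))
  moreover have "eventually (\<lambda>s. s \<in> {1/2<..<1}) (at_right (1 / 2 :: real))"
    by (rule eventually_at_right_real) simp
  ultimately have "eventually (\<lambda>s. R < ?g s \<and> s \<in> {1/2<..<1}) (at_right (1 / 2))"
    by (rule eventually_conj)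
  then obtain s where s: "R < ?g s" "1 / 2 < s" "s < 1"
    using eventually_happens'[of "at_right (1 / 2 :: real)"] by auto
  have inj: "inj_on (\<lambda>a. [Suc a]) {..<N}" by (auto simp: inj_on_def)
  have "?g s = sum (weight s) ((\<lambda>a. [Suc a]) ` {..<N})"
    by (simp add: sum.reindex[OF inj] weight_def)
  also have "\<dots> = infsum (weight s) ((\<lambda>a. [Suc a]) ` {..<N})" by simp
  also have "\<dots> \<le> psum 1 s"
    unfolding psum_def using s
    by (intro infsum_mono_neutral summable_weight summable_on_finite)
       (auto simp: words_def weight_nonneg)
  finally have "R < psum 1 s" using s by simp
  moreover have "0 < R" by (simp add: R_def)
  ultimately have "ln R < ln (psum 1 s)" by simp
  moreover have "s * ln 4 < ln 4" using s by simp
  moreover have "ln R = K + ln 4" by (simp add: R_def)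
  moreover have "\<bar>ln (psum 1 s) - pressure s\<bar> \<le> s * ln 4"
    using pressure_limit(2)[OF s(2), of 1] by simp
  ultimately have "K < pressure s" by linarith
  then show ?thesis using s by blast
qed

text \<open>The function P(s) - s L is continuous and strictly decreasing, positive at some s close
  to 1/2 where P(s) > L, and equal to -L at 1.\<close>

lemma pressure_root_exists:
  assumes L: "0 < L"
  obtains \<theta> where "1 / 2 < \<theta>" "\<theta> < 1" "pressure \<theta> = \<theta> * L" "pressure_root L = \<theta>"
    "\<exists>!\<theta>. 1 / 2 < \<theta> \<and> pressure \<theta> = \<theta> * L"
    "\<And>s. \<theta> < s \<Longrightarrow> pressure s < s * L"
    "\<And>s. 1 / 2 < s \<Longrightarrow> s < \<theta> \<Longrightarrow> s * L < pressure s"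
proof -
  obtain s where s: "1 / 2 < s" "s < 1" "L < pressure s" using pressure_unbounded by blast
  have "s * L < 1 * L" using s L by (intro mult_strict_right_mono) auto
  then have 1: "0 \<le> pressure s - s * L" using s by simp
  have 2: "pressure 1 - 1 * L \<le> 0" using L by (simp add: pressure_1)
  have c: "continuous_on {s..1} (\<lambda>x. pressure x - x * L)"
    using s by (intro continuous_intros continuous_on_subset[OF continuous_on_pressure]) auto
  obtain \<theta> where \<theta>: "s \<le> \<theta>" "\<theta> \<le> 1" "pressure \<theta> - \<theta> * L = 0"
    using IVT2'[of "\<lambda>x. pressure x - x * L" 1 0 s, OF 2 1 _ c] s by auto
  have dec: "pressure t - t * L < pressure r - r * L" if "1 / 2 < r" "r < t" for r t
  proof -
    have "r * L < t * L" using that L by (intro mult_strict_right_mono) auto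
    moreover have "(t - r) * ln 2 > 0" using that by simp
    ultimately show ?thesis using pressure_decreasing[of r t] that by linarith
  qed
  have \<theta>h: "1 / 2 < \<theta>" using \<theta> s by simp
  have "\<theta> \<noteq> 1" using \<theta> L pressure_1 by auto
  then have "\<theta> < 1" using \<theta> by simp
  have uniq: "\<theta>' = \<theta>" if "1 / 2 < \<theta>'" "pressure \<theta>' = \<theta>' * L" for \<theta>'
  proof (cases \<theta> \<theta>' rule: linorder_cases)
    case less
    then show ?thesis using dec[OF \<theta>h less] \<theta>(3) that(2) by linarith
  next
    case greater
    then show ?thesis using dec[OF that(1) greater] \<theta>(3) that(2) by linarith
  qed simp
  have root_eq: "1 / 2 < \<theta> \<and> pressure \<theta> = \<theta> * L" using \<theta>(3) \<theta>h by simp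
  have root: "pressure_root L = \<theta>"
    unfolding pressure_root_def by (rule the_equality) (use root_eq uniq in blast)+
  show ?thesis
  proof (rule that[OF \<theta>h \<open>\<theta> < 1\<close> _ root])
    show "\<exists>!\<theta>. 1 / 2 < \<theta> \<and> pressure \<theta> = \<theta> * L" by (rule ex1I[of _ \<theta>]) (use root_eq uniq in blast)+
    show "pressure s < s * L" if "\<theta> < s" for s using dec[OF \<theta>h that] \<theta> by simp
    show "s * L < pressure s" if "1 / 2 < s" "s < \<theta>" for s using dec[OF that] \<theta> by simp
  qed (use \<theta> in auto)
qed

section \<open>Upper bounds\<close>

text \<open>Grouping words by length, those of length n contribute at most a constant times exp (n
  P(\<sigma>)), which \<open>g n\<close> has to compensate.\<close>

lemma summable_on_pos_words:
  assumes \<sigma>: "1 / 2 < \<sigma>" and g: "\<And>n. 0 \<le> g n"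
    and summ: "summable (\<lambda>n. exp (real n * pressure \<sigma>) * g n)"
  shows "(\<lambda>w. weight \<sigma> w * g (length w)) summable_on {w. pos_word w}"
proof -
  have bij: "bij_betw snd (SIGMA n:UNIV. words n) {w. pos_word w}"
    by (rule bij_betw_byWitness[where f' = "\<lambda>w. (length w, w)"]) (auto simp: words_def)
  have "(\<lambda>x. weight \<sigma> (snd x) * g (fst x)) summable_on (SIGMA n:UNIV. words n)"
  proof (rule summable_on_SigmaI)
    show "((\<lambda>w. weight \<sigma> (snd (n, w)) * g (fst (n, w))) has_sum psum n \<sigma> * g n) (words n)" for n
      unfolding psum_def fst_conv snd_conv
      by (intro has_sum_cmult_left has_sum_infsum summable_weight \<sigma>)
    have "(\<lambda>n. 4 powr \<sigma> * (exp (real n * pressure \<sigma>) * g n)) summable_on UNIV"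
      using summ g by (intro summable_on_cmult_right) (auto simp: summable_on_UNIV_nonneg_real_iff)
    then show "(\<lambda>n. psum n \<sigma> * g n) summable_on UNIV"
    proof (rule summable_on_comparison_test)
      fix n
      show "psum n \<sigma> * g n \<le> 4 powr \<sigma> * (exp (real n * pressure \<sigma>) * g n)"
        using mult_right_mono[OF psum_le[OF \<sigma>, of n] g[of n]] by (simp add: mult.assoc)
      show "0 \<le> psum n \<sigma> * g n"
        using psum_pos[OF \<sigma>, of n] g by simp
    qed
  qed (use g weight_nonneg in auto)
  also have "?this \<longleftrightarrow> (\<lambda>x. weight \<sigma> (snd x) * g (length (snd x))) summable_on (SIGMA n:UNIV. words n)"
    by (intro summable_on_cong) (auto simp: words_def)
  also have "\<dots> \<longleftrightarrow> (\<lambda>w. weight \<sigma> w * g (length w)) summable_on {w. pos_word w}"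
    by (rule summable_on_reindex_bij_betw[OF bij])
  finally show ?thesis .
qed

text \<open>The bound \<open>r\<close> on the reciprocal of the next digit may depend on the whole
  word, not only on its length. A power of q contained in \<open>r\<close> is absorbed by passing
  from s to a different exponent \<sigma>; this is how s below 1/2 is reached.\<close>

lemma hausdorff_dim_le_of_large_digits:
  fixes r :: "nat list \<Rightarrow> real"
  assumes s: "0 < s" and \<sigma>: "1 / 2 < \<sigma>" and r: "\<And>w. 0 \<le> r w" and g: "\<And>n. 0 \<le> g n"
    and summ: "summable (\<lambda>n. exp (real n * pressure \<sigma>) * g n)"
    and le: "\<And>w. pos_word w \<Longrightarrow> (r w / (rQ w)\<^sup>2) powr s \<le> weight \<sigma> w * g (length w)"
    and A: "\<And>x. x \<in> A \<Longrightarrow> \<exists>a. pos_seq a \<and> cval a = x \<and> (\<exists>\<^sub>\<infinity>n. 1 / real (a n) \<le> r (pre n a))"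
  shows "hausdorff_dim A \<le> ereal s"
proof -
  \<comment> \<open>After the prefix \<open>w\<close> the tail value is at most the reciprocal of
    the next digit, so these are the points whose next digit is large, enclosed in an interval of
    length at most r / q^2.\<close>
  define U where "U = (\<lambda>w. cft w ` {0..r w})"
  have dist: "norm (x - y) \<le> r w / (rQ w)\<^sup>2" if w: "pos_word w" and x: "x \<in> U w" and y: "y \<in> U w" for w x y
  proof -
    obtain t where "0 \<le> t" "t \<le> r w" "x = cft w t" using x by (auto simp: U_def)
    moreover obtain t' where "0 \<le> t'" "t' \<le> r w" "y = cft w t'" using y by (auto simp: U_def)
    ultimately have t: "0 \<le> t" "t \<le> r w" "0 \<le> t'" "t' \<le> r w" "x = cft w t" "y = cft w t'"
      by blast+
    have "norm (x - y) \<le> \<bar>t - t'\<bar> / (rQ w)\<^sup>2"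
      using cft_diff_le[OF w t(1,3)] t by simp
    also have "\<dots> \<le> r w / (rQ w)\<^sup>2" using t by (intro divide_right_mono) auto
    finally show ?thesis .
  qed
  have "hausdorff_measure s A = 0"
  proof (rule hausdorff_measure_limsup[OF s, where I = "{w. pos_word w}" and U = U])
    fix w assume "w \<in> {w. pos_word w}"
    then have w: "pos_word w" by simp
    show "diameter (U w) \<le> r w / (rQ w)\<^sup>2"
      using r[of w] by (intro diameter_le dist[OF w]) auto
    have "U w \<subseteq> cball (cft w 0) (r w / (rQ w)\<^sup>2)"
    proof
      fix x assume "x \<in> U w"
      moreover have "cft w 0 \<in> U w" using r[of w] by (auto simp: U_def)
      ultimately show "x \<in> cball (cft w 0) (r w / (rQ w)\<^sup>2)"
        using dist[OF w] by (auto simp: dist_norm)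
    qed
    then show "bounded (U w)" using bounded_cball bounded_subset by blast
  next
    show "(\<lambda>w. (r w / (rQ w)\<^sup>2) powr s) summable_on {w. pos_word w}"
      by (rule summable_on_comparison_test[OF summable_on_pos_words[OF \<sigma> g summ]]) (auto simp: le)
  next
    fix x assume "x \<in> A"
    then obtain a where a: "pos_seq a" "cval a = x" "\<exists>\<^sub>\<infinity>n. 1 / real (a n) \<le> r (pre n a)"
      using A by blast
    have "infinite ((\<lambda>n. pre n a) ` {n. 1 / real (a n) \<le> r (pre n a)})"
    proof -
      have "inj_on (\<lambda>n. pre n a) X" for X by (metis inj_onI length_pre)
      then show ?thesis using a(3) by (simp add: finite_image_iff frequently_cofinite)
    qed
    moreover have "x \<in> U (pre n a)" if n: "1 / real (a n) \<le> r (pre n a)" for n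
    proof -
      have an: "1 \<le> real (a n)" using a(1) by (auto simp: pos_seq_def)
      have "cval (shift n a) = 1 / (real (a n) + cval (shift 1 (shift n a)))"
        using cval_step[OF pos_seq_shift[OF a(1)], of n] by (simp add: shift_def)
      also have "\<dots> \<le> 1 / real (a n)"
        using cval_bounds[OF pos_seq_shift[OF pos_seq_shift[OF a(1)]], of 1 n] an
        by (intro divide_left_mono) auto
      finally have "cval (shift n a) \<in> {0..r (pre n a)}"
        using n cval_bounds[OF pos_seq_shift[OF a(1)], of n] by auto
      then show "x \<in> U (pre n a)"
        using a cval_tail[OF a(1), of n] by (auto simp: U_def)
    qed
    then have "(\<lambda>n. pre n a) ` {n. 1 / real (a n) \<le> r (pre n a)} \<subseteq> {w \<in> {w. pos_word w}. x \<in> U w}"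
      using pos_word_pre[OF a(1)] by auto
    ultimately show "infinite {w \<in> {w. pos_word w}. x \<in> U w}" by (meson finite_subset)
  qed
  then show ?thesis using s by (intro hausdorff_dim_le) auto
qed

lemma hausdorff_dim_le_exponential:
  assumes s: "1 / 2 < s" and B: "1 \<le> B" and P: "pressure s < s * ln B"
    and A: "A \<subseteq> cval ` {a. pos_seq a \<and> (\<exists>\<^sub>\<infinity>n. B ^ n \<le> real (a n))}"
  shows "hausdorff_dim A \<le> ereal s"
proof (rule hausdorff_dim_le_of_large_digits[where r = "\<lambda>w. 1 / B ^ length w" and \<sigma> = s
      and g = "\<lambda>n. exp (- (real n * (s * ln B)))"])
  have "exp (real n * pressure s) * exp (- (real n * (s * ln B))) = exp (pressure s - s * ln B) ^ n" for n
    by (simp add: exp_of_nat_mult[symmetric] exp_add[symmetric] algebra_simps)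
  then show "summable (\<lambda>n. exp (real n * pressure s) * exp (- (real n * (s * ln B))))"
    using P by (simp add: summable_geometric)
next
  fix w assume w: "pos_word w"
  have q: "0 < rQ w" by (rule rQ_pos[OF w])
  have "(1 / B ^ length w / (rQ w)\<^sup>2) powr s
      = exp (- (real (length w) * (s * ln B))) * weight s w"
    using q B by (simp add: weight_def powr_def ln_div ln_mult ln_realpow exp_add[symmetric] algebra_simps)
  then show "(1 / B ^ length w / (rQ w)\<^sup>2) powr s
      \<le> weight s w * exp (- (real (length w) * (s * ln B)))"
    by simp
next
  fix x assume "x \<in> A"
  then obtain a where a: "pos_seq a" "\<exists>\<^sub>\<infinity>n. B ^ n \<le> real (a n)" "cval a = x" using A by blast
  have "\<exists>\<^sub>\<infinity>n. 1 / real (a n) \<le> 1 / B ^ length (pre n a)"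
    using a(2)
  proof (rule frequently_elim1)
    fix n assume "B ^ n \<le> real (a n)"
    then show "1 / real (a n) \<le> 1 / B ^ length (pre n a)"
      using B by (simp add: frac_le)
  qed
  then show "\<exists>a. pos_seq a \<and> cval a = x \<and> (\<exists>\<^sub>\<infinity>n. 1 / real (a n) \<le> 1 / B ^ length (pre n a))"
    using a by blast
qed (use s B in auto)

text \<open>If \<open>ln q\<^sub>n / c\<^sup>n\<close> is unbounded, then it increases, from a value at least 1, infinitely often.\<close>

lemma denominator_jumps:
  assumes a: "pos_seq a" and c: "1 < c" "c < d" and inf: "\<exists>\<^sub>\<infinity>n. exp (d ^ n) \<le> real (a n)"
  shows "\<exists>\<^sub>\<infinity>n. max (rQ (pre n a) powr c) (exp (c ^ Suc n)) \<le> rQ (pre (Suc n) a)"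
proof (rule ccontr)
  define q where "q = (\<lambda>n. rQ (pre n a))"
  have q1: "1 \<le> q n" for n using cQ_pos[OF pos_word_pre[OF a, of n]] by (simp add: q_def)
  assume "\<not> (\<exists>\<^sub>\<infinity>n. max (rQ (pre n a) powr c) (exp (c ^ Suc n)) \<le> rQ (pre (Suc n) a))"
  then obtain N where N: "\<And>n. n \<ge> N \<Longrightarrow> q (Suc n) < max (q n powr c) (exp (c ^ Suc n))"
    unfolding frequently_sequentially cofinite_eq_sequentially q_def by (meson not_le)
  \<comment> \<open>Without jumps beyond \<open>N\<close>, each step multiplies ln q by at most c or
    keeps it below c^(n+1), so ln q_n / c^n never exceeds the larger of 1 and its value at
    \<open>N\<close>.\<close>
  define K where "K = max 1 (ln (q N) / c ^ N)"
  have bdd: "ln (q n) \<le> K * c ^ n" if "n \<ge> N" for n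
    using that
  proof (induction n rule: dec_induct)
    case base
    have "ln (q N) = ln (q N) / c ^ N * c ^ N" using c by simp
    also have "\<dots> \<le> K * c ^ N" using c by (intro mult_right_mono) (auto simp: K_def)
    finally show ?case .
  next
    case (step n)
    have "ln (q (Suc n)) \<le> ln (max (q n powr c) (exp (c ^ Suc n)))"
      using N[OF step(1)] q1[of "Suc n"] by simp
    also have "\<dots> = max (c * ln (q n)) (c ^ Suc n)"
      using q1[of n] by (auto simp: max_def ln_powr powr_def)
    also have "\<dots> \<le> K * c ^ Suc n"
    proof (rule max.boundedI)
      show "c * ln (q n) \<le> K * c ^ Suc n" using mult_left_mono[OF step.IH, of c] c by (simp add: algebra_simps)
      show "c ^ Suc n \<le> K * c ^ Suc n" using c mult_right_mono[of 1 K "c ^ Suc n"] by (simp add: K_def)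
    qed
    finally show ?case .
  qed
  \<comment> \<open>A digit exp (d^n) forces ln q_(n+1) \<ge> d^n, which for large n exceeds K
    c^(n+1) because d > c.\<close>
  have "(\<lambda>n. K * c * (c / d) ^ n) \<longlonglongrightarrow> 0"
    using c by (intro tendsto_mult_right_zero LIMSEQ_realpow_zero) auto
  then have "eventually (\<lambda>n. K * c * (c / d) ^ n < 1) sequentially"
    by (rule order_tendstoD) simp
  then have "eventually (\<lambda>n. K * c ^ Suc n < d ^ n \<and> n \<ge> N) sequentially"
    using eventually_ge_at_top[of N]
    by eventually_elim (use c in \<open>auto simp: field_simps power_divide\<close>)
  then have "\<exists>\<^sub>\<infinity>n. exp (d ^ n) \<le> real (a n) \<and> (K * c ^ Suc n < d ^ n \<and> n \<ge> N)"
    using inf by (intro frequently_eventually_frequently) (auto simp: cofinite_eq_sequentially)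
  then obtain n where n: "exp (d ^ n) \<le> real (a n)" "K * c ^ Suc n < d ^ n" "n \<ge> N"
    by (auto dest: frequently_ex)
  have "real (a n) * 1 \<le> real (a n) * q n" using q1 by (intro mult_left_mono) auto
  also have "\<dots> \<le> q (Suc n)" by (simp add: q_def pre_Suc cQ_snoc)
  finally have "exp (d ^ n) \<le> q (Suc n)" using n by simp
  then have "d ^ n \<le> ln (q (Suc n))" using q1[of "Suc n"] by (subst ln_ge_iff) auto
  also have "\<dots> \<le> K * c ^ Suc n" using n by (intro bdd) auto
  finally show False using n by simp
qed

lemma summable_exp_linear_minus_power:
  fixes p k c :: real
  assumes "1 < c" "0 < k"
  shows "summable (\<lambda>n. exp (real n * p) * exp (- (k * c ^ n)))"
proof (rule summable_comparison_test_ev)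
  have "(\<lambda>n. (\<bar>p\<bar> + 1) * (real n * (1 / c) ^ n)) \<longlonglongrightarrow> (\<bar>p\<bar> + 1) * 0"
    using assms by (intro tendsto_mult tendsto_const powser_times_n_limit_0) auto
  then have "eventually (\<lambda>n. (\<bar>p\<bar> + 1) * (real n * (1 / c) ^ n) < k) sequentially"
    using assms by (intro order_tendstoD) auto
  then show "eventually (\<lambda>n. norm (exp (real n * p) * exp (- (k * c ^ n))) \<le> exp (- 1) ^ n) sequentially"
  proof eventually_elim
    case (elim n)
    have "(\<bar>p\<bar> + 1) * real n \<le> k * c ^ n"
      using elim assms by (simp add: power_divide field_simps)
    moreover have "real n * p \<le> real n * \<bar>p\<bar>" by (intro mult_left_mono) auto
    ultimately have "real n * p - k * c ^ n \<le> - real n" by (simp add: algebra_simps)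
    then have "exp (real n * p - k * c ^ n) \<le> exp (- real n)" by simp
    then show ?case by (simp add: exp_diff exp_minus divide_inverse exp_of_nat_mult[symmetric] power_inverse)
  qed
  show "summable (\<lambda>n. exp (- 1 :: real) ^ n)" by (simp add: summable_geometric)
qed

text \<open>At a jump q_(n+1) \<ge> q_n^c the interval has length at most a constant times
  q_n^(-1-c). Its s-th power is compared with q_n^(-2 \<sigma>), where 2 \<sigma> lies between 1 and
  s (1 + c). The share \<eta> of the other lower bound exp (c^(n+1)) is spent on beating the growth
  exp (n P(\<sigma>)).\<close>

lemma hausdorff_dim_le_double_exponential:
  assumes d: "1 < d" and s: "1 / (1 + d) < s"
    and A: "A \<subseteq> cval ` {a. pos_seq a \<and> (\<exists>\<^sub>\<infinity>n. exp (d ^ n) \<le> real (a n))}"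
  shows "hausdorff_dim A \<le> ereal s"
proof -
  have s0: "0 < s" using d s by (meson add_pos_pos divide_pos_pos less_trans zero_less_one)
  have "1 / s - 1 < d" using s s0 d by (simp add: field_simps)
  then have "max 1 (1 / s - 1) < d" using d by simp
  then obtain c where c: "max 1 (1 / s - 1) < c" "c < d" using dense by blast
  have c1: "1 < c" using c by simp
  have sc: "1 < s * (1 + c)" using c s0 by (simp add: field_simps)
  \<comment> \<open>Using the share \<eta> lowers the exponent of q by s c \<eta>; this choice gives
    away at most half of the surplus s (1 + c) - 1, so \<sigma> stays above 1/2.\<close>
  define \<eta> where "\<eta> = min 1 ((s * (1 + c) - 1) / (2 * s * c))"
  have \<eta>: "0 < \<eta>" "\<eta> \<le> 1" using sc s0 c1 by (auto simp: \<eta>_def)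
  define \<sigma> where "\<sigma> = s * (1 + c * (1 - \<eta>)) / 2"
  have \<sigma>: "1 / 2 < \<sigma>"
  proof -
    have "\<eta> \<le> (s * (1 + c) - 1) / (2 * s * c)" by (simp add: \<eta>_def)
    then have "\<eta> * (2 * s * c) \<le> s * (1 + c) - 1" using s0 c1 by (simp add: pos_le_divide_eq)
    then show ?thesis using sc by (simp add: \<sigma>_def algebra_simps)
  qed
  \<comment> \<open>Lower bound for the next denominator at a jump. Since q_(n+1) \<le> (a_n + 1)
    q_n \<le> 2 a_n q_n, it gives 1 / a_n \<le> 2 q_n / m, the radius used below.\<close>
  define m where "m = (\<lambda>w. max (rQ w powr c) (exp (c ^ Suc (length w))))"
  have m0: "0 < m w" for w by (simp add: m_def less_max_iff_disj)
  show ?thesis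
  proof (rule hausdorff_dim_le_of_large_digits[where r = "\<lambda>w. 2 * rQ w / m w" and \<sigma> = \<sigma>
        and g = "\<lambda>n. 2 powr s * exp (- (s * \<eta> * c * c ^ n))"])
    show "summable (\<lambda>n. exp (real n * pressure \<sigma>) * (2 powr s * exp (- (s * \<eta> * c * c ^ n))))"
      using summable_mult[OF summable_exp_linear_minus_power[of c "s * \<eta> * c" "pressure \<sigma>"], of "2 powr s"] c1 s0 \<eta>
      by (simp add: mult_ac)
  next
    fix w assume w: "pos_word w"
    have q: "0 < rQ w" by (rule rQ_pos[OF w])
    let ?l = "ln (rQ w)" and ?e = "c ^ Suc (length w)"
    have lm: "ln (m w) = max (c * ?l) ?e"
      using q by (auto simp: m_def max_def powr_def)
    have "(1 - \<eta>) * (c * ?l) + \<eta> * ?e \<le> (1 - \<eta>) * ln (m w) + \<eta> * ln (m w)"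
      using \<eta> unfolding lm by (intro add_mono mult_left_mono) auto
    then have lm': "(1 - \<eta>) * (c * ?l) + \<eta> * ?e \<le> ln (m w)" by (simp add: algebra_simps)
    have "(2 * rQ w / m w / (rQ w)\<^sup>2) powr s = exp (s * (ln 2 - ?l - ln (m w)))"
      using q m0[of w] by (simp add: powr_def ln_div ln_mult ln_realpow)
    also have "\<dots> \<le> exp (s * (ln 2 - ?l - ((1 - \<eta>) * (c * ?l) + \<eta> * ?e)))"
      using lm' s0 by simp
    also have "\<dots> = weight \<sigma> w * (2 powr s * exp (- (s * \<eta> * c * c ^ length w)))"
      using q by (simp add: weight_def powr_def exp_add[symmetric] \<sigma>_def field_simps)
    finally show "(2 * rQ w / m w / (rQ w)\<^sup>2) powr s
       \<le> weight \<sigma> w * (2 powr s * exp (- (s * \<eta> * c * c ^ length w)))" .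
  next
    fix x assume "x \<in> A"
    then obtain a where a: "pos_seq a" "\<exists>\<^sub>\<infinity>n. exp (d ^ n) \<le> real (a n)" "cval a = x" using A by blast
    have "\<exists>\<^sub>\<infinity>n. 1 / real (a n) \<le> 2 * rQ (pre n a) / m (pre n a)"
      using denominator_jumps[OF a(1) c1 c(2) a(2)]
    proof (rule frequently_elim1)
      fix n
      assume "max (rQ (pre n a) powr c) (exp (c ^ Suc n)) \<le> rQ (pre (Suc n) a)"
      then have "m (pre n a) \<le> rQ (pre (Suc n) a)" by (simp add: m_def)
      also have "\<dots> \<le> real ((a n + 1) * cQ (pre n a))"
        unfolding pre_Suc by (intro of_nat_mono cQ_snoc_le pos_word_pre a)
      also have "\<dots> \<le> real (2 * a n * cQ (pre n a))"
        using a(1) by (intro of_nat_mono mult_le_mono) (auto simp: pos_seq_def)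
      finally have "m (pre n a) \<le> 2 * real (a n) * rQ (pre n a)" by simp
      moreover have "0 < real (a n)" using a(1) by (auto simp: pos_seq_def Suc_le_eq)
      ultimately show "1 / real (a n) \<le> 2 * rQ (pre n a) / m (pre n a)"
        using m0[of "pre n a"] by (simp add: field_simps)
    qed
    then show "\<exists>a. pos_seq a \<and> cval a = x \<and> (\<exists>\<^sub>\<infinity>n. 1 / real (a n) \<le> 2 * rQ (pre n a) / m (pre n a))"
      using a by blast
  qed (use s0 \<sigma> m0 in \<open>auto simp: less_imp_le\<close>)
qed

section \<open>Lower bounds from random digits\<close>

text \<open>A value can be close to 1 only if its first digit is 1 and its second digit is
  huge.\<close>

lemma cval_le_gap:
  assumes x: "pos_seq x" and C: "0 \<le> C" and gap: "2 \<le> x 0 \<or> real (x 1) \<le> C"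
  shows "cval x \<le> 1 - 1 / (C + 2)"
proof -
  let ?t = "cval (shift 1 x)"
  have t: "0 < ?t" by (intro cval_bounds pos_seq_shift x)
  have eq: "cval x = 1 / (real (x 0) + ?t)" by (rule cval_step[OF x])
  have half: "1 / 2 \<le> 1 - 1 / (C + 2)" using C by (simp add: field_simps)
  show ?thesis
  proof (cases "2 \<le> x 0")
    case True
    then have "cval x \<le> 1 / 2" unfolding eq using t by (intro divide_left_mono) auto
    then show ?thesis using half by linarith
  next
    case False
    have t': "0 < cval (shift 1 (shift 1 x))" "cval (shift 1 (shift 1 x)) < 1"
      by (intro cval_bounds pos_seq_shift x)+
    have "?t = 1 / (real (x 1) + cval (shift 1 (shift 1 x)))"
      using cval_step[OF pos_seq_shift[OF x], of 1] by (simp add: shift_def)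
    also have "\<dots> \<ge> 1 / (C + 1)"
      using gap False t' C by (intro divide_left_mono mult_pos_pos) auto
    finally have "1 / (C + 1) \<le> ?t" .
    moreover have "1 \<le> real (x 0)" using x by (auto simp: pos_seq_def)
    ultimately have "cval x \<le> 1 / (1 + 1 / (C + 1))"
      unfolding eq using C t by (intro divide_left_mono mult_pos_pos add_pos_pos add_mono) auto
    also have "\<dots> = 1 - 1 / (C + 2)" using C by (simp add: field_simps)
    finally show ?thesis .
  qed
qed

text \<open>The tails are 1 / (a + t) and 1 / (b + t') with a < b. For b = a + 1 they merge only if
  t is near 1 and t' near 0, so it is enough to keep the tail of the point with the smaller digit
  away from 1. The constant 16 is 4 from a + t \<le> 2 a, b + t' \<le> 2 b, times 4 from
  \<open>cft_diff_ge\<close>.\<close>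

lemma cval_separation:
  assumes x: "pos_seq x" and y: "pos_seq y" and pre: "pre n x = pre n y" and lt: "x n < y n"
    and \<mu>: "0 < \<mu>" and gap: "cval (shift (Suc n) x) \<le> 1 - \<mu>"
  shows "\<mu> * (real (y n) - real (x n)) / (16 * real (x n) * real (y n) * (rQ (pre n x))\<^sup>2)
    \<le> \<bar>cval x - cval y\<bar>"
proof -
  define a b where "a = real (x n)" and "b = real (y n)"
  define t t' where "t = cval (shift (Suc n) x)" and "t' = cval (shift (Suc n) y)"
  define Q where "Q = rQ (pre n x)"
  have Q: "Q > 0" using cQ_pos[OF pos_word_pre[OF x, of n]] by (simp add: Q_def)
  have ab: "1 \<le> a" "a + 1 \<le> b" using x lt by (auto simp: a_def b_def pos_seq_def)
  have t: "0 < t" "t < 1" "0 < t'" "t' < 1" "t \<le> 1 - \<mu>"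
    using gap cval_bounds[OF pos_seq_shift[OF x]] cval_bounds[OF pos_seq_shift[OF y]]
    by (auto simp: t_def t'_def)
  have Tx: "cval (shift n x) = 1 / (a + t)" and Ty: "cval (shift n y) = 1 / (b + t')"
    using cval_step[OF pos_seq_shift[OF x], of n] cval_step[OF pos_seq_shift[OF y], of n]
    unfolding shift_shift by (simp_all add: a_def b_def t_def t'_def shift_def)
  have num: "\<mu> * (b - a) \<le> (b + t') - (a + t)"
  proof -
    have "(1 - \<mu>) * 1 \<le> (1 - \<mu>) * (b - a)" using t ab by (intro mult_left_mono) auto
    then show ?thesis using t by (simp add: algebra_simps)
  qed
  have "\<mu> * (b - a) / (4 * a * b) \<le> ((b + t') - (a + t)) / ((a + t) * (b + t'))"
  proof (rule frac_le)
    have "(a + t) * (b + t') \<le> (2 * a) * (2 * b)" using ab t by (intro mult_mono) auto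
    then show "(a + t) * (b + t') \<le> 4 * a * b" by simp
    show "0 < (a + t) * (b + t')" using ab t by (intro mult_pos_pos) auto
    show "0 \<le> b + t' - (a + t)" using ab t by auto
  qed (rule num)
  also have "\<dots> = 1 / (a + t) - 1 / (b + t')"
    using ab t by (subst diff_frac_eq) auto
  also have "\<dots> \<le> \<bar>cval (shift n x) - cval (shift n y)\<bar>" unfolding Tx Ty by simp
  finally have "\<mu> * (b - a) / (4 * a * b) / (4 * Q\<^sup>2) \<le> \<bar>cval (shift n x) - cval (shift n y)\<bar> / (4 * Q\<^sup>2)"
    using Q by (intro divide_right_mono) auto
  also have "\<dots> \<le> \<bar>cft (pre n x) (cval (shift n x)) - cft (pre n x) (cval (shift n y))\<bar>"
    unfolding Q_def
    by (intro cft_diff_ge pos_word_pre cval_bounds_weak pos_seq_shift x y)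
  also have "\<dots> = \<bar>cval x - cval y\<bar>"
    using cval_tail[OF x, of n] cval_tail[OF y, of n] pre by simp
  finally show ?thesis by (simp add: a_def b_def Q_def mult.assoc)
qed

lemma measurable_cfrac_map:
  assumes "\<And>n. (\<lambda>\<xi>. X \<xi> n) \<in> measurable M (count_space UNIV)"
  shows "(\<lambda>\<xi>. cfrac (map (X \<xi>) ks) :: real) \<in> borel_measurable M"
proof (induction ks)
  case (Cons k ks)
  have [measurable]: "(\<lambda>\<xi>. real (X \<xi> k)) \<in> borel_measurable M"
    by (rule measurable_compose[OF assms]) simp
  note Cons [measurable]
  show ?case by simp
qed simp

lemma measurable_cval:
  assumes "\<And>n. (\<lambda>\<xi>. X \<xi> n) \<in> measurable M (count_space UNIV)"
  shows "(\<lambda>\<xi>. cval (X \<xi>)) \<in> borel_measurable M"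
  unfolding cval_def pre_def
  by (intro borel_measurable_lim_metric measurable_cfrac_map assms)

text \<open>For points of an interval with longest common prefix \<open>w\<close>, the next digits span a range whose
  length is controlled by that of the interval; the first bound on the probabilities is used
  for long intervals and the second one, summed over this range, for short ones.\<close>

lemma hausdorff_dim_ge_random_digits:
  fixes X :: "'m \<Rightarrow> nat \<Rightarrow> nat" and L :: "nat \<Rightarrow> real"
  assumes "prob_space M"
    and X [measurable]: "\<And>n. (\<lambda>\<xi>. X \<xi> n) \<in> measurable M (count_space UNIV)"
    and C: "1 \<le> C" and s: "0 < s" "s \<le> 1" and L: "\<And>n. 1 \<le> L n"
    and G: "AE \<xi> in M. G \<xi>"
    and pos: "\<And>\<xi>. G \<xi> \<Longrightarrow> pos_seq (X \<xi>)"
    and lower: "\<And>\<xi> n. G \<xi> \<Longrightarrow> L n \<le> real (X \<xi> n)"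
    and upper: "\<And>\<xi> n. G \<xi> \<Longrightarrow> real (X \<xi> n) \<le> C * L n"
    and gap: "\<And>\<xi> n. G \<xi> \<Longrightarrow> 2 \<le> X \<xi> n \<or> real (X \<xi> (Suc n)) \<le> C"
    and prob1: "\<And>\<xi> n. G \<xi> \<Longrightarrow> measure M {\<xi>'\<in>space M. \<forall>k<n. X \<xi>' k = X \<xi> k}
        \<le> C * ((rQ (pre n (X \<xi>)))\<^sup>2 * L n) powr (- s)"
    and prob2: "\<And>\<xi> n. G \<xi> \<Longrightarrow> measure M {\<xi>'\<in>space M. \<forall>k<Suc n. X \<xi>' k = X \<xi> k}
        \<le> C * ((rQ (pre n (X \<xi>)))\<^sup>2 * L n) powr (- s) / L n"
    and A: "\<And>\<xi>. G \<xi> \<Longrightarrow> cval (X \<xi>) \<in> A"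
  shows "ereal s \<le> hausdorff_dim A"
proof -
  interpret prob_space M by fact
  define f where "f = (\<lambda>\<xi>. cval (X \<xi>))"
  have f [measurable]: "f \<in> borel_measurable M"
    unfolding f_def by (rule measurable_cval[OF X])
  define cyl where "cyl = (\<lambda>n \<xi>. {\<xi>'\<in>space M. \<forall>k<n. X \<xi>' k = X \<xi> k})"
  have cyl [measurable]: "cyl n \<xi> \<in> sets M" for n \<xi>
    unfolding cyl_def by measurable
  define \<mu> where "\<mu> = 1 / (C + 2)"
  have \<mu>: "0 < \<mu>" using C by (simp add: \<mu>_def)
  define K where "K = C * (32 * C\<^sup>2 / \<mu>) powr s"
  have K: "0 < K" using C \<mu> by (auto simp: K_def)
  have bound: "measure M {\<xi>\<in>space M. x \<le> f \<xi> \<and> f \<xi> \<le> y} \<le> K * (y - x) powr s" if xy: "x \<le> y" for x y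
  proof -
    define m where "m = measure M {\<xi>\<in>space M. x \<le> f \<xi> \<and> f \<xi> \<le> y}"
    define S where "S = {\<xi>\<in>space M. G \<xi> \<and> x \<le> f \<xi> \<and> f \<xi> \<le> y}"
    have m_le: "m \<le> measure M B" if "S \<subseteq> B" "B \<in> sets M" for B
      unfolding m_def
    proof (rule finite_measure_mono_AE)
      show "AE \<xi> in M. \<xi> \<in> {\<xi>\<in>space M. x \<le> f \<xi> \<and> f \<xi> \<le> y} \<longrightarrow> \<xi> \<in> B"
        using G by eventually_elim (use that in \<open>auto simp: S_def\<close>)
    qed (rule that)
    show ?thesis
    proof (cases "\<exists>n. \<exists>\<xi>1\<in>S. \<exists>\<xi>2\<in>S. X \<xi>1 n \<noteq> X \<xi>2 n")
      case False
      have "m \<le> 0"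
      proof (cases "S = {}")
        case True
        then show ?thesis using m_le[of "{}"] by simp
      next
        case nonempty: False
        then obtain \<xi> where \<xi>: "\<xi> \<in> S" by blast
        then have g: "G \<xi>" by (simp add: S_def)
        \<comment> \<open>The points of \<open>S\<close> agree in all digits, so \<open>S\<close>
          lies in a cylinder of every order, and these have probabilities tending to 0.\<close>
        have "m \<le> C * (2 * (1 / 2) ^ n) powr s" for n
        proof -
          let ?Q = "(rQ (pre n (X \<xi>)))\<^sup>2"
          have q: "?Q > 0" using cQ_pos[OF pos_word_pre[OF pos[OF g], of n]] by simp
          have "S \<subseteq> cyl n \<xi>" using False \<xi> by (auto simp: cyl_def S_def)
          then have "m \<le> measure M (cyl n \<xi>)" by (rule m_le) measurable
          also have "\<dots> \<le> C * (?Q * L n) powr (- s)" unfolding cyl_def by (rule prob1[OF g])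
          also have "\<dots> \<le> C * ?Q powr (- s)"
            using C s q L[of n] by (intro mult_left_mono powr_mono2') auto
          also have "?Q powr (- s) = (1 / ?Q) powr s"
            using q by (simp add: powr_minus_divide powr_divide)
          also have "C * (1 / ?Q) powr s \<le> C * (2 * (1 / 2) ^ n) powr s"
            using C s inverse_cQ_le[OF pos_word_pre[OF pos[OF g]], of n]
            by (intro mult_left_mono powr_mono2) auto
          finally show ?thesis .
        qed
        moreover have "(\<lambda>n. C * (2 * (1 / 2) ^ n) powr s) \<longlonglongrightarrow> 0" using s by real_asymp
        ultimately show ?thesis by (intro LIMSEQ_le_const) auto
      qed
      also have "0 \<le> K * (y - x) powr s" using K by simp
      finally show ?thesis by (simp add: m_def)
    next
      case True
      \<comment> \<open>All of \<open>S\<close> lies in one cylinder of order \<open>n\<close>, but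
        not in one of order \<open>Suc n\<close>.\<close>
      define n where "n = (LEAST n. \<exists>\<xi>1\<in>S. \<exists>\<xi>2\<in>S. X \<xi>1 n \<noteq> X \<xi>2 n)"
      have n: "\<exists>\<xi>1\<in>S. \<exists>\<xi>2\<in>S. X \<xi>1 n \<noteq> X \<xi>2 n" unfolding n_def by (rule LeastI_ex[OF True])
      have same: "X \<xi>1 k = X \<xi>2 k" if "\<xi>1 \<in> S" "\<xi>2 \<in> S" "k < n" for \<xi>1 \<xi>2 k
        using not_less_Least[of k "\<lambda>n. \<exists>\<xi>1\<in>S. \<exists>\<xi>2\<in>S. X \<xi>1 n \<noteq> X \<xi>2 n"] that
        unfolding n_def by blast
      have SG: "G \<xi>" if "\<xi> \<in> S" for \<xi> using that by (simp add: S_def)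
      define D where "D = (\<lambda>\<xi>. X \<xi> n) ` S"
      have "D \<subseteq> {..nat \<lfloor>C * L n\<rfloor>}"
        using upper[OF SG] by (auto simp: D_def le_nat_floor)
      then have fin: "finite D" by (rule finite_subset) simp
      have ne: "D \<noteq> {}" using n by (auto simp: D_def)
      define a b where "a = Min D" and "b = Max D"
      obtain \<xi>a where \<xi>a: "\<xi>a \<in> S" "X \<xi>a n = a"
        using Min_in[OF fin ne] by (auto simp: D_def a_def)
      obtain \<xi>b where \<xi>b: "\<xi>b \<in> S" "X \<xi>b n = b"
        using Max_in[OF fin ne] by (auto simp: D_def b_def)
      have Dab: "D \<subseteq> {a..b}" using fin by (auto simp: a_def b_def)
      have "a \<noteq> b"
      proof
        assume "a = b"
        then have "D \<subseteq> {a}" using Dab by simp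
        then show False using n by (auto simp: D_def)
      qed
      moreover have "a \<le> b" using Dab ne by fastforce
      ultimately have ab: "a < b" by simp
      define Q where "Q = rQ (pre n (X \<xi>a))"
      have Q: "Q > 0" using cQ_pos[OF pos_word_pre[OF pos[OF SG[OF \<xi>a(1)]], of n]] by (simp add: Q_def)
      have preS: "pre n (X \<xi>) = pre n (X \<xi>a)" if "\<xi> \<in> S" for \<xi>
        using same[OF that \<xi>a(1)] by (simp add: pre_eq_iff)
      \<comment> \<open>\<open>\<xi>a\<close> carries the smallest digit at \<open>n\<close>, and
        \<open>gap\<close> at the following position keeps its tail away from 1.\<close>
      have "cval (shift (Suc n) (X \<xi>a)) \<le> 1 - \<mu>"
        unfolding \<mu>_def
        using C gap[OF SG[OF \<xi>a(1)], of "Suc n"]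
        by (intro cval_le_gap pos_seq_shift pos SG \<xi>a(1)) (auto simp: shift_def)
      then have "\<mu> * (real (X \<xi>b n) - real (X \<xi>a n)) / (16 * real (X \<xi>a n) * real (X \<xi>b n) * Q\<^sup>2)
          \<le> \<bar>cval (X \<xi>a) - cval (X \<xi>b)\<bar>"
        unfolding Q_def using ab \<xi>a \<xi>b preS[OF \<xi>b(1)] \<mu> SG
        by (intro cval_separation pos) auto
      also have "\<dots> \<le> y - x" using \<xi>a(1) \<xi>b(1) by (auto simp: S_def f_def)
      finally have sep: "\<mu> * (real b - real a) / (16 * real a * real b * Q\<^sup>2) \<le> y - x"
        using \<xi>a \<xi>b by simp
      have a1: "1 \<le> real a" using pos[OF SG[OF \<xi>a(1)]] \<xi>a(2) by (auto simp: pos_seq_def)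
      have "16 * real a * real b * Q\<^sup>2 \<le> 16 * (C * L n) * (C * L n) * Q\<^sup>2"
        using upper[OF SG[OF \<xi>a(1)], of n] upper[OF SG[OF \<xi>b(1)], of n] \<xi>a(2) \<xi>b(2) C L[of n]
        by (intro mult_mono) auto
      moreover have "\<mu> * (real b - real a) \<le> (y - x) * (16 * real a * real b * Q\<^sup>2)"
        using sep a1 ab Q by (simp add: pos_divide_le_eq)
      ultimately have "\<mu> * (real b - real a) \<le> (y - x) * (16 * (C * L n) * (C * L n) * Q\<^sup>2)"
        using xy by (meson mult_left_mono order_trans diff_ge_0_iff_ge)
      then have len: "real b - real a \<le> 16 * C\<^sup>2 * (L n)\<^sup>2 * Q\<^sup>2 * (y - x) / \<mu>"
        using \<mu> by (subst pos_le_divide_eq) (simp_all add: power2_eq_square mult_ac)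
      define V where "V = C * (Q\<^sup>2 * L n) powr (- s)"
      have V: "V \<ge> 0" using C by (simp add: V_def)
      \<comment> \<open>Up to a constant, the ratio of y - x to 1 / (Q^2 L), the length scale of all
        continuations of the common prefix by digits of size L.\<close>
      define z where "z = (32 * C\<^sup>2 / \<mu>) * ((Q\<^sup>2 * L n) * (y - x))"
      have z: "z \<ge> 0" using C \<mu> L[of n] xy by (simp add: z_def)
      have mV: "m \<le> V"
      proof -
        have "S \<subseteq> cyl n \<xi>a"
        proof
          fix \<xi> assume \<xi>: "\<xi> \<in> S"
          have "\<forall>k<n. X \<xi> k = X \<xi>a k" using same[OF \<xi> \<xi>a(1)] by blast
          then show "\<xi> \<in> cyl n \<xi>a" using \<xi> by (simp add: cyl_def S_def)
        qed
        then have "m \<le> measure M (cyl n \<xi>a)" by (rule m_le) measurable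
        also have "\<dots> \<le> V" unfolding cyl_def V_def Q_def by (rule prob1[OF SG[OF \<xi>a(1)]])
        finally show ?thesis .
      qed
      \<comment> \<open>Count the cylinders of order \<open>Suc n\<close> that meet
        \<open>S\<close>: at most b - a + 1 \<le> 2 (b - a) of them, each of mass at most
        \<open>V / L n\<close>.\<close>
      have mz: "m \<le> V * z"
      proof -
        define h where "h = (\<lambda>d. SOME \<xi>. \<xi> \<in> S \<and> X \<xi> n = d)"
        have h: "h d \<in> S \<and> X (h d) n = d" if "d \<in> D" for d
        proof -
          have "\<exists>\<xi>. \<xi> \<in> S \<and> X \<xi> n = d" using that by (auto simp: D_def)
          then show ?thesis unfolding h_def by (rule someI_ex)
        qed
        have "S \<subseteq> (\<Union>d\<in>D. cyl (Suc n) (h d))"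
        proof
          fix \<xi> assume \<xi>: "\<xi> \<in> S"
          then have d: "X \<xi> n \<in> D" by (auto simp: D_def)
          have "\<forall>k<n. X \<xi> k = X (h (X \<xi> n)) k" using same[OF \<xi>] h[OF d] by blast
          then have "\<xi> \<in> cyl (Suc n) (h (X \<xi> n))"
            using h[OF d] \<xi> by (simp add: cyl_def S_def less_Suc_eq)
          then show "\<xi> \<in> (\<Union>d\<in>D. cyl (Suc n) (h d))" using d by blast
        qed
        then have "m \<le> measure M (\<Union>d\<in>D. cyl (Suc n) (h d))"
          using fin by (intro m_le) auto
        also have "\<dots> \<le> (\<Sum>d\<in>D. measure M (cyl (Suc n) (h d)))"
          using fin by (intro finite_measure_subadditive_finite) auto
        also have "\<dots> \<le> (\<Sum>d\<in>D. V / L n)"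
        proof (rule sum_mono)
          fix d assume "d \<in> D"
          then have "h d \<in> S" using h by blast
          then show "measure M (cyl (Suc n) (h d)) \<le> V / L n"
            using prob2[OF SG, of "h d" n] preS[of "h d"] by (simp add: cyl_def V_def Q_def)
        qed
        also have "\<dots> = real (card D) * (V / L n)" by simp
        also have "\<dots> \<le> 2 * (real b - real a) * (V / L n)"
        proof (rule mult_right_mono)
          have "card D \<le> card {a..b}" using Dab by (intro card_mono) auto
          then show "real (card D) \<le> 2 * (real b - real a)" using ab by auto
        qed (use V L[of n] in auto)
        also have "\<dots> \<le> 2 * (16 * C\<^sup>2 * (L n)\<^sup>2 * Q\<^sup>2 * (y - x) / \<mu>) * (V / L n)"
          using len V L[of n] by (intro mult_right_mono mult_left_mono) auto
        also have "\<dots> = V * z"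
          using L[of n] by (simp add: z_def power2_eq_square)
        finally show ?thesis .
      qed
      \<comment> \<open>The two estimates interpolate because the smaller of 1 and z is at most z^s
        when 0 < s \<le> 1.\<close>
      have "m \<le> V * z powr s"
      proof (cases "1 \<le> z")
        case True
        then have "V * 1 \<le> V * z powr s" using V s by (intro mult_left_mono) (auto simp: ge_one_powr_ge_zero)
        then show ?thesis using mV by simp
      next
        case False
        then have "z \<le> z powr s" using z s by (cases "z = 0") (auto intro: powr_mono'[of s 1 z, simplified])
        then have "V * z \<le> V * z powr s" using V by (intro mult_left_mono)
        then show ?thesis using mz by simp
      qed
      also have "z powr s = (32 * C\<^sup>2 / \<mu>) powr s * ((Q\<^sup>2 * L n) powr s * (y - x) powr s)"
        using C \<mu> L[of n] xy by (simp add: z_def powr_mult del: times_divide_eq_left times_divide_eq_right)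
      also have "V * \<dots> = K * (y - x) powr s * ((Q\<^sup>2 * L n) powr (- s) * (Q\<^sup>2 * L n) powr s)"
        by (simp add: V_def K_def)
      also have "(Q\<^sup>2 * L n) powr (- s) * (Q\<^sup>2 * L n) powr s = 1"
        using Q L[of n] by (simp add: powr_add[symmetric])
      finally show ?thesis by (simp add: m_def)
    qed
  qed
  show ?thesis
  proof (rule mass_distribution[OF \<open>prob_space M\<close> f _ s(1) K bound])
    show "AE \<xi> in M. f \<xi> \<in> A" using G by eventually_elim (simp add: A f_def)
  qed
qed

section \<open>Products of discrete probability laws\<close>

abbreviation "indep_pmf p \<equiv> Pi\<^sub>M UNIV (\<lambda>i::nat. measure_pmf (p i))"

text \<open>The set \<open>E\<close> for the coordinate after the prefix covers two uses:
  \<open>UNIV\<close> for a plain prefix, and a singleton when the next coordinate is known as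
  well.\<close>

lemma prob_PiM_prefix:
  fixes p :: "nat \<Rightarrow> 'b pmf"
  defines "M \<equiv> indep_pmf p"
  shows "measure M {\<xi>\<in>space M. (\<forall>k<j. \<xi> k = b k) \<and> \<xi> j \<in> E}
    = (\<Prod>k<j. pmf (p k) (b k)) * measure_pmf.prob (p j) E"
proof -
  interpret product_prob_space "\<lambda>i. measure_pmf (p i)" UNIV
    by unfold_locales
  define F where "F = (\<lambda>k. if k < j then {b k} else E)"
  have "{\<xi>\<in>space M. (\<forall>k<j. \<xi> k = b k) \<and> \<xi> j \<in> E} = {\<xi>\<in>space M. \<forall>k\<in>{..j}. \<xi> k \<in> F k}"
    by (auto simp: F_def le_less)
  also have "measure M \<dots> = (\<Prod>k\<in>{..j}. measure_pmf.prob (p k) (F k))"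
  proof -
    have "{\<xi>\<in>space M. \<forall>k\<in>{..j}. \<xi> k \<in> F k} = emb UNIV {..j} (Pi\<^sub>E {..j} F)"
      unfolding M_def prod_emb_def by (auto simp: space_PiM Pi_iff)
    then show ?thesis unfolding M_def by (simp add: measure_PiM_emb)
  qed
  also have "{..j} = insert j {..<j}" by auto
  also have "(\<Prod>k\<in>insert j {..<j}. measure_pmf.prob (p k) (F k)) = 
     measure_pmf.prob (p j) E * (\<Prod>k<j. measure_pmf.prob (p k) {b k})"
    by (subst prod.insert) (auto simp: F_def intro!: prod.cong arg_cong2[where f = "(*)"])
  finally show ?thesis by (simp add: measure_pmf_single mult.commute)
qed

lemma AE_PiM_set_pmf:
  fixes p :: "nat \<Rightarrow> 'b pmf"
  shows "AE \<xi> in indep_pmf p. \<forall>k. \<xi> k \<in> set_pmf (p k)"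
  unfolding AE_all_countable
proof
  fix k
  show "AE \<xi> in indep_pmf p. \<xi> k \<in> set_pmf (p k)"
    by (rule AE_PiM_component) (auto simp: AE_measure_pmf_iff measure_pmf.prob_space_axioms)
qed

lemma prob_space_PiM_pmf: "prob_space (Pi\<^sub>M I (\<lambda>i. measure_pmf (p i)))"
  by (intro prob_space_PiM measure_pmf.prob_space_axioms)

lemma measurable_PiM_pmf_component:
  "(\<lambda>\<xi>. g (\<xi> k)) \<in> measurable (indep_pmf p) (count_space UNIV)"
  by (rule measurable_compose[OF measurable_component_singleton[of k UNIV]]) auto

section \<open>Independent digits of doubly exponential size\<close>

lemma cQ_pre_le_prod:
  assumes "pos_seq a"
  shows "rQ (pre n a) \<le> (\<Prod>k<n. real (a k) + 1)"
proof (induction n)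
  case (Suc n)
  have "rQ (pre (Suc n) a) \<le> real ((a n + 1) * cQ (pre n a))"
    unfolding pre_Suc by (intro of_nat_mono cQ_snoc_le pos_word_pre assms)
  also have "\<dots> = (real (a n) + 1) * rQ (pre n a)" by (simp add: algebra_simps)
  also have "\<dots> \<le> (real (a n) + 1) * (\<Prod>k<n. real (a k) + 1)"
    using Suc by (intro mult_left_mono) auto
  finally show ?case by (simp add: mult.commute)
qed simp

text \<open>Logarithm of the bound: product of 1 / N k at most K (Q^2 N n)^(-s), where l k = ln (N
  k) and Q is bounded by the product of the 2 N k. To leading order it compares s d^(n+1) with (1 -
  2 s) d^(n+1) / (d - 1), that is, s (1 + d) with 1.\<close>

lemma double_exponential_estimate:
  fixes d s :: real and l :: "nat \<Rightarrow> real"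
  assumes d: "1 < d" and s: "0 < s" "s < 1 / (1 + d)"
    and l: "\<And>k. d ^ Suc k \<le> l k" "\<And>k. l k \<le> d ^ Suc k + ln 2"
  shows "\<exists>K\<ge>1. \<forall>n. - (\<Sum>k<n. l k) \<le> ln K - s * (2 * (\<Sum>k<n. ln 2 + l k) + l n)"
proof -
  have sd: "s * (1 + d) < 1" using s d by (simp add: field_simps)
  moreover have "s * 2 < s * (1 + d)" using s d by (intro mult_strict_left_mono) auto
  ultimately have s2: "2 * s < 1" by linarith
  \<comment> \<open>The positive surplus in this comparison; e d^(n+1) absorbs the term linear in n
    that the factors 2 produce.\<close>
  define e where "e = (1 - 2 * s) / (d - 1) - s"
  have e: "e > 0" using sd d by (simp add: e_def field_simps)
  have "(\<lambda>n. exp (real n * (2 * s * ln 2)) * exp (- (e * d * d ^ n))) \<longlonglongrightarrow> 0"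
    using d e by (intro summable_LIMSEQ_zero summable_exp_linear_minus_power) auto
  then have "Bseq (\<lambda>n. exp (real n * (2 * s * ln 2)) * exp (- (e * d * d ^ n)))"
    by (intro convergent_imp_Bseq convergentI)
  then obtain K0 where K0: "K0 > 0" "\<And>n. norm (exp (real n * (2 * s * ln 2)) * exp (- (e * d * d ^ n))) \<le> K0"
    unfolding Bseq_def by blast
  define K1 where "K1 = max 1 K0"
  have K1: "real n * (2 * s * ln 2) - e * d ^ Suc n \<le> ln K1" for n
  proof -
    have "exp (real n * (2 * s * ln 2) - e * d ^ Suc n) \<le> K1"
      using K0(2)[of n] by (simp add: exp_diff exp_minus divide_inverse K1_def mult.assoc le_max_iff_disj)
    then show ?thesis by (subst ln_ge_iff) (auto simp: K1_def)
  qed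
  define c where "c = s * ln 2 + (1 - 2 * s) * d / (d - 1)"
  have c: "0 \<le> c" using s s2 d by (simp add: c_def)
  have "- (\<Sum>k<n. l k) \<le> ln (K1 * exp c) - s * (2 * (\<Sum>k<n. ln 2 + l k) + l n)" for n
  proof -
    have gs: "(\<Sum>k<n. d ^ Suc k) = (d ^ Suc n - d) / (d - 1)"
    proof -
      have "(\<Sum>k<n. d ^ Suc k) = d * (\<Sum>k<n. d ^ k)" by (simp add: sum_distrib_left)
      also have "\<dots> = d * ((d ^ n - 1) / (d - 1))" using geometric_sum[of d n] d by simp
      also have "\<dots> = (d ^ Suc n - d) / (d - 1)" by (simp add: right_diff_distrib)
      finally show ?thesis .
    qed
    have "(\<Sum>k<n. d ^ Suc k) \<le> (\<Sum>k<n. l k)" by (intro sum_mono l)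
    then have "(1 - 2 * s) * ((d ^ Suc n - d) / (d - 1)) \<le> (1 - 2 * s) * (\<Sum>k<n. l k)"
      using s2 unfolding gs by (intro mult_left_mono) auto
    moreover have "s * l n \<le> s * (d ^ Suc n + ln 2)" using s l by (intro mult_left_mono) auto
    moreover have "s * (d ^ Suc n + ln 2) + real n * (2 * s * ln 2) - (1 - 2 * s) * ((d ^ Suc n - d) / (d - 1))
        = real n * (2 * s * ln 2) - e * d ^ Suc n + c"
      by (simp add: e_def c_def divide_inverse algebra_simps)
    moreover have "s * (2 * (\<Sum>k<n. ln 2 + l k) + l n)
        = real n * (2 * s * ln 2) + 2 * s * (\<Sum>k<n. l k) + s * l n"
      by (simp add: sum.distrib algebra_simps)
    moreover have "ln (K1 * exp c) = ln K1 + c" by (subst ln_mult) (auto simp: K1_def)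
    ultimately show ?thesis using K1[of n] by (simp add: algebra_simps)
  qed
  moreover have "1 \<le> K1 * exp c" using c mult_mono[of 1 K1 1 "exp c"] by (simp add: K1_def)
  ultimately show ?thesis by blast
qed

text \<open>In the application \<psi> lies below the double exponential only along an unspecified
  infinite set of n, so every digit is made that large. With digits uniform between N and 2 N, a
  prefix has probability the product of the 1 / N k, while its denominator is at most the product of
  the 2 N k.\<close>

lemma hausdorff_dim_ge_double_exponential:
  assumes d: "1 < d" and s: "0 < s" "s < 1 / (1 + d)"
    and A: "cval ` {a. pos_seq a \<and> (\<forall>n. exp (d ^ Suc n) \<le> real (a n))} \<subseteq> A"
  shows "ereal s \<le> hausdorff_dim A"
proof -
  define N where "N = (\<lambda>n. nat \<lceil>exp (d ^ Suc n)\<rceil>)"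
  have N1: "exp (d ^ Suc n) \<le> real (N n)" for n unfolding N_def by (rule real_nat_ceiling_ge)
  have N2: "real (N n) \<le> 2 * exp (d ^ Suc n)" for n
  proof -
    have "0 \<le> d ^ Suc n" using d by simp
    then have "1 \<le> exp (d ^ Suc n)" by simp
    then show ?thesis unfolding N_def by linarith
  qed
  have N3: "2 \<le> N n" for n
  proof -
    have "1 < d ^ Suc n" using d by (intro one_less_power) auto
    then have "2 \<le> exp (d ^ Suc n)" using exp_ge_add_one_self[of "d ^ Suc n"] by linarith
    then show ?thesis using N1[of n] by linarith
  qed
  define p where "p = (\<lambda>n. pmf_of_set {N n..<2 * N n})"
  have ne: "{N n..<2 * N n} \<noteq> {}" "finite {N n..<2 * N n}" for n using N3[of n] by auto
  have set_p: "set_pmf (p n) = {N n..<2 * N n}" for n unfolding p_def by (rule set_pmf_of_set[OF ne])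
  have pmf_p: "pmf (p n) a = 1 / real (N n)" if "a \<in> {N n..<2 * N n}" for n a
    using that ne[of n] by (simp add: p_def)
  define l where "l = (\<lambda>n. ln (real (N n)))"
  have Npos: "real (N n) > 0" for n using N3[of n] by simp
  have l1: "d ^ Suc n \<le> l n" for n unfolding l_def using N1[of n] Npos[of n] by (subst ln_ge_iff) auto
  have l2: "l n \<le> d ^ Suc n + ln 2" for n
  proof -
    have "l n \<le> ln (2 * exp (d ^ Suc n))" unfolding l_def using N2[of n] Npos[of n] by (subst ln_le_cancel_iff) auto
    then show ?thesis by (simp add: ln_mult)
  qed
  obtain K where K: "K \<ge> 1" "\<And>n. - (\<Sum>k<n. l k) \<le> ln K - s * (2 * (\<Sum>k<n. ln 2 + l k) + l n)"
    using double_exponential_estimate[OF d s l1 l2] by blast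
  let ?M = "indep_pmf p"
  define G where "G = (\<lambda>\<xi>. \<forall>k. \<xi> k \<in> {N k..<2 * N k})"
  have "1 / (1 + d) \<le> 1" using d by simp
  then have s1: "s \<le> 1" using s by linarith
  have prob: "measure ?M {\<xi>'\<in>space ?M. \<forall>k<n. \<xi>' k = \<xi> k} = (\<Prod>k<n. 1 / real (N k))" if "G \<xi>" for \<xi> n
    using prob_PiM_prefix[of p n \<xi> UNIV] that by (simp add: G_def pmf_p)
  have main: "(\<Prod>k<n. 1 / real (N k)) \<le> K * ((rQ (pre n \<xi>))\<^sup>2 * real (N n)) powr (- s)"
    if g: "G \<xi>" for \<xi> n
  proof -
    have pos: "pos_seq \<xi>" unfolding pos_seq_def
    proof
      fix k show "1 \<le> \<xi> k" using g N3[of k] unfolding G_def by (meson atLeastLessThan_iff one_le_numeral order_trans)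
    qed
    let ?Q = "rQ (pre n \<xi>)"
    have q: "?Q > 0" using cQ_pos[OF pos_word_pre[OF pos, of n]] by simp
    have "?Q \<le> (\<Prod>k<n. real (\<xi> k) + 1)" by (rule cQ_pre_le_prod[OF pos])
    also have "\<dots> \<le> (\<Prod>k<n. 2 * real (N k))"
    proof (rule prod_mono)
      fix k
      have "\<xi> k + 1 \<le> 2 * N k" using g unfolding G_def by (auto simp: Suc_le_eq)
      then have "real (\<xi> k + 1) \<le> real (2 * N k)" by (rule of_nat_mono)
      then show "0 \<le> real (\<xi> k) + 1 \<and> real (\<xi> k) + 1 \<le> 2 * real (N k)" by simp
    qed
    finally have "ln ?Q \<le> ln (\<Prod>k<n. 2 * real (N k))" using q by (subst ln_le_cancel_iff) (auto intro: order.strict_trans2)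
    also have "\<dots> = (\<Sum>k<n. ln 2 + l k)"
      using Npos by (subst ln_prod) (auto simp: l_def ln_mult)
    finally have lnQ: "ln ?Q \<le> (\<Sum>k<n. ln 2 + l k)" .
    have "(\<Prod>k<n. 1 / real (N k)) = exp (- (\<Sum>k<n. l k))"
      using Npos by (simp add: exp_minus exp_sum l_def prod_dividef inverse_eq_divide)
    also have "\<dots> \<le> exp (ln K - s * (2 * ln ?Q + l n))"
    proof -
      have "s * (2 * ln ?Q + l n) \<le> s * (2 * (\<Sum>k<n. ln 2 + l k) + l n)"
        using lnQ s by (intro mult_left_mono) auto
      then show ?thesis using K(2)[of n] by simp
    qed
    also have "\<dots> = K * (?Q\<^sup>2 * real (N n)) powr (- s)"
      using K(1) q Npos[of n] by (simp add: powr_def ln_mult ln_realpow exp_diff exp_minus l_def divide_inverse)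
    finally show ?thesis .
  qed
  define C where "C = max 2 K"
  have C: "2 \<le> C" "K \<le> C" by (auto simp: C_def)
  have main': "(\<Prod>k<n. 1 / real (N k)) \<le> C * ((rQ (pre n \<xi>))\<^sup>2 * real (N n)) powr (- s)"
    if g: "G \<xi>" for \<xi> n
    using main[OF g, of n] mult_right_mono[OF C(2), of "((rQ (pre n \<xi>))\<^sup>2 * real (N n)) powr (- s)"] by simp
  show ?thesis
  proof (rule hausdorff_dim_ge_random_digits[where M = ?M and X = "\<lambda>\<xi>. \<xi>" and L = "\<lambda>n. real (N n)"
        and C = C and G = G])
    show "AE \<xi> in ?M. G \<xi>" using AE_PiM_set_pmf[of p] by (simp add: G_def set_p)
    fix \<xi> assume g: "G \<xi>"
    have N\<xi>: "N k \<le> \<xi> k" "\<xi> k < 2 * N k" for k using g by (auto simp: G_def)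
    have two: "2 \<le> \<xi> k" for k using N\<xi>(1)[of k] N3[of k] by linarith
    show pos: "pos_seq \<xi>" unfolding pos_seq_def using two by (meson one_le_numeral order_trans)
    show "cval \<xi> \<in> A"
    proof -
      have "exp (d ^ Suc n) \<le> real (\<xi> n)" for n using N1[of n] N\<xi>(1)[of n] by linarith
      then show ?thesis using A pos by blast
    qed
    fix n
    show "real (N n) \<le> real (\<xi> n)" using N\<xi>(1)[of n] by simp
    have "real (\<xi> n) \<le> 2 * real (N n)" using N\<xi>(2)[of n] by linarith
    also have "\<dots> \<le> C * real (N n)" using C by (intro mult_right_mono) auto
    finally show "real (\<xi> n) \<le> C * real (N n)" .
    show "2 \<le> \<xi> n \<or> real (\<xi> (Suc n)) \<le> C" using two by blast
    show "measure ?M {\<xi>'\<in>space ?M. \<forall>k<n. \<xi>' k = \<xi> k} \<le> C * ((rQ (pre n \<xi>))\<^sup>2 * real (N n)) powr (- s)"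
      unfolding prob[OF g] by (rule main'[OF g])
    have "(\<Prod>k<Suc n. 1 / real (N k)) = (\<Prod>k<n. 1 / real (N k)) / real (N n)" by simp
    also have "\<dots> \<le> C * ((rQ (pre n \<xi>))\<^sup>2 * real (N n)) powr (- s) / real (N n)"
      by (intro divide_right_mono main'[OF g]) auto
    finally show "measure ?M {\<xi>'\<in>space ?M. \<forall>k<Suc n. \<xi>' k = \<xi> k}
        \<le> C * ((rQ (pre n \<xi>))\<^sup>2 * real (N n)) powr (- s) / real (N n)"
      unfolding prob[OF g] .
  next
    show "1 \<le> real (N n)" for n using N3[of n] by simp
    show "(\<lambda>\<xi>. \<xi> n) \<in> measurable ?M (count_space UNIV)" for n
      by (rule measurable_PiM_pmf_component)
    show "1 \<le> C" using C by simp
  qed (rule s s1 prob_space_PiM_pmf)+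
qed

section \<open>Random blocks with sparse large digits\<close>

lemma ex_weighted_pmf:
  fixes g :: "'b \<Rightarrow> real"
  assumes F: "finite F" "F \<noteq> {}" and g: "\<And>v. v \<in> F \<Longrightarrow> 0 < g v"
  shows "\<exists>p. set_pmf p = F \<and> (\<forall>v\<in>F. pmf p v = g v / sum g F)"
proof -
  define h where "h = (\<lambda>v. if v \<in> F then g v / sum g F else 0)"
  have Z: "0 < sum g F" using F g by (intro sum_pos) auto
  have h0: "0 \<le> h v" for v using g Z by (auto simp: h_def less_imp_le)
  have "(\<integral>\<^sup>+v. ennreal (h v) \<partial>count_space UNIV) = (\<Sum>v\<in>F. ennreal (h v))"
    by (rule nn_integral_count_space'[OF F(1)]) (auto simp: h_def)
  also have "\<dots> = ennreal (\<Sum>v\<in>F. h v)" using h0 by (intro sum_ennreal) auto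
  also have "(\<Sum>v\<in>F. h v) = 1" using Z by (simp add: h_def sum_divide_distrib[symmetric])
  finally have int: "(\<integral>\<^sup>+v. ennreal (h v) \<partial>count_space UNIV) = 1" by simp
  have pmf: "pmf (embed_pmf h) v = h v" for v by (rule pmf_embed_pmf[OF h0 int])
  have "set_pmf (embed_pmf h) = {v. h v \<noteq> 0}" by (simp add: set_pmf_eq pmf)
  also have "\<dots> = F"
  proof (intro equalityI subsetI)
    fix v assume "v \<in> F"
    then show "v \<in> {v. h v \<noteq> 0}" using g[of v] Z by (simp add: h_def)
  qed (auto simp: h_def split: if_splits)
  finally have "set_pmf (embed_pmf h) = F" .
  moreover have "pmf (embed_pmf h) v = g v / sum g F" if "v \<in> F" for v
    using that unfolding pmf by (simp add: h_def)
  ultimately show ?thesis by blast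
qed

lemma cQ_le_prod_list: "pos_word w \<Longrightarrow> cQ w \<le> prod_list (map Suc w)"
proof (induction w)
  case (Cons a w)
  have "cQ (a # w) \<le> (a + 1) * cQ w" using Cons.prems by (intro cQ_Cons_le) auto
  also have "\<dots> \<le> (a + 1) * prod_list (map Suc w)" using Cons by (intro mult_le_mono2) auto
  finally show ?case by simp
qed simp

lemma cQ_le_power:
  assumes "pos_word w" "\<And>a. a \<in> set w \<Longrightarrow> a \<le> M" "length w \<le> l"
  shows "cQ w \<le> (M + 1) ^ l"
proof -
  have "prod_list (map Suc w) \<le> (M + 1) ^ length w"
    using assms(2)
  proof (induction w)
    case (Cons a w)
    have "Suc a * prod_list (map Suc w) \<le> (M + 1) * (M + 1) ^ length w"
      using Cons by (intro mult_le_mono) auto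
    then show ?case by simp
  qed simp
  also have "\<dots> \<le> (M + 1) ^ l" using assms(3) by (intro power_increasing) auto
  finally show ?thesis using cQ_le_prod_list[OF assms(1)] by linarith
qed

lemma sets_PiM_prefix:
  fixes p :: "nat \<Rightarrow> 'b pmf"
  shows "{\<xi> \<in> space (indep_pmf p). (\<forall>k<j. \<xi> k = b k) \<and> \<xi> j \<in> E}
    \<in> sets (indep_pmf p)"
proof -
  have [measurable]: "(\<lambda>\<xi>. \<xi> k = b k) \<in> measurable (indep_pmf p) (count_space UNIV)" for k
    by (rule measurable_PiM_pmf_component)
  have [measurable]: "(\<lambda>\<xi>. \<xi> j \<in> E) \<in> measurable (indep_pmf p) (count_space UNIV)"
    by (rule measurable_PiM_pmf_component)
  show ?thesis by measurable
qed

text \<open>Independent blocks of length \<open>m + 1\<close>. An ordinary block is a word \<open>v \<in> F\<close>, drawn with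
  probability proportional to \<open>weight s v\<close>, followed by the digit 2. A block with number
  \<open>j \<in> J\<close> consists of digits 2 except for one digit, at position \<open>\<nu> j\<close> of the sequence, which is
  uniformly distributed between \<open>N j\<close> and \<open>2 * N j\<close> with \<open>N j \<approx> B ^ (\<nu> j + 1)\<close>. The digits 2 ensure that
  a large digit never follows a digit 1, where the gap between neighbouring cylinders would be lost.\<close>

locale random_blocks =
  fixes m M :: nat and F :: "nat list set" and s \<beta> B :: real and J :: "nat set" and \<nu> :: "nat \<Rightarrow> nat"
    and ord :: "nat list pmf" and K :: real
  assumes K_def: "K = real ((M + 1) ^ Suc m)"
    and s: "1 / 2 < s" "s \<le> 1" and B: "1 < B" and \<beta>: "0 \<le> \<beta>"
    and F: "finite F" "F \<subseteq> words m" and M: "\<And>v a. v \<in> F \<Longrightarrow> a \<in> set v \<Longrightarrow> a \<le> M" "2 \<le> M"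
    and F_sum: "64 powr s * exp (\<beta> * s * real (Suc m)) \<le> sum (weight s) F"
    and \<nu>: "\<And>j. j \<in> J \<Longrightarrow> \<nu> j div Suc m = j"
    and ord: "set_pmf ord = F" "\<And>v. v \<in> F \<Longrightarrow> pmf ord v = weight s v / sum (weight s) F"
    and sparse: "\<And>j e. j \<in> J \<Longrightarrow> e \<le> j \<Longrightarrow> e = 0 \<or> e - 1 \<in> J \<Longrightarrow>
      (4 * K) powr (2 * s) * exp (- (\<beta> * s * real (Suc m) * (real j - real e)))
        \<le> (2 * exp (ln B * (real (Suc m) * (real j + 1)))) powr (- s)"
begin

abbreviation bl :: real where "bl \<equiv> real (Suc m)"

abbreviation C1 :: real where "C1 \<equiv> (4 * K) powr (2 * s)"

definition N :: "nat \<Rightarrow> nat" where "N j = nat \<lceil>B ^ Suc (\<nu> j)\<rceil>"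

abbreviation rN :: "nat \<Rightarrow> real" where "rN j \<equiv> real (N j)"

definition big :: "nat \<Rightarrow> nat \<Rightarrow> nat list" where
  "big j a = replicate (\<nu> j mod Suc m) 2 @ a # replicate (m - \<nu> j mod Suc m) 2"

definition law :: "nat \<Rightarrow> nat list pmf" where
  "law j = (if j \<in> J then map_pmf (big j) (pmf_of_set {N j..<2 * N j}) else map_pmf (\<lambda>v. v @ [2]) ord)"

definition digit :: "(nat \<Rightarrow> nat list) \<Rightarrow> nat \<Rightarrow> nat" where
  "digit \<xi> n = \<xi> (n div Suc m) ! (n mod Suc m)"

definition good :: "(nat \<Rightarrow> nat list) \<Rightarrow> bool" where
  "good \<xi> \<longleftrightarrow> (\<forall>k. \<xi> k \<in> set_pmf (law k))"

definition prefix_prob :: "(nat \<Rightarrow> nat list) \<Rightarrow> nat \<Rightarrow> real" where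
  "prefix_prob \<xi> j = (\<Prod>k<j. pmf (law k) (\<xi> k))"

text \<open>Bound, up to 4^s, for probability times (2 q)^(2s) of the first \<open>j\<close> blocks.
  A digit of size N has probability 1 / N but enlarges q^(2s) by about N^(2s), hence the exponent 2
  s - 1; an ordinary block has a net gain owing to \<open>F_sum\<close>.\<close>

definition growth :: "nat \<Rightarrow> real" where
  "growth j = (\<Prod>k<j. if k \<in> J then C1 * rN k powr (2 * s - 1)
     else exp (- (\<beta> * s * bl)))"

abbreviation "\<Omega> \<equiv> indep_pmf law"

abbreviation cyl_prob :: "nat \<Rightarrow> (nat \<Rightarrow> nat list) \<Rightarrow> real" where
  "cyl_prob n \<xi> \<equiv> measure \<Omega> {\<xi>'\<in>space \<Omega>. \<forall>k<n. digit \<xi>' k = digit \<xi> k}"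

section \<open>Laws and digits of the blocks\<close>

lemma K_ge: "1 \<le> K"
  by (simp add: K_def del: power_Suc)

lemma K_mult: "real ((M + 1) ^ Suc m * x) = K * real x"
  unfolding K_def by (rule of_nat_mult)

lemma C1_ge: "1 \<le> C1"
  using K_ge s by (intro ge_one_powr_ge_zero) auto

lemma N_ge: "B ^ Suc (\<nu> j) \<le> rN j"
  unfolding N_def by (rule real_nat_ceiling_ge)

lemma N_ge_2: "2 \<le> N j"
proof -
  have "1 < B ^ Suc (\<nu> j)" using B by (intro one_less_power) auto
  then have "1 < rN j" using N_ge[of j] by linarith
  then show ?thesis by simp
qed

lemma \<nu>_eq: "j \<in> J \<Longrightarrow> \<nu> j = Suc m * j + \<nu> j mod Suc m"
  using \<nu>[of j] div_mult_mod_eq[of "\<nu> j" "Suc m"] by (simp add: mult.commute)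

lemma N_le:
  assumes "j \<in> J"
  shows "rN j \<le> 2 * exp (ln B * (bl * (real j + 1)))"
proof -
  have "1 \<le> B ^ Suc (\<nu> j)" using B by (intro one_le_power) auto
  then have "rN j \<le> 2 * B ^ Suc (\<nu> j)" unfolding N_def by linarith
  also have "B ^ Suc (\<nu> j) \<le> B ^ (Suc m * (j + 1))"
  proof (rule power_increasing)
    have "\<nu> j mod Suc m \<le> m" by (simp add: less_Suc_eq_le[symmetric])
    moreover have "Suc m * (j + 1) = Suc m * j + Suc m" by simp
    ultimately show "Suc (\<nu> j) \<le> Suc m * (j + 1)" using \<nu>_eq[OF assms] by linarith
  qed (use B in simp)
  also have "B ^ (Suc m * (j + 1)) = exp (ln B * (bl * (real j + 1)))"
  proof -
    have "B ^ (Suc m * (j + 1)) = exp (real (Suc m * (j + 1)) * ln B)"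
      using B by (simp only: exp_of_nat_mult exp_ln)
    then show ?thesis by (simp add: algebra_simps)
  qed
  finally show ?thesis by simp
qed

lemma length_big [simp]: "length (big j a) = Suc m"
proof -
  have "\<nu> j mod Suc m \<le> m" by (simp add: less_Suc_eq_le[symmetric])
  then show ?thesis by (simp add: big_def)
qed

lemma big_nth [simp]: "big j a ! (\<nu> j mod Suc m) = a"
  by (simp add: big_def nth_append)

lemma big_nth_other:
  assumes "i \<le> m" "i \<noteq> \<nu> j mod Suc m"
  shows "big j a ! i = 2"
proof -
  have "\<nu> j mod Suc m \<le> m" by (simp add: less_Suc_eq_le[symmetric])
  then show ?thesis using assms by (auto simp: big_def nth_append nth_Cons')
qed

lemma inj_big: "inj (big j)"
  by (rule injI) (metis big_nth)

lemma set_law: 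
  "set_pmf (law j) = (if j \<in> J then big j ` {N j..<2 * N j} else (\<lambda>v. v @ [2]) ` F)"
proof -
  have "{N j..<2 * N j} \<noteq> {}" using N_ge_2[of j] by auto
  then show ?thesis by (simp add: law_def ord set_pmf_of_set)
qed

lemma pmf_law_big:
  assumes "j \<in> J" "b \<in> set_pmf (law j)"
  shows "pmf (law j) b = 1 / rN j"
proof -
  have ne: "{N j..<2 * N j} \<noteq> {}" using N_ge_2[of j] by auto
  obtain a where a: "a \<in> {N j..<2 * N j}" "b = big j a" using assms by (auto simp: set_law)
  then have "pmf (law j) b = pmf (pmf_of_set {N j..<2 * N j}) a"
    using assms(1) by (simp add: law_def pmf_map_inj'[OF inj_big])
  then show ?thesis using a ne by simp
qed

lemma pmf_law_ord:
  assumes "j \<notin> J" "v \<in> F"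
  shows "pmf (law j) (v @ [2]) = weight s v / sum (weight s) F"
proof -
  have "inj (\<lambda>v. v @ [2::nat])" by (rule injI) simp
  then have "pmf (law j) (v @ [2]) = pmf ord v"
    using assms(1) by (simp add: law_def pmf_map_inj'[where f = "\<lambda>v. v @ [2]"])
  then show ?thesis using ord assms by simp
qed

lemma length_block: "b \<in> set_pmf (law j) \<Longrightarrow> length b = Suc m"
  using F by (auto simp: set_law words_def split: if_splits)

lemma pos_word_block: "b \<in> set_pmf (law j) \<Longrightarrow> pos_word b"
proof (cases "j \<in> J")
  case True
  assume "b \<in> set_pmf (law j)"
  then obtain a where "N j \<le> a" "b = big j a" using True by (auto simp: set_law)
  then show ?thesis using N_ge_2[of j] by (auto simp: big_def pos_word_def)
next
  case False
  assume "b \<in> set_pmf (law j)"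
  then show ?thesis using False F by (auto simp: set_law words_def)
qed

lemma pos_word_take: "pos_word w \<Longrightarrow> pos_word (take r w)"
  by (auto simp: pos_word_def dest: in_set_takeD)

text \<open>Each digit 2 contributes a factor of at most 3 \<le> M + 1, so a prefix of any length
  costs at most \<open>K\<close> times the factor of the large digit.\<close>

lemma cQ_take_big:
  assumes "1 \<le> a"
  shows "cQ (take r (big j a)) \<le> (M + 1) ^ Suc m * (a + 1)"
proof -
  have pm: "\<nu> j mod Suc m \<le> m" by (simp add: less_Suc_eq_le[symmetric])
  have three: "3 \<le> M + 1" using M by simp
  have "pos_word (big j a)" using assms by (auto simp: big_def pos_word_def)
  then have "cQ (take r (big j a)) \<le> prod_list (map Suc (take r (big j a)))"
    by (intro cQ_le_prod_list pos_word_take)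
  also have "\<dots> \<le> prod_list (map Suc (take r (big j a))) * prod_list (map Suc (drop r (big j a)))"
  proof -
    have "1 \<le> prod_list (map Suc w)" for w by (induction w) auto
    then show ?thesis by (metis mult.right_neutral mult_le_mono2)
  qed
  also have "\<dots> = prod_list (map Suc (big j a))"
    by (metis append_take_drop_id map_append prod_list.append)
  also have "\<dots> = 3 ^ (\<nu> j mod Suc m) * 3 ^ (m - \<nu> j mod Suc m) * (a + 1)"
    by (simp add: big_def prod_list_replicate algebra_simps)
  also have "3 ^ (\<nu> j mod Suc m) * 3 ^ (m - \<nu> j mod Suc m) = (3 :: nat) ^ m"
    using pm by (simp add: power_add[symmetric])
  also have "3 ^ m * (a + 1) \<le> (M + 1) ^ m * (a + 1)"
    using three by (intro mult_le_mono1 power_mono) auto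
  also have "\<dots> \<le> (M + 1) ^ Suc m * (a + 1)"
    by (intro mult_le_mono1 power_increasing) auto
  finally show ?thesis .
qed

lemma cQ_take_big_before:
  assumes "1 \<le> a" "r \<le> \<nu> j mod Suc m"
  shows "cQ (take r (big j a)) \<le> (M + 1) ^ Suc m"
proof -
  have "take r (big j a) = replicate r 2" using assms by (simp add: big_def)
  moreover have "r \<le> Suc m" using assms(2) mod_less_divisor[of "Suc m" "\<nu> j"] by linarith
  ultimately show ?thesis using M by (intro cQ_le_power) (auto simp: pos_word_def)
qed

lemma cQ_take_ord:
  assumes "v \<in> F"
  shows "cQ (take r (v @ [2])) \<le> (M + 1) ^ Suc m"
proof (rule cQ_le_power)
  show "pos_word (take r (v @ [2]))" using assms F by (intro pos_word_take) (auto simp: words_def)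
  show "a \<le> M" if "a \<in> set (take r (v @ [2]))" for a
    using in_set_takeD[OF that] assms M by auto
  show "length (take r (v @ [2])) \<le> Suc m" using assms F by (auto simp: words_def)
qed

lemma digit_eq: "i \<le> m \<Longrightarrow> digit \<xi> (Suc m * j + i) = \<xi> j ! i"
proof -
  assume "i \<le> m"
  then have "(Suc m * j + i) div Suc m = j" "(Suc m * j + i) mod Suc m = i"
    by (simp_all only: less_Suc_eq_le[symmetric] div_mult_self4 mod_mult_self4) auto
  then show ?thesis by (simp only: digit_def)
qed

lemma pos_seq_digit: "good \<xi> \<Longrightarrow> pos_seq (digit \<xi>)"
  unfolding pos_seq_def
proof
  fix n
  assume "good \<xi>"
  then have b: "\<xi> (n div Suc m) \<in> set_pmf (law (n div Suc m))" by (simp add: good_def)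
  have "n mod Suc m < length (\<xi> (n div Suc m))" using length_block[OF b] by simp
  then have "digit \<xi> n \<in> set (\<xi> (n div Suc m))" unfolding digit_def by (rule nth_mem)
  then show "1 \<le> digit \<xi> n" using pos_word_block[OF b] by (auto simp: pos_word_def)
qed

lemma pre_digit:
  assumes "good \<xi>" "r \<le> Suc m"
  shows "pre (Suc m * j + r) (digit \<xi>) = pre (Suc m * j) (digit \<xi>) @ take r (\<xi> j)"
proof -
  have len: "length (\<xi> j) = Suc m" using assms length_block by (auto simp: good_def)
  have "pre r (shift (Suc m * j) (digit \<xi>)) = take r (\<xi> j)"
  proof (rule nth_equalityI)
    show "length (pre r (shift (Suc m * j) (digit \<xi>))) = length (take r (\<xi> j))" using len assms by simp
    fix i assume "i < length (pre r (shift (Suc m * j) (digit \<xi>)))"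
    then have i: "i < r" by simp
    then have "digit \<xi> (Suc m * j + i) = \<xi> j ! i" using assms by (intro digit_eq) auto
    then show "pre r (shift (Suc m * j) (digit \<xi>)) ! i = take r (\<xi> j) ! i"
      using i by (simp only: pre_nth nth_take shift_def)
  qed
  then show ?thesis by (simp only: pre_add)
qed

lemma good_big_block:
  assumes "good \<xi>" "j \<in> J"
  obtains a where "a \<in> {N j..<2 * N j}" "\<xi> j = big j a"
proof -
  have "\<xi> j \<in> set_pmf (law j)" using assms by (simp add: good_def)
  then show ?thesis using assms that by (auto simp: set_law)
qed

lemma good_ord_block:
  assumes "good \<xi>" "j \<notin> J"
  obtains v where "v \<in> F" "\<xi> j = v @ [2]"
proof -
  have "\<xi> j \<in> set_pmf (law j)" using assms by (simp add: good_def)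
  then show ?thesis using assms that by (auto simp: set_law)
qed

lemma digit_big:
  assumes "good \<xi>" "j \<in> J"
  shows "digit \<xi> (\<nu> j) \<in> {N j..<2 * N j}" "\<xi> j = big j (digit \<xi> (\<nu> j))"
proof -
  obtain a where a: "a \<in> {N j..<2 * N j}" "\<xi> j = big j a"
    using good_big_block[OF assms] by blast
  have "digit \<xi> (\<nu> j) = a" using a \<nu>[OF assms(2)] by (simp add: digit_def)
  then show "digit \<xi> (\<nu> j) \<in> {N j..<2 * N j}" "\<xi> j = big j (digit \<xi> (\<nu> j))" using a by auto
qed

lemma digit_le:
  assumes "good \<xi>" "\<not> (n div Suc m \<in> J \<and> n = \<nu> (n div Suc m))"
  shows "digit \<xi> n \<le> M" and "n div Suc m \<in> J \<Longrightarrow> digit \<xi> n = 2"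
proof -
  let ?j = "n div Suc m" and ?r = "n mod Suc m"
  have r: "?r \<le> m" by (simp add: less_Suc_eq_le[symmetric])
  show two: "digit \<xi> n = 2" if "?j \<in> J"
  proof -
    have "?r \<noteq> \<nu> ?j mod Suc m"
    proof
      assume "?r = \<nu> ?j mod Suc m"
      then have "n = \<nu> ?j" using \<nu>[OF that] by (metis div_mult_mod_eq)
      then show False using assms that by blast
    qed
    then have "\<xi> ?j ! ?r = 2"
      by (subst digit_big(2)[OF assms(1) that]) (rule big_nth_other[OF r])
    then show ?thesis by (simp only: digit_def)
  qed
  show "digit \<xi> n \<le> M"
  proof (cases "?j \<in> J")
    case True
    then show ?thesis using two M by simp
  next
    case False
    then obtain v where v: "v \<in> F" "\<xi> ?j = v @ [2]" using good_ord_block[OF assms(1) False] by blast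
    have "?r < length (v @ [2])" using v F r by (auto simp: words_def)
    then have "digit \<xi> n \<in> set (v @ [2])" unfolding digit_def v(2) by (rule nth_mem)
    then show ?thesis using M v by auto
  qed
qed

text \<open>A digit above \<open>M\<close> occurs only in a block of \<open>J\<close>. Its
  predecessor is at least 2, either as a digit of a block of \<open>J\<close> or as the 2 that
  closes an ordinary block.\<close>

lemma digit_gap:
  assumes "good \<xi>"
  shows "2 \<le> digit \<xi> n \<or> digit \<xi> (Suc n) \<le> M"
proof (rule disjCI)
  let ?j = "n div Suc m" and ?r = "n mod Suc m"
  assume "\<not> digit \<xi> (Suc n) \<le> M"
  then have big: "Suc n div Suc m \<in> J" using digit_le(1)[OF assms, of "Suc n"] by blast
  show "2 \<le> digit \<xi> n"
  proof (cases "?j \<in> J")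
    case True
    show ?thesis
    proof (cases "n = \<nu> ?j")
      case eq: True
      show ?thesis using digit_big(1)[OF assms True] N_ge_2[of ?j] eq by auto
    next
      case False
      then show ?thesis using digit_le(2)[OF assms _ True] by simp
    qed
  next
    case False
    then have "Suc n div Suc m \<noteq> ?j" using big by auto
    then have r: "?r = m" by (auto simp: div_Suc mod_Suc split: if_splits)
    obtain v where v: "v \<in> F" "\<xi> ?j = v @ [2]" using good_ord_block[OF assms False] by blast
    have "length v = m" using v F by (auto simp: words_def)
    then have "digit \<xi> n = 2" unfolding digit_def v(2) r by (simp add: nth_append)
    then show ?thesis by simp
  qed
qed

section \<open>Balance between probabilities and denominators\<close>

lemma block_weight:
  assumes "good \<xi>"
  shows "pmf (law j) (\<xi> j) * (2 * rQ (\<xi> j)) powr (2 * s)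
    \<le> (if j \<in> J then C1 * rN j powr (2 * s - 1) else exp (- (\<beta> * s * bl)))"
proof (cases "j \<in> J")
  case True
  let ?a = "digit \<xi> (\<nu> j)"
  have Npos: "0 < rN j" using N_ge_2[of j] by simp
  have a: "?a \<in> {N j..<2 * N j}" "\<xi> j = big j ?a" by (rule digit_big[OF assms True])+
  have "1 \<le> ?a" using a N_ge_2[of j] by auto
  from cQ_take_big[OF this, of "Suc m" j] have "cQ (\<xi> j) \<le> (M + 1) ^ Suc m * (?a + 1)"
    by (subst a(2)) simp
  also have "\<dots> \<le> (M + 1) ^ Suc m * (2 * N j)" using a by (intro mult_le_mono2) auto
  finally have "rQ (\<xi> j) \<le> real ((M + 1) ^ Suc m * (2 * N j))" by (rule of_nat_mono)
  \<comment> \<open>Origin of \<open>C1\<close>: one factor 2 belongs to the doubled denominator,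
    the other to the digit, which is below 2 N.\<close>
  then have "2 * rQ (\<xi> j) \<le> 4 * K * rN j" unfolding K_mult by simp
  then have "(2 * rQ (\<xi> j)) powr (2 * s) \<le> (4 * K * rN j) powr (2 * s)"
    using s by (intro powr_mono2) auto
  also have "\<dots> = C1 * rN j powr (2 * s)"
    using K_ge by (intro powr_mult)
  finally have "pmf (law j) (\<xi> j) * (2 * rQ (\<xi> j)) powr (2 * s)
      \<le> 1 / rN j * (C1 * rN j powr (2 * s))"
    using pmf_law_big[OF True, of "\<xi> j"] assms by (simp add: good_def divide_right_mono)
  also have "\<dots> = C1 * rN j powr (2 * s - 1)"
    using Npos by (simp add: powr_diff)
  finally show ?thesis using True by simp
next
  case False
  obtain v where v: "v \<in> F" "\<xi> j = v @ [2]" using good_ord_block[OF assms False] by blast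
  have pv: "pos_word v" using v F by (auto simp: words_def)
  have q: "0 < rQ v" by (rule rQ_pos[OF pv])
  let ?Z = "sum (weight s) F"
  have Z: "?Z > 0" using F_sum by (auto intro: less_le_trans[rotated])
  have "cQ (\<xi> j) \<le> 3 * cQ v" using cQ_snoc_le[OF pv, of 2] v by simp
  then have "rQ (\<xi> j) \<le> real (3 * cQ v)" by (rule of_nat_mono)
  \<comment> \<open>Appending the digit 2 costs at most a factor 3, and 2 * 3 is rounded up to 8;
    its power 8^(2s) = 64^s is the loss provided for in \<open>F_sum\<close>.\<close>
  then have "2 * rQ (\<xi> j) \<le> 8 * rQ v" by simp
  then have "(2 * rQ (\<xi> j)) powr (2 * s) \<le> (8 * rQ v) powr (2 * s)"
    using s by (intro powr_mono2) auto
  also have "\<dots> = 8 powr (2 * s) * rQ v powr (2 * s)" by (intro powr_mult)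
  also have "(8::real) powr (2 * s) = 64 powr s" using powr_powr[of 8 2 s] by simp
  finally have "pmf (law j) (\<xi> j) * (2 * rQ (\<xi> j)) powr (2 * s)
      \<le> weight s v / ?Z * (64 powr s * rQ v powr (2 * s))"
    unfolding v(2) pmf_law_ord[OF False v(1)]
    using Z weight_nonneg[of s v] by (intro mult_left_mono) auto
  also have "\<dots> = 64 powr s / ?Z * (weight s v * rQ v powr (2 * s))" by simp
  also have "weight s v * rQ v powr (2 * s) = 1"
    using q by (simp add: weight_def powr_add[symmetric])
  also have "64 powr s / ?Z * 1 \<le> 64 powr s / (64 powr s * exp (\<beta> * s * bl))"
    unfolding mult_1_right by (rule divide_left_mono[OF F_sum]) (use Z in \<open>auto intro!: mult_pos_pos\<close>)
  also have "\<dots> = exp (- (\<beta> * s * bl))" by (simp add: exp_minus divide_inverse)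
  finally show ?thesis using False by simp
qed

lemma prefix_prob_nonneg: "0 \<le> prefix_prob \<xi> j"
  by (simp add: prefix_prob_def prod_nonneg)

lemma growth_nonneg: "0 \<le> growth j"
  by (auto simp: growth_def intro!: prod_nonneg)

text \<open>Twice the denominator is submultiplicative under concatenation, so the block factors
  multiply without accumulating constants; 4^s = 2^(2s) is the value for the empty word.\<close>

lemma prefix_weight:
  assumes g: "good \<xi>"
  shows "prefix_prob \<xi> j * (2 * rQ (pre (Suc m * j) (digit \<xi>))) powr (2 * s) \<le> 4 powr s * growth j"
proof (induction j)
  case 0
  have "(2::real) powr (2 * s) = 4 powr s" using powr_powr[of 2 2 s] by simp
  then show ?case by (simp add: prefix_prob_def growth_def)
next
  case (Suc j)
  let ?u = "pre (Suc m * j) (digit \<xi>)"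
  have len: "length (\<xi> j) = Suc m" using g length_block by (auto simp: good_def)
  have "Suc m * Suc j = Suc m * j + Suc m" by simp
  then have split: "pre (Suc m * Suc j) (digit \<xi>) = ?u @ \<xi> j"
    using pre_digit[OF g, of "Suc m" j] len by (simp only: le_refl take_all)
  have "cQ (?u @ \<xi> j) \<le> 2 * (cQ ?u * cQ (\<xi> j))"
    using g by (intro cQ_append_le pos_word_pre pos_seq_digit pos_word_block[of _ j]) (auto simp: good_def)
  then have "rQ (?u @ \<xi> j) \<le> real (2 * (cQ ?u * cQ (\<xi> j)))" by (rule of_nat_mono)
  then have "2 * rQ (pre (Suc m * Suc j) (digit \<xi>)) \<le> (2 * rQ ?u) * (2 * rQ (\<xi> j))"
    unfolding split by (simp only: of_nat_mult of_nat_numeral mult_ac)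
  then have "(2 * rQ (pre (Suc m * Suc j) (digit \<xi>))) powr (2 * s)
      \<le> ((2 * rQ ?u) * (2 * rQ (\<xi> j))) powr (2 * s)"
    using s by (intro powr_mono2) auto
  also have "\<dots> = (2 * rQ ?u) powr (2 * s) * (2 * rQ (\<xi> j)) powr (2 * s)"
    by (intro powr_mult)
  finally have "prefix_prob \<xi> (Suc j) * (2 * rQ (pre (Suc m * Suc j) (digit \<xi>))) powr (2 * s)
      \<le> prefix_prob \<xi> (Suc j) * ((2 * rQ ?u) powr (2 * s) * (2 * rQ (\<xi> j)) powr (2 * s))"
    by (intro mult_left_mono prefix_prob_nonneg)
  also have "\<dots> = (prefix_prob \<xi> j * (2 * rQ ?u) powr (2 * s))
      * (pmf (law j) (\<xi> j) * (2 * rQ (\<xi> j)) powr (2 * s))"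
    by (simp add: prefix_prob_def)
  also have "\<dots> \<le> (4 powr s * growth j) * (if j \<in> J then C1 * rN j powr (2 * s - 1)
      else exp (- (\<beta> * s * bl)))"
    using growth_nonneg by (intro mult_mono Suc block_weight g mult_nonneg_nonneg) auto
  also have "\<dots> = 4 powr s * growth (Suc j)" by (simp add: growth_def)
  finally show ?case .
qed

lemma growth_big_of_bound:
  assumes "j \<in> J" "e \<le> j" "e = 0 \<or> e - 1 \<in> J"
    and "growth j \<le> C1 * exp (- (\<beta> * s * bl * (real j - real e)))"
  shows "growth j \<le> rN j powr (- s)"
proof -
  have "growth j \<le> (2 * exp (ln B * (bl * (real j + 1)))) powr (- s)"
    using sparse[OF assms(1-3)] assms(4) by linarith
  also have "\<dots> \<le> rN j powr (- s)"
    using N_le[OF assms(1)] N_ge_2[of j] s by (intro powr_mono2') auto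
  finally show ?thesis .
qed

text \<open>\<open>e\<close> is 0 or the block following the last one in \<open>J\<close>, so only
  ordinary blocks lie between \<open>e\<close> and \<open>j\<close>, each with the same decay. On
  reaching a block of \<open>J\<close> this decay is down to N^(-s) by \<open>sparse\<close>;
  multiplied by C1 N^(2s-1) it leaves at most C1 N^(s-1) \<le> C1, and the count restarts.\<close>

lemma growth_bound:
  "\<exists>e\<le>j. (e = 0 \<or> e - 1 \<in> J) \<and>
     growth j \<le> C1 * exp (- (\<beta> * s * bl * (real j - real e)))"
proof (induction j)
  case 0
  then show ?case using C1_ge by (simp add: growth_def)
next
  case (Suc j)
  then obtain e where e: "e \<le> j" "e = 0 \<or> e - 1 \<in> J"
    "growth j \<le> C1 * exp (- (\<beta> * s * bl * (real j - real e)))" by blast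
  show ?case
  proof (cases "j \<in> J")
    case True
    have Npos: "1 \<le> rN j" using N_ge_2[of j] by simp
    have "growth (Suc j) = growth j * (C1 * rN j powr (2 * s - 1))"
      using True by (simp add: growth_def)
    also have "\<dots> \<le> rN j powr (- s) * (C1 * rN j powr (2 * s - 1))"
      by (intro mult_right_mono growth_big_of_bound[OF True e]) auto
    also have "\<dots> = C1 * rN j powr (s - 1)"
      by (simp add: powr_add[symmetric])
    also have "\<dots> \<le> C1 * 1"
      using s Npos powr_mono[of "s - 1" 0 "rN j"] by (intro mult_left_mono) auto
    finally have "growth (Suc j) \<le> C1" by simp
    then show ?thesis using True by (intro exI[of _ "Suc j"]) auto
  next
    case False
    have "growth (Suc j) = growth j * exp (- (\<beta> * s * bl))"
      using False by (simp add: growth_def)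
    also have "\<dots> \<le> C1 * exp (- (\<beta> * s * bl * (real j - real e))) * exp (- (\<beta> * s * bl))"
      using e by (intro mult_right_mono) auto
    also have "\<dots> = C1 * exp (- (\<beta> * s * bl * (real (Suc j) - real e)))"
      by (simp add: mult.assoc exp_add[symmetric] algebra_simps)
    finally show ?thesis using e by (intro exI[of _ e]) auto
  qed
qed

lemma growth_le: "growth j \<le> C1"
proof -
  obtain e where e: "e \<le> j"
    "growth j \<le> C1 * exp (- (\<beta> * s * bl * (real j - real e)))"
    using growth_bound by blast
  have "exp (- (\<beta> * s * bl * (real j - real e))) \<le> 1"
    using e(1) \<beta> s by simp
  then have "C1 * exp (- (\<beta> * s * bl * (real j - real e))) \<le> C1 * 1"
    by (intro mult_left_mono) auto
  then show ?thesis using e by simp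
qed

lemma growth_big: "j \<in> J \<Longrightarrow> growth j \<le> rN j powr (- s)"
  using growth_bound[of j] growth_big_of_bound by blast

text \<open>A cylinder may end inside a block. The incomplete block enters only through the bound
  \<open>K * y\<close> for its denominator, with \<open>y\<close> equal to 1 up to the large digit
  and to 2 N after it.\<close>

lemma partial_prefix_weight:
  assumes g: "good \<xi>" and r: "r \<le> m" and y: "1 \<le> y"
    and take: "rQ (take r (\<xi> j)) \<le> K * y"
  shows "prefix_prob \<xi> j \<le> 4 powr s * K powr (2 * s) * growth j * y powr (2 * s)
    * rQ (pre (Suc m * j + r) (digit \<xi>)) powr (- 2 * s)"
proof -
  let ?u = "pre (Suc m * j) (digit \<xi>)" and ?Q = "rQ (pre (Suc m * j + r) (digit \<xi>))"
  have Q: "?Q > 0" using cQ_pos[OF pos_word_pre[OF pos_seq_digit[OF g], of "Suc m * j + r"]] by linarith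
  have split: "pre (Suc m * j + r) (digit \<xi>) = ?u @ take r (\<xi> j)"
    using r by (intro pre_digit g) auto
  have "cQ (?u @ take r (\<xi> j)) \<le> 2 * (cQ ?u * cQ (take r (\<xi> j)))"
    using g by (intro cQ_append_le pos_word_pre pos_seq_digit pos_word_take pos_word_block[of _ j]) (auto simp: good_def)
  then have "rQ (?u @ take r (\<xi> j)) \<le> real (2 * (cQ ?u * cQ (take r (\<xi> j))))" by (rule of_nat_mono)
  also have "\<dots> = 2 * rQ ?u * rQ (take r (\<xi> j))" by simp
  also have "\<dots> \<le> 2 * rQ ?u * (K * y)" using take by (intro mult_left_mono) auto
  finally have "?Q \<le> 2 * rQ ?u * (K * y)" unfolding split .
  then have "?Q powr (2 * s) \<le> (2 * rQ ?u * (K * y)) powr (2 * s)"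
    using s by (intro powr_mono2) auto
  also have "\<dots> = (2 * rQ ?u) powr (2 * s) * (K powr (2 * s) * y powr (2 * s))"
    using K_ge y by (simp add: powr_mult)
  finally have "prefix_prob \<xi> j * ?Q powr (2 * s)
      \<le> prefix_prob \<xi> j * ((2 * rQ ?u) powr (2 * s) * (K powr (2 * s) * y powr (2 * s)))"
    by (intro mult_left_mono prefix_prob_nonneg)
  also have "\<dots> = (prefix_prob \<xi> j * (2 * rQ ?u) powr (2 * s)) * (K powr (2 * s) * y powr (2 * s))"
    by simp
  also have "\<dots> \<le> (4 powr s * growth j) * (K powr (2 * s) * y powr (2 * s))"
    by (intro mult_right_mono prefix_weight g) auto
  finally have "prefix_prob \<xi> j * ?Q powr (2 * s) * ?Q powr (- 2 * s)
      \<le> (4 powr s * growth j) * (K powr (2 * s) * y powr (2 * s)) * ?Q powr (- 2 * s)"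
    by (intro mult_right_mono) auto
  moreover have "?Q powr (2 * s) * ?Q powr (- 2 * s) = 1" using Q by (simp add: powr_add[symmetric])
  ultimately show ?thesis by (simp add: mult.assoc mult.left_commute)
qed

section \<open>Probabilities of digit cylinders\<close>

lemma AE_good: "AE \<xi> in \<Omega>. good \<xi>"
  using AE_PiM_set_pmf[of law] by (simp add: good_def)

text \<open>Almost surely the blocks have the right length, so the digits determine all completed
  blocks. In a block of \<open>J\<close> all digits but one are prescribed; once the position
  \<open>\<nu> j\<close> is known the whole block is known, which gains the factor 1 / N before the
  block ends.\<close>

lemma cylinder_prob:
  assumes g: "good \<xi>" and n: "Suc m * j \<le> n"
  shows "cyl_prob n \<xi> \<le> prefix_prob \<xi> j"
    and "j \<in> J \<Longrightarrow> \<nu> j < n \<Longrightarrow>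
      cyl_prob n \<xi> \<le> prefix_prob \<xi> j / rN j"
proof -
  interpret prob_space \<Omega> by (rule prob_space_PiM_pmf)
  have eq: "\<xi>' k = \<xi> k" if g': "good \<xi>'" and d: "\<forall>i<n. digit \<xi>' i = digit \<xi> i" and k: "k < j" for \<xi>' k
  proof (rule nth_equalityI)
    have len: "length (\<xi>' k) = Suc m" "length (\<xi> k) = Suc m"
      using g g' length_block by (auto simp: good_def)
    then show "length (\<xi>' k) = length (\<xi> k)" by simp
    fix i assume "i < length (\<xi>' k)"
    then have i: "i \<le> m" using len by simp
    have "Suc m * k + i < Suc m * (k + 1)" using i by simp
    also have "\<dots> \<le> Suc m * j" using k by (intro mult_le_mono2) simp
    finally have "digit \<xi>' (Suc m * k + i) = digit \<xi> (Suc m * k + i)" using d n by (meson less_le_trans)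
    then show "\<xi>' k ! i = \<xi> k ! i" by (simp only: digit_eq[OF i])
  qed
  show "cyl_prob n \<xi> \<le> prefix_prob \<xi> j"
  proof -
    have "AE \<xi>' in \<Omega>. \<xi>' \<in> {\<xi>'\<in>space \<Omega>. \<forall>k<n. digit \<xi>' k = digit \<xi> k} \<longrightarrow>
        \<xi>' \<in> {\<xi>'\<in>space \<Omega>. (\<forall>k<j. \<xi>' k = \<xi> k) \<and> \<xi>' j \<in> UNIV}"
      using AE_good
    proof eventually_elim
      case (elim \<xi>')
      then show ?case using eq[OF elim] by blast
    qed
    then have "cyl_prob n \<xi>
        \<le> measure \<Omega> {\<xi>'\<in>space \<Omega>. (\<forall>k<j. \<xi>' k = \<xi> k) \<and> \<xi>' j \<in> UNIV}"
      by (rule finite_measure_mono_AE) (rule sets_PiM_prefix)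
    also have "\<dots> = prefix_prob \<xi> j" by (subst prob_PiM_prefix) (simp add: prefix_prob_def)
    finally show ?thesis .
  qed
  show "cyl_prob n \<xi> \<le> prefix_prob \<xi> j / rN j"
    if j: "j \<in> J" "\<nu> j < n"
  proof -
    have "AE \<xi>' in \<Omega>. \<xi>' \<in> {\<xi>'\<in>space \<Omega>. \<forall>k<n. digit \<xi>' k = digit \<xi> k} \<longrightarrow>
        \<xi>' \<in> {\<xi>'\<in>space \<Omega>. (\<forall>k<j. \<xi>' k = \<xi> k) \<and> \<xi>' j \<in> {\<xi> j}}"
      using AE_good
    proof eventually_elim
      case (elim \<xi>')
      have "\<xi>' j = \<xi> j" if "\<forall>k<n. digit \<xi>' k = digit \<xi> k"
        using that j digit_big(2)[OF g j(1)] digit_big(2)[OF elim j(1)] by simp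
      then show ?case using eq[OF elim] by blast
    qed
    then have "cyl_prob n \<xi>
        \<le> measure \<Omega> {\<xi>'\<in>space \<Omega>. (\<forall>k<j. \<xi>' k = \<xi> k) \<and> \<xi>' j \<in> {\<xi> j}}"
      by (rule finite_measure_mono_AE) (rule sets_PiM_prefix)
    also have "\<dots> = prefix_prob \<xi> j * pmf (law j) (\<xi> j)"
      by (subst prob_PiM_prefix) (simp add: prefix_prob_def measure_pmf_single)
    also have "pmf (law j) (\<xi> j) = 1 / rN j"
      using g by (intro pmf_law_big j) (auto simp: good_def)
    finally show ?thesis by simp
  qed
qed

text \<open>Plays the role of \<open>L\<close> in \<open>hausdorff_dim_ge_random_digits\<close>: the
  order of magnitude of the digit at position \<open>n\<close>.\<close>

definition scale :: "nat \<Rightarrow> real" where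
  "scale n = (if n div Suc m \<in> J \<and> n = \<nu> (n div Suc m) then real (N (n div Suc m)) else 1)"

definition const :: real where
  "const = max (real M) (4 powr s * 4 powr s * K powr (2 * s) * C1)"

lemma const_ge: "2 \<le> const" "real M \<le> const"
  "4 powr s * 4 powr s * K powr (2 * s) * C1 \<le> const"
  using M by (auto simp: const_def)

lemma const_ge': "4 powr s * K powr (2 * s) * C1 \<le> const"
  "4 powr s * 4 powr s * K powr (2 * s) \<le> const" "4 powr s * K powr (2 * s) \<le> const"
proof -
  have four: "1 \<le> 4 powr s" using s by (intro ge_one_powr_ge_zero) auto
  have c: "4 powr s * K powr (2 * s) * C1 \<ge> 0" "4 powr s * K powr (2 * s) \<ge> 0"
    "4 powr s * 4 powr s * K powr (2 * s) \<ge> 0" by simp_all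
  show 1: "4 powr s * K powr (2 * s) * C1 \<le> const"
  proof -
    have "1 * (4 powr s * K powr (2 * s) * C1)
        \<le> 4 powr s * (4 powr s * K powr (2 * s) * C1)"
      by (intro mult_right_mono four c)
    also have "\<dots> = 4 powr s * 4 powr s * K powr (2 * s) * C1"
      by (simp only: mult.assoc)
    finally show ?thesis using const_ge(3) by linarith
  qed
  show "4 powr s * 4 powr s * K powr (2 * s) \<le> const"
    using mult_left_mono[OF C1_ge c(3)] const_ge(3) by linarith
  show "4 powr s * K powr (2 * s) \<le> const"
    using mult_left_mono[OF C1_ge c(2)] 1 by linarith
qed

lemma scale_powr:
  fixes q :: real
  assumes "0 < q" "0 < x"
  shows "(q\<^sup>2 * x) powr (- s) = x powr (- s) * q powr (- 2 * s)"
proof -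
  have "(q\<^sup>2) powr (- s) = q powr (- 2 * s)" using powr_powr[of q 2 "- s"] assms by simp
  then show ?thesis using assms by (simp add: powr_mult)
qed

text \<open>At the position of a large digit the factor \<open>scale n powr (- s)\<close> is
  supplied by \<open>growth_big\<close>. Everywhere else \<open>scale n\<close> is 1, so the second
  bound follows from the first by monotonicity, and outside the stretch after a large digit bounded
  growth is enough.\<close>

lemma cylinder_bounds:
  assumes g: "good \<xi>"
  shows "cyl_prob n \<xi>
      \<le> const * ((rQ (pre n (digit \<xi>)))\<^sup>2 * scale n) powr (- s)" (is ?first)
    and "cyl_prob (Suc n) \<xi>
      \<le> const * ((rQ (pre n (digit \<xi>)))\<^sup>2 * scale n) powr (- s) / scale n" (is ?second)
proof -
  interpret prob_space \<Omega> by (rule prob_space_PiM_pmf)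
  define j r where "j = n div Suc m" and "r = n mod Suc m"
  have n: "n = Suc m * j + r" unfolding j_def r_def by (rule mult_div_mod_eq[symmetric])
  have r: "r \<le> m" by (simp add: r_def less_Suc_eq_le[symmetric])
  define Q where "Q = rQ (pre n (digit \<xi>))"
  have Q: "Q > 0" using cQ_pos[OF pos_word_pre[OF pos_seq_digit[OF g], of n]] by (simp add: Q_def)
  define P where "P = (\<lambda>n. cyl_prob n \<xi>)"
  have mono: "P (Suc n) \<le> P n"
  proof -
    have [measurable]: "(\<lambda>\<xi>'. digit \<xi>' k = digit \<xi> k) \<in> measurable \<Omega> (count_space UNIV)" for k
      unfolding digit_def by (rule measurable_PiM_pmf_component)
    show ?thesis unfolding P_def
      by (rule finite_measure_mono) (auto, measurable)
  qed
  have Npos: "1 \<le> rN j" using N_ge_2[of j] by simp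
  have weight: "prefix_prob \<xi> j \<le> 4 powr s * K powr (2 * s) * growth j * y powr (2 * s) * Q powr (- 2 * s)"
    if "1 \<le> y" "rQ (take r (\<xi> j)) \<le> K * y" for y
    using partial_prefix_weight[OF g r that] by (simp add: Q_def n)
  have ordinary: "prefix_prob \<xi> j \<le> const * Q powr (- 2 * s)" if "rQ (take r (\<xi> j)) \<le> K"
  proof -
    have "prefix_prob \<xi> j \<le> 4 powr s * K powr (2 * s) * growth j * 1 * Q powr (- 2 * s)"
      using weight[of 1] that by simp
    also have "\<dots> \<le> 4 powr s * K powr (2 * s) * C1 * 1 * Q powr (- 2 * s)"
      using growth_le[of j] by (intro mult_right_mono mult_left_mono) auto
    also have "\<dots> \<le> const * Q powr (- 2 * s)"
      using const_ge'(1) by (simp add: mult_right_mono)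
    finally show ?thesis .
  qed
  have Qs: "(Q\<^sup>2 * 1) powr (- s) = Q powr (- 2 * s)" using scale_powr[OF Q, of 1] by simp
  have both: "P n \<le> const * (Q\<^sup>2 * scale n) powr (- s) \<and> P (Suc n) \<le> const * (Q\<^sup>2 * scale n) powr (- s) / scale n"
  proof (cases "j \<in> J")
    case False
    then obtain v where v: "v \<in> F" "\<xi> j = v @ [2]" using good_ord_block[OF g False] by blast
    have "rQ (take r (\<xi> j)) \<le> K"
      unfolding v(2) K_def by (intro of_nat_mono cQ_take_ord v)
    then have "P n \<le> const * Q powr (- 2 * s)"
      using ordinary cylinder_prob(1)[OF g, of j n] by (simp add: P_def n)
    moreover have "scale n = 1" using False by (simp add: scale_def j_def)
    ultimately show ?thesis using mono Qs by simp
  next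
    case True
    let ?a = "digit \<xi> (\<nu> j)"
    have a: "?a \<in> {N j..<2 * N j}" "\<xi> j = big j ?a" by (rule digit_big[OF g True])+
    have a1: "1 \<le> ?a" using a(1) N_ge_2[of j] by auto
    have \<nu>j: "\<nu> j = Suc m * j + \<nu> j mod Suc m" by (rule \<nu>_eq[OF True])
    show ?thesis
    proof (cases "r \<le> \<nu> j mod Suc m")
      case before: True
      have "cQ (take r (\<xi> j)) \<le> (M + 1) ^ Suc m"
        by (subst a(2)) (rule cQ_take_big_before[OF a1 before])
      then have tk: "rQ (take r (\<xi> j)) \<le> K" unfolding K_def by (rule of_nat_mono)
      show ?thesis
      proof (cases "n = \<nu> j")
        case False
        then have "P n \<le> const * Q powr (- 2 * s)"
          using ordinary[OF tk] cylinder_prob(1)[OF g, of j n] by (simp add: P_def n)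
        moreover have "scale n = 1" using False by (simp add: scale_def j_def)
        ultimately show ?thesis using mono Qs by simp
      next
        case eq: True
        have sc: "scale n = rN j"
          unfolding scale_def j_def[symmetric] using True eq by simp
        have "prefix_prob \<xi> j \<le> 4 powr s * K powr (2 * s) * growth j * 1 * Q powr (- 2 * s)"
          using weight[of 1] tk by simp
        also have "\<dots> \<le> 4 powr s * K powr (2 * s) * rN j powr (- s) * 1 * Q powr (- 2 * s)"
          using growth_big[OF True] by (intro mult_right_mono mult_left_mono) auto
        also have "\<dots> = 4 powr s * K powr (2 * s) * (Q\<^sup>2 * scale n) powr (- s)"
          using Npos by (simp add: sc scale_powr[OF Q])
        also have "\<dots> \<le> const * (Q\<^sup>2 * scale n) powr (- s)"
          by (intro mult_right_mono const_ge') auto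
        finally have W: "prefix_prob \<xi> j \<le> const * (Q\<^sup>2 * scale n) powr (- s)" .
        have "P n \<le> prefix_prob \<xi> j"
          unfolding P_def by (rule cylinder_prob(1)[OF g]) (simp add: n)
        moreover have "P (Suc n) \<le> prefix_prob \<xi> j / rN j"
          unfolding P_def by (rule cylinder_prob(2)[OF g _ True]) (simp_all add: n eq[symmetric] del: mult_Suc)
        moreover have "prefix_prob \<xi> j / rN j \<le> const * (Q\<^sup>2 * scale n) powr (- s) / scale n"
          unfolding sc[symmetric] using Npos sc by (intro divide_right_mono W) auto
        ultimately show ?thesis using W by linarith
      qed
    next
      case after: False
      have sc: "scale n = 1"
      proof -
        have "n \<noteq> \<nu> j" using after by (auto simp: r_def)
        then show ?thesis by (simp add: scale_def j_def)
      qed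
      have "cQ (take r (\<xi> j)) \<le> (M + 1) ^ Suc m * (?a + 1)"
        by (subst a(2)) (rule cQ_take_big[OF a1])
      also have "\<dots> \<le> (M + 1) ^ Suc m * (2 * N j)" using a(1) by (intro mult_le_mono2) auto
      finally have "rQ (take r (\<xi> j)) \<le> real ((M + 1) ^ Suc m * (2 * N j))" by (rule of_nat_mono)
      then have tk: "rQ (take r (\<xi> j)) \<le> K * (2 * rN j)" unfolding K_mult by simp
      \<comment> \<open>The denominator now contains the large digit, which costs N^(2s). The factor
        1 / N for the known digit and the decay N^(-s) reduce this to N^(s-1) \<le> 1.\<close>
      have "P n \<le> prefix_prob \<xi> j / rN j"
        unfolding P_def using after \<nu>j by (intro cylinder_prob(2)[OF g _ True]) (simp_all add: n del: mult_Suc)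
      also have "\<dots> \<le> 4 powr s * K powr (2 * s) * growth j * (2 * rN j) powr (2 * s) * Q powr (- 2 * s) / rN j"
        using weight[of "2 * rN j"] tk Npos by (intro divide_right_mono) auto
      also have "\<dots> \<le> 4 powr s * K powr (2 * s) * rN j powr (- s) * (2 * rN j) powr (2 * s) * Q powr (- 2 * s) / rN j"
        using growth_big[OF True] by (intro divide_right_mono mult_right_mono mult_left_mono) auto
      also have "\<dots> = 4 powr s * 4 powr s * K powr (2 * s) * rN j powr (s - 1) * Q powr (- 2 * s)"
      proof -
        have two: "(2::real) powr (2 * s) = 4 powr s" using powr_powr[of 2 2 s] by simp
        have Ns: "rN j powr (- s) * rN j powr (2 * s) / rN j = rN j powr (s - 1)"
          using Npos by (simp add: powr_add[symmetric] powr_diff)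
        have "4 powr s * K powr (2 * s) * rN j powr (- s) * (2 * rN j) powr (2 * s) * Q powr (- 2 * s) / rN j
            = 4 powr s * 2 powr (2 * s) * K powr (2 * s)
              * (rN j powr (- s) * rN j powr (2 * s) / rN j) * Q powr (- 2 * s)"
          by (simp add: powr_mult)
        then show ?thesis by (simp only: two Ns)
      qed
      also have "\<dots> \<le> 4 powr s * 4 powr s * K powr (2 * s) * 1 * Q powr (- 2 * s)"
        using s Npos powr_mono[of "s - 1" 0 "rN j"] by (intro mult_right_mono mult_left_mono) auto
      also have "\<dots> \<le> const * Q powr (- 2 * s)"
        using const_ge'(2) by (simp add: mult_right_mono)
      finally show ?thesis using mono sc Qs by simp
    qed
  qed
  then show ?first ?second by (simp_all add: P_def Q_def)
qed

lemma hausdorff_dim_ge: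
  assumes A: "\<And>a. pos_seq a \<Longrightarrow> (\<And>j. j \<in> J \<Longrightarrow> B ^ Suc (\<nu> j) \<le> real (a (\<nu> j))) \<Longrightarrow> cval a \<in> A"
  shows "ereal s \<le> hausdorff_dim A"
proof (rule hausdorff_dim_ge_random_digits[where M = \<Omega> and X = digit and L = scale and C = const and G = good])
  show "(\<lambda>\<xi>. digit \<xi> n) \<in> measurable \<Omega> (count_space UNIV)" for n
    unfolding digit_def by (rule measurable_PiM_pmf_component)
  show "1 \<le> scale n" for n using N_ge_2[of "n div Suc m"] by (simp add: scale_def)
  fix \<xi> assume g: "good \<xi>"
  show "cval (digit \<xi>) \<in> A"
  proof (rule A[OF pos_seq_digit[OF g]])
    fix j assume "j \<in> J"
    then have "N j \<le> digit \<xi> (\<nu> j)" using digit_big(1)[OF g] by simp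
    then show "B ^ Suc (\<nu> j) \<le> real (digit \<xi> (\<nu> j))" using N_ge[of j] by linarith
  qed
  fix n
  show "scale n \<le> real (digit \<xi> n)" "real (digit \<xi> n) \<le> const * scale n"
  proof -
    let ?j = "n div Suc m"
    have "scale n \<le> real (digit \<xi> n) \<and> real (digit \<xi> n) \<le> const * scale n"
    proof (cases "?j \<in> J \<and> n = \<nu> ?j")
      case True
      then have d: "digit \<xi> n \<in> {N ?j..<2 * N ?j}" using digit_big(1)[OF g, of ?j] by simp
      have "real (digit \<xi> n) \<le> 2 * real (N ?j)" using d by auto
      also have "\<dots> \<le> const * real (N ?j)" using const_ge(1) by (intro mult_right_mono) auto
      finally show ?thesis using d True by (simp add: scale_def)
    next
      case False
      have "1 \<le> digit \<xi> n" using pos_seq_digit[OF g] by (auto simp: pos_seq_def)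
      moreover have "digit \<xi> n \<le> M" by (rule digit_le(1)[OF g False])
      ultimately show ?thesis using False const_ge(2) by (auto simp: scale_def)
    qed
    then show "scale n \<le> real (digit \<xi> n)" "real (digit \<xi> n) \<le> const * scale n" by auto
  qed
  show "2 \<le> digit \<xi> n \<or> real (digit \<xi> (Suc n)) \<le> const"
    using digit_gap[OF g, of n] const_ge(2) by linarith
  show "cyl_prob n \<xi>
      \<le> const * ((rQ (pre n (digit \<xi>)))\<^sup>2 * scale n) powr (- s)"
    by (rule cylinder_bounds(1)[OF g])
  show "cyl_prob (Suc n) \<xi>
      \<le> const * ((rQ (pre n (digit \<xi>)))\<^sup>2 * scale n) powr (- s) / scale n"
    by (rule cylinder_bounds(2)[OF g])
qed (use s const_ge(1) prob_space_PiM_pmf AE_good pos_seq_digit in auto)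

end

section \<open>Choice of the parameters of the blocks\<close>

lemma infinite_sparse_subset:
  fixes I :: "nat set"
  assumes "infinite I" "1 \<le> c"
  obtains J where "J \<subseteq> I" "infinite J"
    "\<And>j e. j \<in> J \<Longrightarrow> e \<le> j \<Longrightarrow> e = 0 \<or> e - 1 \<in> J \<Longrightarrow> c * (e + 1) \<le> j"
proof -
  have unb: "\<exists>y\<in>I. c * (x + 2) \<le> y" for x
    using assms(1) unfolding infinite_nat_iff_unbounded by (meson less_imp_le)
  \<comment> \<open>If \<open>e - 1 = f i\<close>, then \<open>c * (e + 1)\<close> equals
    \<open>c * (f i + 2)\<close>, which explains the offset 2; the condition
    \<open>c \<le> f k\<close> settles the case \<open>e = 0\<close>.\<close>
  have "\<exists>f. \<forall>k. (f k \<in> I \<and> c \<le> f k) \<and> c * (f k + 2) \<le> f (Suc k)"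
  proof (rule dependent_nat_choice)
    obtain y where "y \<in> I" "c * (0 + 2) \<le> y" using unb by blast
    then show "\<exists>x. x \<in> I \<and> c \<le> x" by (intro exI[of _ y]) auto
  next
    fix x k assume "x \<in> I \<and> c \<le> x"
    obtain y where "y \<in> I" "c * (x + 2) \<le> y" using unb by blast
    moreover have "c \<le> c * (x + 2)" by simp
    ultimately show "\<exists>y. (y \<in> I \<and> c \<le> y) \<and> c * (x + 2) \<le> y"
      by (intro exI[of _ y]) auto
  qed
  then obtain f where f: "\<And>k. f k \<in> I" "\<And>k. c \<le> f k" "\<And>k. c * (f k + 2) \<le> f (Suc k)" by blast
  have "f k < f (Suc k)" for k
  proof -
    have "1 * (f k + 2) \<le> c * (f k + 2)" by (rule mult_le_mono1[OF assms(2)])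
    then show ?thesis using f(3)[of k] by simp
  qed
  then have mono: "strict_mono f" by (rule strict_monoI_Suc)
  show ?thesis
  proof (rule that[of "range f"])
    show "range f \<subseteq> I" using f by auto
    show "infinite (range f)" using mono by (simp add: range_inj_infinite strict_mono_imp_inj_on)
    fix j e assume "j \<in> range f" "e \<le> j" "e = 0 \<or> e - 1 \<in> range f"
    then obtain k where k: "j = f k" by blast
    show "c * (e + 1) \<le> j"
    proof (cases "e = 0")
      case True
      then show ?thesis using f(2)[of k] k by simp
    next
      case False
      then obtain i where i: "e - 1 = f i" using \<open>e = 0 \<or> e - 1 \<in> range f\<close> by blast
      then have "f i < f k" using \<open>e \<le> j\<close> k False by simp
      then have "Suc i \<le> k" using mono by (simp add: strict_mono_less)
      then have "f (Suc i) \<le> f k" using mono by (simp add: strict_mono_less_eq)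
      moreover have "f i + 2 = e + 1" using i False by simp
      ultimately show ?thesis using f(3)[of i] k by simp
    qed
  qed
qed

text \<open>In the application \<open>I\<close> collects the n with \<psi>(n + 1) \<le> B^(n+1).
  Large digits are placed only at a very sparse infinite subset of \<open>I\<close>, which is enough
  for a limsup set.\<close>

lemma hausdorff_dim_ge_exponential:
  assumes s: "1 / 2 < s" and B: "1 < B" and P: "s * ln B < pressure s" and I: "infinite I"
    and A: "\<And>a. pos_seq a \<Longrightarrow> \<exists>\<^sub>\<infinity>n. n \<in> I \<and> B ^ Suc n \<le> real (a n) \<Longrightarrow> cval a \<in> A"
  shows "ereal s \<le> hausdorff_dim A"
proof -
  have lnB: "0 < ln B" using B by simp
  have s1: "s \<le> 1"
  proof (rule ccontr)
    assume "\<not> s \<le> 1"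
    then have "pressure s \<le> pressure 1 - (s - 1) * ln 2" "0 < (s - 1) * ln 2"
      using pressure_decreasing[of 1 s] by auto
    moreover have "0 < s * ln B" using s lnB by simp
    ultimately show False using P pressure_1 by linarith
  qed
  have "ln B < pressure s / s" using P s by (simp add: field_simps)
  \<comment> \<open>The rate \<beta> lies below P(s) / s, so that finitely many words can realise
    it, and above \<open>ln B\<close>, so that the accumulated decay outweighs the digits of size
    about B^n.\<close>
  then obtain \<beta> where \<beta>: "ln B < \<beta>" "\<beta> < pressure s / s" using dense by blast
  have \<beta>0: "0 < \<beta>" using \<beta> lnB by simp
  have gap: "0 < pressure s - \<beta> * s" using \<beta> s by (simp add: field_simps)
  \<comment> \<open>Three losses per block have to be compensated: 64^s from \<open>F_sum\<close>,
    4^s from comparing \<open>psum\<close> with the pressure, and exp (\<beta> s) for the extra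
    digit 2.\<close>
  obtain m :: nat where m: "s * ln 64 + s * ln 4 + \<beta> * s < real m * (pressure s - \<beta> * s)"
    using reals_Archimedean3[OF gap] by blast
  have "64 powr s * exp (\<beta> * s * real (Suc m)) < psum m s"
  proof -
    have "s * ln 64 + \<beta> * s * real (Suc m) < real m * pressure s - s * ln 4"
      using m by (simp add: algebra_simps)
    also have "\<dots> \<le> ln (psum m s)"
      using pressure_limit(2)[OF s, of m] by linarith
    finally have "exp (s * ln 64 + \<beta> * s * real (Suc m)) < exp (ln (psum m s))"
      by (subst exp_less_cancel_iff)
    then show ?thesis using psum_pos[OF s, of m] by (simp add: exp_add powr_def)
  qed
  moreover have "(sum (weight s) \<longlongrightarrow> psum m s) (finite_subsets_at_top (words m))"
    using has_sum_infsum[OF summable_weight[OF s, of m]] by (simp add: has_sum_def psum_def)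
  ultimately have "eventually (\<lambda>F. 64 powr s * exp (\<beta> * s * real (Suc m)) < sum (weight s) F)
      (finite_subsets_at_top (words m))"
    by (rule order_tendstoD(1)[rotated])
  then obtain F where F: "finite F" "F \<subseteq> words m"
      "64 powr s * exp (\<beta> * s * real (Suc m)) < sum (weight s) F"
    unfolding eventually_finite_subsets_at_top by blast
  have "F \<noteq> {}"
  proof
    assume "F = {}"
    then have "64 powr s * exp (\<beta> * s * real (Suc m)) < 0" using F(3) by simp
    moreover have "0 < 64 powr s * exp (\<beta> * s * real (Suc m))" by simp
    ultimately show False by linarith
  qed
  then have "\<exists>p. set_pmf p = F \<and> (\<forall>v\<in>F. pmf p v = weight s v / sum (weight s) F)"
    using F(2) by (intro ex_weighted_pmf[OF F(1)] weight_pos) (auto simp: words_def)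
  then obtain ord where ord: "set_pmf ord = F"
      "\<And>v. v \<in> F \<Longrightarrow> pmf ord v = weight s v / sum (weight s) F"
    by blast
  define M where "M = Max (insert 2 (\<Union>v\<in>F. set v))"
  have fin: "finite (insert 2 (\<Union>v\<in>F. set v))" using F by simp
  have M: "2 \<le> M" "\<And>v a. v \<in> F \<Longrightarrow> a \<in> set v \<Longrightarrow> a \<le> M"
    unfolding M_def using fin by (auto intro!: Max_ge)
  define K where "K = real ((M + 1) ^ Suc m)"
  have K: "1 \<le> K" by (simp add: K_def del: power_Suc)
  define C where "C = (4 * K) powr (2 * s)"
  have C: "1 \<le> C" unfolding C_def using K s by (intro ge_one_powr_ge_zero) auto
  define l where "l = real (Suc m)"
  have l: "0 < l" by (simp add: l_def)
  \<comment> \<open>After taking logarithms, \<open>sparse\<close> reads ln C + s ln 2 + s l ln B +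
    \<beta> s l e \<le> \<mu> j. The left side is at most H (e + 1), so j \<ge> c (e + 1) with \<mu>
    c \<ge> H suffices.\<close>
  define H where "H = ln C + s * ln 2 + s * ln B * l + \<beta> * s * l"
  define \<mu> where "\<mu> = s * l * (\<beta> - ln B)"
  have \<mu>: "0 < \<mu>" using s l \<beta> by (simp add: \<mu>_def)
  obtain c0 :: nat where c0: "H < real c0 * \<mu>" using reals_Archimedean3[OF \<mu>] by blast
  define c where "c = max 1 c0"
  have c: "1 \<le> c" "H \<le> \<mu> * real c"
  proof -
    have "real c0 * \<mu> \<le> real c * \<mu>" using \<mu> by (intro mult_right_mono) (auto simp: c_def)
    then show "H \<le> \<mu> * real c" using c0 by (simp add: mult.commute)
  qed (simp add: c_def)
  have "infinite ((\<lambda>n. n div Suc m) ` I)"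
  proof
    assume "finite ((\<lambda>n. n div Suc m) ` I)"
    then obtain b where b: "\<forall>x\<in>(\<lambda>n. n div Suc m) ` I. x \<le> b" using finite_nat_set_iff_bounded_le by blast
    have "n < Suc m * Suc b" if "n \<in> I" for n
    proof -
      have "n div Suc m < Suc b" using b that by (simp add: less_Suc_eq_le)
      then show ?thesis by (simp only: div_less_iff_less_mult[of "Suc m"] mult.commute)
    qed
    then have "I \<subseteq> {..<Suc m * Suc b}" by blast
    then show False using I finite_subset by blast
  qed
  then obtain J where J: "J \<subseteq> (\<lambda>n. n div Suc m) ` I" "infinite J"
    "\<And>j e. j \<in> J \<Longrightarrow> e \<le> j \<Longrightarrow> e = 0 \<or> e - 1 \<in> J \<Longrightarrow> c * (e + 1) \<le> j"
    using infinite_sparse_subset[OF _ c(1)] by blast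
  \<comment> \<open>Several elements of \<open>I\<close> may fall into the same block; one of them
    is selected.\<close>
  define \<nu> where "\<nu> = (\<lambda>j. SOME n. n \<in> I \<and> n div Suc m = j)"
  have \<nu>I: "\<nu> j \<in> I \<and> \<nu> j div Suc m = j" if "j \<in> J" for j
  proof -
    have "\<exists>n. n \<in> I \<and> n div Suc m = j" using J(1) that by blast
    then show ?thesis unfolding \<nu>_def by (rule someI_ex)
  qed
  have sparse: "C * exp (- (\<beta> * s * l * (real j - real e))) \<le> (2 * exp (ln B * (l * (real j + 1)))) powr (- s)"
    if je: "j \<in> J" "e \<le> j" "e = 0 \<or> e - 1 \<in> J" for j e
  proof -
    have "real (c * (e + 1)) \<le> real j" by (intro of_nat_mono J(3) je)
    then have "\<mu> * (real c * (real e + 1)) \<le> \<mu> * real j"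
      using \<mu> by (intro mult_left_mono) (auto simp: algebra_simps)
    moreover have "H * (real e + 1) \<le> \<mu> * real c * (real e + 1)"
      using c(2) by (intro mult_right_mono) auto
    moreover have "\<beta> * s * l * real e \<le> H * real e"
    proof (rule mult_right_mono)
      have "0 \<le> ln C" "0 \<le> s * ln 2" "0 \<le> s * ln B * l" using C s lnB l by auto
      then show "\<beta> * s * l \<le> H" by (simp add: H_def)
    qed simp
    moreover have "0 \<le> \<beta> * s * l" using \<beta>0 s l by simp
    ultimately have "ln C + s * ln 2 + s * ln B * l + \<beta> * s * l * real e \<le> \<mu> * real j"
      by (simp add: H_def algebra_simps)
    then have "ln C - \<beta> * s * l * (real j - real e) \<le> - s * (ln 2 + ln B * (l * (real j + 1)))"
      by (simp add: \<mu>_def algebra_simps)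
    then have "exp (ln C - \<beta> * s * l * (real j - real e)) \<le> exp (- s * (ln 2 + ln B * (l * (real j + 1))))"
      by (subst exp_le_cancel_iff)
    also have "\<dots> = (2 * exp (ln B * (l * (real j + 1)))) powr (- s)"
      by (simp add: powr_def ln_mult)
    finally show ?thesis using C by (simp add: exp_diff exp_minus divide_inverse)
  qed
  interpret random_blocks m M F s \<beta> B J \<nu> ord K
  proof
    show "K = real ((M + 1) ^ Suc m)" by (rule K_def)
    show "64 powr s * exp (\<beta> * s * real (Suc m)) \<le> sum (weight s) F" using F(3) by (rule less_imp_le)
    show "0 \<le> \<beta>" using \<beta>0 by (rule less_imp_le)
    show "\<nu> j div Suc m = j" if "j \<in> J" for j using \<nu>I[OF that] ..
    show "(4 * K) powr (2 * s) * exp (- (\<beta> * s * real (Suc m) * (real j - real e)))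
        \<le> (2 * exp (ln B * (real (Suc m) * (real j + 1)))) powr (- s)"
      if "j \<in> J" "e \<le> j" "e = 0 \<or> e - 1 \<in> J" for j e
      using sparse[OF that] unfolding C_def l_def .
  qed (fact s s1 B F(1,2) M ord)+
  show ?thesis
  proof (rule hausdorff_dim_ge)
    fix a assume a: "pos_seq a" "\<And>j. j \<in> J \<Longrightarrow> B ^ Suc (\<nu> j) \<le> real (a (\<nu> j))"
    have "inj_on \<nu> J" by (rule inj_onI) (metis \<nu>I)
    then have "infinite (\<nu> ` J)" using J(2) by (simp add: finite_image_iff)
    moreover have "\<nu> ` J \<subseteq> {n. n \<in> I \<and> B ^ Suc n \<le> real (a n)}"
    proof (rule image_subsetI)
      fix j assume j: "j \<in> J"
      have "\<nu> j \<in> I" using \<nu>I[OF j] ..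
      then show "\<nu> j \<in> {n. n \<in> I \<and> B ^ Suc n \<le> real (a n)}"
        using a(2)[OF j] by blast
    qed
    ultimately have "\<exists>\<^sub>\<infinity>n. n \<in> I \<and> B ^ Suc n \<le> real (a n)"
      unfolding frequently_cofinite by (meson finite_subset)
    then show "cval a \<in> A" using A a(1) by blast
  qed
qed

section \<open>The dimension formula\<close>

lemma hausdorff_dim_nonneg: "0 \<le> hausdorff_dim A"
  unfolding hausdorff_dim_def by (intro INF_greatest) auto

lemma ereal_eq_dense:
  fixes x :: ereal
  assumes "c < r" and upper: "\<And>s. r < s \<Longrightarrow> x \<le> ereal s" and lower: "\<And>s. c < s \<Longrightarrow> s < r \<Longrightarrow> ereal s \<le> x"
  shows "x = ereal r"
proof (rule antisym)
  show "x \<le> ereal r"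
  proof (rule ereal_le_epsilon2)
    fix e :: real assume "0 < e"
    then show "x \<le> ereal r + ereal e" using upper[of "r + e"] by simp
  qed
  show "ereal r \<le> x"
  proof (rule ereal_le_epsilon2)
    fix e :: real assume e: "0 < e"
    define s where "s = max (r - e) ((c + r) / 2)"
    have "c < s" "s < r" using assms(1) e by (auto simp: s_def less_max_iff_disj field_simps)
    then have "ereal s \<le> x" by (rule lower)
    moreover have "r - e \<le> s" by (simp add: s_def)
    then have "ereal r \<le> ereal s + ereal e" by simp
    ultimately show "ereal r \<le> x + ereal e" by (meson add_right_mono order_trans)
  qed
qed

section \<open>From limits inferior to the growth of \<psi>\<close>

lemma exp_divide_power: "exp (x / real (Suc n)) ^ Suc n = exp (x :: real)"
  by (subst exp_of_nat_mult[symmetric]) (simp del: of_nat_Suc)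

lemma eventually_power_le_exp:
  fixes g :: "nat \<Rightarrow> real"
  assumes c: "0 < c" "ereal c < liminf (\<lambda>n. ereal (exp (g n / real n)))"
  shows "\<forall>\<^sub>F n in cofinite. c ^ Suc n \<le> exp (g (Suc n))"
proof -
  have "\<forall>\<^sub>F n in sequentially. ereal c < ereal (exp (g n / real n))"
    using c(2) by (rule less_LiminfD)
  then have "\<forall>\<^sub>F n in sequentially. ereal c < ereal (exp (g (Suc n) / real (Suc n)))"
    by (subst eventually_sequentially_Suc)
  then show ?thesis
    unfolding cofinite_eq_sequentially
  proof eventually_elim
    case (elim n)
    then have "c ^ Suc n \<le> exp (g (Suc n) / real (Suc n)) ^ Suc n"
      using c by (intro power_mono) auto
    then show ?case unfolding exp_divide_power .
  qed
qed

lemma frequently_exp_le_power: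
  fixes g :: "nat \<Rightarrow> real"
  assumes "liminf (\<lambda>n. ereal (exp (g n / real n))) < ereal c"
  shows "\<exists>\<^sub>\<infinity>n. exp (g (Suc n)) \<le> c ^ Suc n"
proof -
  have "\<exists>\<^sub>\<infinity>n. exp (g (Suc n) / real (Suc n)) < c"
  proof (rule ccontr)
    assume "\<not> (\<exists>\<^sub>\<infinity>n. exp (g (Suc n) / real (Suc n)) < c)"
    then have "\<forall>\<^sub>F n in sequentially. ereal c \<le> ereal (exp (g (Suc n) / real (Suc n)))"
      by (simp add: frequently_def cofinite_eq_sequentially not_less del: of_nat_Suc)
    then have "\<forall>\<^sub>F n in sequentially. ereal c \<le> ereal (exp (g n / real n))"
      by (subst (asm) eventually_sequentially_Suc)
    then have "ereal c \<le> liminf (\<lambda>n. ereal (exp (g n / real n)))" by (rule Liminf_bounded)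
    then show False using assms by simp
  qed
  then show ?thesis
  proof (rule frequently_elim1)
    fix n assume "exp (g (Suc n) / real (Suc n)) < c"
    then have "exp (g (Suc n) / real (Suc n)) ^ Suc n \<le> c ^ Suc n"
      by (intro power_mono) auto
    then show "exp (g (Suc n)) \<le> c ^ Suc n" unfolding exp_divide_power .
  qed
qed

lemma A_setE:
  assumes "x \<in> A_set \<psi>" and "\<forall>\<^sub>F n in cofinite. h n \<le> \<psi> (real (Suc n))"
  shows "x \<in> cval ` {a. pos_seq a \<and> (\<exists>\<^sub>\<infinity>n. h n \<le> real (a n))}"
proof -
  obtain a where a: "pos_seq a" "\<exists>\<^sub>\<infinity>n. \<psi> (real (Suc n)) \<le> real (a n)" "x = cval a"
    using assms(1) by (auto simp: A_set_eq)
  have "\<exists>\<^sub>\<infinity>n. \<psi> (real (Suc n)) \<le> real (a n) \<and> h n \<le> \<psi> (real (Suc n))"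
    using a(2) assms(2) by (rule frequently_eventually_frequently)
  then have "\<exists>\<^sub>\<infinity>n. h n \<le> real (a n)" by (rule frequently_elim1) linarith
  then show ?thesis using a by blast
qed

context
  fixes \<psi> :: "real \<Rightarrow> real"
  assumes \<psi>: "\<forall>t>0. 0 < \<psi> t"
begin

lemma exp_ln_\<psi>: "exp (ln (\<psi> (real (Suc n)))) = \<psi> (real (Suc n))"
  using \<psi>[rule_format, of "real (Suc n)"] by simp

lemma A_set_dim_le:
  assumes s: "1 / 2 < s" and c: "1 \<le> c" "ereal c < B_lower \<psi>" and P: "pressure s < s * ln c"
  shows "hausdorff_dim (A_set \<psi>) \<le> ereal s"
proof (rule hausdorff_dim_le_exponential[OF s c(1) P], rule subsetI, erule A_setE)
  have "\<forall>\<^sub>F n in cofinite. c ^ Suc n \<le> \<psi> (real (Suc n))"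
    using eventually_power_le_exp[of c "\<lambda>n. ln (\<psi> (real n))"] c by (simp only: exp_ln_\<psi> B_lower_def)
  then show "\<forall>\<^sub>F n in cofinite. c ^ n \<le> \<psi> (real (Suc n))"
  proof eventually_elim
    case (elim n)
    have "c ^ n \<le> c ^ Suc n" using c by (intro power_increasing) auto
    then show ?case using elim by linarith
  qed
qed

lemma A_set_dim_ge:
  assumes s: "1 / 2 < s" and c: "1 < c" "B_lower \<psi> < ereal c" and P: "s * ln c < pressure s"
  shows "ereal s \<le> hausdorff_dim (A_set \<psi>)"
proof (rule hausdorff_dim_ge_exponential[OF s c(1) P])
  have "\<exists>\<^sub>\<infinity>n. exp (ln (\<psi> (real (Suc n)))) \<le> c ^ Suc n"
    using c(2) unfolding B_lower_def by (rule frequently_exp_le_power)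
  then show "infinite {n. \<psi> (real (Suc n)) \<le> c ^ Suc n}"
    unfolding exp_ln_\<psi> frequently_cofinite .
  fix a
  assume a: "pos_seq a" "\<exists>\<^sub>\<infinity>n. n \<in> {n. \<psi> (real (Suc n)) \<le> c ^ Suc n} \<and> c ^ Suc n \<le> real (a n)"
  have "\<exists>\<^sub>\<infinity>n. \<psi> (real (Suc n)) \<le> real (a n)"
    using a(2) by (rule frequently_elim1) auto
  then show "cval a \<in> A_set \<psi>" using a(1) by (auto simp: A_set_eq)
qed

text \<open>Infinite B gives \<psi>(n) \<ge> e^n eventually, so ln \<psi>(n) \<ge> 1 for large n.
  Besides the bound on b, the positivity is needed to undo the outer logarithm, which takes a
  default value at nonpositive arguments.\<close>

lemma one_le_b_lower:
  assumes B: "B_lower \<psi> = \<infinity>"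
  shows "\<forall>\<^sub>F n in cofinite. 0 < ln (\<psi> (real (Suc n)))" and "1 \<le> b_lower \<psi>"
proof -
  have "\<forall>\<^sub>F n in cofinite. exp 1 ^ Suc n \<le> exp (ln (\<psi> (real (Suc n))))"
    by (rule eventually_power_le_exp) (use B in \<open>auto simp: B_lower_def\<close>)
  then have ev: "\<forall>\<^sub>F n in cofinite. 1 \<le> ln (\<psi> (real (Suc n)))"
  proof eventually_elim
    case (elim n)
    then have "exp (real (Suc n) * 1) \<le> exp (ln (\<psi> (real (Suc n))))" by (simp only: exp_of_nat_mult)
    then have "real (Suc n) * 1 \<le> ln (\<psi> (real (Suc n)))" by (subst (asm) exp_le_cancel_iff)
    then show ?case by simp
  qed
  then show "\<forall>\<^sub>F n in cofinite. 0 < ln (\<psi> (real (Suc n)))" by eventually_elim linarith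
  have "\<forall>\<^sub>F n in sequentially. 1 \<le> ln (\<psi> (real n))"
    using ev unfolding cofinite_eq_sequentially by (subst (asm) eventually_sequentially_Suc)
  then have "\<forall>\<^sub>F n in sequentially. 1 \<le> ereal (exp (ln (ln (\<psi> (real n))) / real n))"
  proof eventually_elim
    case (elim n)
    then have "0 \<le> ln (ln (\<psi> (real n))) / real n" by simp
    then show ?case by (simp add: one_ereal_def)
  qed
  then show "1 \<le> b_lower \<psi>" unfolding b_lower_def by (rule Liminf_bounded)
qed

lemma A_set_dim_le_double:
  assumes B: "B_lower \<psi> = \<infinity>" and d: "1 < d" "ereal d < b_lower \<psi>" and s: "1 / (1 + d) < s"
  shows "hausdorff_dim (A_set \<psi>) \<le> ereal s"
proof (rule hausdorff_dim_le_double_exponential[OF d(1) s], rule subsetI, erule A_setE)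
  have "\<forall>\<^sub>F n in cofinite. d ^ Suc n \<le> exp (ln (ln (\<psi> (real (Suc n)))))"
    by (rule eventually_power_le_exp) (use d in \<open>auto simp: b_lower_def\<close>)
  then show "\<forall>\<^sub>F n in cofinite. exp (d ^ n) \<le> \<psi> (real (Suc n))"
    using one_le_b_lower(1)[OF B]
  proof eventually_elim
    case (elim n)
    have "d ^ n \<le> d ^ Suc n" using d by (intro power_increasing) auto
    also have "\<dots> \<le> ln (\<psi> (real (Suc n)))" using elim by simp
    finally have "exp (d ^ n) \<le> exp (ln (\<psi> (real (Suc n))))" by (subst exp_le_cancel_iff)
    then show ?case unfolding exp_ln_\<psi> .
  qed
qed

lemma A_set_dim_ge_double:
  assumes B: "B_lower \<psi> = \<infinity>" and d: "1 < d" "b_lower \<psi> < ereal d" and s: "0 < s" "s < 1 / (1 + d)"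
  shows "ereal s \<le> hausdorff_dim (A_set \<psi>)"
proof (rule hausdorff_dim_ge_double_exponential[OF d(1) s])
  have "\<exists>\<^sub>\<infinity>n. exp (ln (ln (\<psi> (real (Suc n))))) \<le> d ^ Suc n"
    using d(2) unfolding b_lower_def by (rule frequently_exp_le_power)
  then have "\<exists>\<^sub>\<infinity>n. exp (ln (ln (\<psi> (real (Suc n))))) \<le> d ^ Suc n \<and> 0 < ln (\<psi> (real (Suc n)))"
    using one_le_b_lower(1)[OF B] by (rule frequently_eventually_frequently)
  then have freq: "\<exists>\<^sub>\<infinity>n. \<psi> (real (Suc n)) \<le> exp (d ^ Suc n)"
  proof (rule frequently_elim1)
    fix n assume "exp (ln (ln (\<psi> (real (Suc n))))) \<le> d ^ Suc n \<and> 0 < ln (\<psi> (real (Suc n)))"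
    then have "ln (\<psi> (real (Suc n))) \<le> d ^ Suc n" by (elim conjE) (simp only: exp_ln)
    then have "exp (ln (\<psi> (real (Suc n)))) \<le> exp (d ^ Suc n)" by (subst exp_le_cancel_iff)
    then show "\<psi> (real (Suc n)) \<le> exp (d ^ Suc n)" unfolding exp_ln_\<psi> .
  qed
  show "cval ` {a. pos_seq a \<and> (\<forall>n. exp (d ^ Suc n) \<le> real (a n))} \<subseteq> A_set \<psi>"
  proof clarify
    fix a assume a: "pos_seq a" "\<forall>n. exp (d ^ Suc n) \<le> real (a n)"
    have "\<exists>\<^sub>\<infinity>n. \<psi> (real (Suc n)) \<le> real (a n)"
      using freq by (rule frequently_elim1) (use a(2) order_trans in blast)
    then show "cval a \<in> A_set \<psi>" using a(1) by (auto simp: A_set_eq)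
  qed
qed

end

text \<open>For s > 1 the pressure is negative, and the trivial digit bound 1, valid for every
  point, already gives the cover. For s < 1 it is positive and therefore exceeds s ln c for every c
  > 1 close enough to 1.\<close>

lemma A_set_dim_of_B_lower_1:
  assumes \<psi>: "\<forall>t>0. 0 < \<psi> t" and B: "B_lower \<psi> = 1"
  shows "hausdorff_dim (A_set \<psi>) = 1"
  unfolding one_ereal_def
proof (rule ereal_eq_dense[where c = "1 / 2"])
  fix s :: real assume s: "1 < s"
  then have "0 < (s - 1) * ln 2" by simp
  moreover have "pressure s \<le> pressure 1 - (s - 1) * ln 2"
    using s by (intro pressure_decreasing) auto
  ultimately have P: "pressure s < s * ln 1" unfolding pressure_1 ln_one by linarith
  have "A_set \<psi> \<subseteq> cval ` {a. pos_seq a \<and> (\<exists>\<^sub>\<infinity>n. 1 ^ n \<le> real (a n))}"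
    by (auto simp: A_set_eq pos_seq_def INFM_const)
  then show "hausdorff_dim (A_set \<psi>) \<le> ereal s"
    using s by (intro hausdorff_dim_le_exponential[OF _ _ P]) auto
next
  fix s :: real assume s: "1 / 2 < s" "s < 1"
  then have "0 < (1 - s) * ln 2" by simp
  moreover have "pressure 1 \<le> pressure s - (1 - s) * ln 2"
    using s by (intro pressure_decreasing) auto
  ultimately have "0 < pressure s" unfolding pressure_1 by linarith
  then have "0 < pressure s / s" using s by simp
  then obtain y where y: "0 < y" "y < pressure s / s" using dense by blast
  show "ereal s \<le> hausdorff_dim (A_set \<psi>)"
  proof (rule A_set_dim_ge[OF \<psi> s(1), of "exp y"])
    show "s * ln (exp y) < pressure s" using y s by (simp add: field_simps)
  qed (use y B in auto)
qed simp

text \<open>Off the root the pressure inequality is strict, so \<open>ln b\<close> can be replaced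
  by a nearby y: below it for the cover, where \<psi> eventually exceeds exp (y n), and above it for
  the construction, where \<psi> stays below exp (y n) infinitely often.\<close>

lemma A_set_dim_of_B_lower_finite:
  assumes \<psi>: "\<forall>t>0. 0 < \<psi> t" and B: "B_lower \<psi> = ereal b" "1 < b"
  shows "\<exists>!\<theta>. 1 / 2 < \<theta> \<and> pressure \<theta> = \<theta> * ln b"
    and "hausdorff_dim (A_set \<psi>) = ereal (pressure_root (ln b))"
proof -
  have L: "0 < ln b" using B by simp
  obtain \<theta> where \<theta>: "1 / 2 < \<theta>" "\<theta> < 1" "pressure \<theta> = \<theta> * ln b" "pressure_root (ln b) = \<theta>"
    "\<exists>!\<theta>. 1 / 2 < \<theta> \<and> pressure \<theta> = \<theta> * ln b"
    "\<And>s. \<theta> < s \<Longrightarrow> pressure s < s * ln b"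
    "\<And>s. 1 / 2 < s \<Longrightarrow> s < \<theta> \<Longrightarrow> s * ln b < pressure s"
    by (rule pressure_root_exists[OF L], rule that; assumption)
  show "\<exists>!\<theta>. 1 / 2 < \<theta> \<and> pressure \<theta> = \<theta> * ln b" by (rule \<theta>(5))
  show "hausdorff_dim (A_set \<psi>) = ereal (pressure_root (ln b))"
    unfolding \<theta>(4)
  proof (rule ereal_eq_dense[OF \<theta>(1)])
    fix s assume s: "\<theta> < s"
    have "pressure s / s < ln b" using \<theta>(6)[OF s] s \<theta>(1) by (simp add: field_simps)
    then have "max 0 (pressure s / s) < ln b" using L by simp
    then obtain y where y: "max 0 (pressure s / s) < y" "y < ln b" using dense by blast
    have "exp y < exp (ln b)" using y by simp
    then have yb: "exp y < b" using B by simp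
    show "hausdorff_dim (A_set \<psi>) \<le> ereal s"
    proof (rule A_set_dim_le[OF \<psi>, of s "exp y"])
      show "pressure s < s * ln (exp y)" using y s \<theta>(1) by (simp add: field_simps)
    qed (use y yb B s \<theta>(1) in auto)
  next
    fix s assume s: "1 / 2 < s" "s < \<theta>"
    have "ln b < pressure s / s" using \<theta>(7)[OF s] s by (simp add: field_simps)
    then obtain y where y: "ln b < y" "y < pressure s / s" using dense by blast
    have y0: "0 < y" using y L by linarith
    have "exp (ln b) < exp y" using y by simp
    then have yb: "b < exp y" using B by simp
    show "ereal s \<le> hausdorff_dim (A_set \<psi>)"
    proof (rule A_set_dim_ge[OF \<psi> s(1), of "exp y"])
      show "s * ln (exp y) < pressure s" using y s by (simp add: field_simps)
    qed (use y0 yb B in auto)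
  qed
qed

lemma A_set_dim_of_B_lower_infinite:
  assumes \<psi>: "\<forall>t>0. 0 < \<psi> t" and B: "B_lower \<psi> = \<infinity>"
  shows "hausdorff_dim (A_set \<psi>) = 1 / (b_lower \<psi> + 1)"
proof (cases "b_lower \<psi>")
  case (real b)
  then have b: "1 \<le> b" using one_le_b_lower(2)[OF \<psi> B] by (simp add: one_ereal_def)
  have "hausdorff_dim (A_set \<psi>) = ereal (1 / (1 + b))"
  proof (rule ereal_eq_dense[where c = 0])
    show "0 < 1 / (1 + b)" using b by simp
    fix s assume s: "1 / (1 + b) < s"
    have "0 < 1 / (1 + b)" using b by simp
    then have s0: "0 < s" using s by linarith
    show "hausdorff_dim (A_set \<psi>) \<le> ereal s"
    \<comment> \<open>For b = 1 no d with 1 < d < b exists. Then s > 1/2, and since B is infinite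
      the exponential cover applies with c so large that P(s) < s ln c.\<close>
    proof (cases "b = 1")
      case True
      let ?y = "max 1 (pressure s / s + 1)"
      have "pressure s / s < ?y" by simp
      then have "pressure s < s * ln (exp ?y)" using s0 by (simp add: field_simps)
      then show ?thesis using s True B
        by (intro A_set_dim_le[OF \<psi>, where c = "exp ?y"]) auto
    next
      case False
      have "1 / s - 1 < b" using s s0 b by (simp add: field_simps)
      then have "max 1 (1 / s - 1) < b" using False b by simp
      then obtain d where d: "max 1 (1 / s - 1) < d" "d < b" using dense by blast
      have "1 / (1 + d) < s" using d s0 by (simp add: field_simps)
      then show ?thesis using d real by (intro A_set_dim_le_double[OF \<psi> B]) auto
    qed
  next
    fix s assume s: "0 < s" "s < 1 / (1 + b)"
    have "b < 1 / s - 1" using s b by (simp add: field_simps)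
    then obtain d where d: "b < d" "d < 1 / s - 1" using dense by blast
    have "s < 1 / (1 + d)" using d s b by (simp add: field_simps)
    then show "ereal s \<le> hausdorff_dim (A_set \<psi>)"
      using d real b s by (intro A_set_dim_ge_double[OF \<psi> B, where d = d]) auto
  qed
  also have "ereal (1 / (1 + b)) = 1 / (b_lower \<psi> + 1)"
    using b by (simp add: real one_ereal_def add.commute)
  finally show ?thesis .
next
  case PInf
  have "hausdorff_dim (A_set \<psi>) \<le> 0"
  proof (rule ereal_le_epsilon2)
    fix s :: real assume s: "0 < s"
    define d where "d = max 2 (1 / s)"
    have d: "1 < d" "1 / s < 1 + d" by (auto simp: d_def)
    then have "1 / (1 + d) < s" using s by (simp add: field_simps)
    then have "hausdorff_dim (A_set \<psi>) \<le> ereal s"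
      using PInf d by (intro A_set_dim_le_double[OF \<psi> B, of d]) auto
    then show "hausdorff_dim (A_set \<psi>) \<le> 0 + ereal s" by simp
  qed
  then show ?thesis using hausdorff_dim_nonneg[of "A_set \<psi>"] PInf by simp
next
  case MInf
  then show ?thesis using one_le_b_lower(2)[OF \<psi> B] by simp
qed

theorem theorem3:
  fixes \<psi> :: "real \<Rightarrow> real"
  assumes "\<And>t. 0 < t \<Longrightarrow> 0 < \<psi> t"
  shows "(B_lower \<psi> = 1 \<longrightarrow> hausdorff_dim (A_set \<psi>) = 1) \<and>
    (1 < B_lower \<psi> \<and> B_lower \<psi> < \<infinity> \<longrightarrow>
       (\<exists>!\<theta>. 1 / 2 < \<theta> \<and> pressure \<theta> = \<theta> * ln (real_of_ereal (B_lower \<psi>))) \<and>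
       hausdorff_dim (A_set \<psi>) = ereal (pressure_root (ln (real_of_ereal (B_lower \<psi>))))) \<and>
    (B_lower \<psi> = \<infinity> \<longrightarrow> hausdorff_dim (A_set \<psi>) = 1 / (b_lower \<psi> + 1))"
proof -
  have pos: "\<forall>t>0. 0 < \<psi> t" using assms by blast
  show ?thesis
  proof (intro conjI impI)
    assume "B_lower \<psi> = 1"
    then show "hausdorff_dim (A_set \<psi>) = 1" by (rule A_set_dim_of_B_lower_1[OF pos])
  next
    assume B: "1 < B_lower \<psi> \<and> B_lower \<psi> < \<infinity>"
    then obtain b where b: "B_lower \<psi> = ereal b" "1 < b" by (cases "B_lower \<psi>") auto
    show "\<exists>!\<theta>. 1 / 2 < \<theta> \<and> pressure \<theta> = \<theta> * ln (real_of_ereal (B_lower \<psi>))"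
      using A_set_dim_of_B_lower_finite(1)[OF pos b] by (simp add: b(1))
    show "hausdorff_dim (A_set \<psi>) = ereal (pressure_root (ln (real_of_ereal (B_lower \<psi>))))"
      using A_set_dim_of_B_lower_finite(2)[OF pos b] by (simp add: b(1))
  next
    assume "B_lower \<psi> = \<infinity>"
    then show "hausdorff_dim (A_set \<psi>) = 1 / (b_lower \<psi> + 1)"
      by (rule A_set_dim_of_B_lower_infinite[OF pos])
  qed
qed

end
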